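(* Let $\mathcal{C}$ be a graph class characterized by a set of forbidden patterns on three vertices, and assume $\mathcal{C}$ is none of the classes of comparability graphs, co-comparability graphs, triangle-free graphs, and co-triangle-free graphs. Then there exists a set $\mathcal{F}$ of forbidden patterns characterizing $\mathcal{C}$ such that, given an ordered graph $(G,\tau)$ with $n$ vertices and $m$ edges (by adjacency lists), one can decide in time $O(n+m)$ whether $(G,\tau)$ contains at least one pattern of $\mathcal{F}$.
   Context: A pattern $P$ consists of a finite totally ordered vertex set $V(P)$ together with a partition of the unordered pairs of distinct vertices into mandatory edges $M(P)$, forbidden edges $F(P)$ and undecided pairs $U(P)$. An ordered graph $(G,\tau)$ is a finite simple graph with a total order $\tau$ on its vertices. $(G,\tau)$ contains $P$ if there is $X\subseteq V(G)$ with $|X|=|V(P)|$ such that, identifying $X$ with $V(P)$ via the order-preserving bijection, all pairs of $M(P)$ are edges and all pairs of $F(P)$ are non-edges of $G$. A class $\mathcal{C}$ is characterized by a set $\mathcal{F}$ of forbidden patterns if a graph $G$ belongs to $\mathcal{C}$ if and only if there exists a total order $\tau$ of $V(G)$ such that $(G,\tau)$ contains no pattern of $\mathcal{F}$. Comparability graphs are graphs admitting a transitive orientation; co-comparability graphs are their complements; co-triangle-free graphs are complements of triangle-free graphs. *)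

theory Defs
  imports Main
begin

section \<open>Graphs and graph classes\<close>

record 'a ugraph =
  verts :: "'a set"
  edges :: "'a set set"

definition pairs :: "'a set \<Rightarrow> 'a set set" where
  "pairs V = {{u, v} | u v. u \<in> V \<and> v \<in> V \<and> u \<noteq> v}"

definition simple_graph :: "'a ugraph \<Rightarrow> bool" where
  "simple_graph G \<longleftrightarrow> finite (verts G) \<and> edges G \<subseteq> pairs (verts G)"

definition complement :: "'a ugraph \<Rightarrow> 'a ugraph" where
  "complement G = \<lparr>verts = verts G, edges = pairs (verts G) - edges G\<rparr>"

definition transitive_orientation :: "'a ugraph \<Rightarrow> ('a \<times> 'a) set \<Rightarrow> bool" where
  "transitive_orientation G A \<longleftrightarrow>
     (\<forall>(u, v) \<in> A. {u, v} \<in> edges G) \<and>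
     (\<forall>u v. {u, v} \<in> edges G \<longrightarrow> ((u, v) \<in> A) \<noteq> ((v, u) \<in> A)) \<and>
     trans A"

text \<open>A graph class is a set of finite simple graphs whose vertices are natural numbers; every
  finite graph is isomorphic to such a graph.\<close>

definition comparability_graphs :: "nat ugraph set" where
  "comparability_graphs = {G. simple_graph G \<and> (\<exists>A. transitive_orientation G A)}"

definition co_comparability_graphs :: "nat ugraph set" where
  "co_comparability_graphs = {G. simple_graph G \<and> complement G \<in> comparability_graphs}"

definition triangle_free_graphs :: "nat ugraph set" where
  "triangle_free_graphs =
     {G. simple_graph G \<and> \<not> (\<exists>u v w. {{u, v}, {v, w}, {u, w}} \<subseteq> edges G)}"

definition co_triangle_free_graphs :: "nat ugraph set" where
  "co_triangle_free_graphs = {G. simple_graph G \<and> complement G \<in> triangle_free_graphs}"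


section \<open>Patterns\<close>

text \<open>As for graphs, taking the vertices of a pattern to be natural numbers is no restriction up
  to isomorphism. The total order is an arbitrary one, not necessarily the one of the naturals.\<close>

record pattern =
  pverts :: "nat set"
  porder :: "nat rel"
  mandatory :: "nat set set"
  forbidden :: "nat set set"
  undecided :: "nat set set"

definition is_pattern :: "pattern \<Rightarrow> bool" where
  "is_pattern P \<longleftrightarrow>
     finite (pverts P) \<and> linear_order_on (pverts P) (porder P) \<and>
     mandatory P \<union> forbidden P \<union> undecided P = pairs (pverts P) \<and>
     mandatory P \<inter> forbidden P = {} \<and>
     mandatory P \<inter> undecided P = {} \<and>
     forbidden P \<inter> undecided P = {}"

definition ordered_graph :: "'a ugraph \<Rightarrow> 'a rel \<Rightarrow> bool" where
  "ordered_graph G \<tau> \<longleftrightarrow> simple_graph G \<and> linear_order_on (verts G) \<tau>"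

definition contains_pattern :: "'a ugraph \<Rightarrow> 'a rel \<Rightarrow> pattern \<Rightarrow> bool" where
  "contains_pattern G \<tau> P \<longleftrightarrow>
     (\<exists>X \<phi>. X \<subseteq> verts G \<and> card X = card (pverts P) \<and> bij_betw \<phi> (pverts P) X \<and>
        (\<forall>a \<in> pverts P. \<forall>b \<in> pverts P. (a, b) \<in> porder P \<longleftrightarrow> (\<phi> a, \<phi> b) \<in> \<tau>) \<and>
        (\<forall>e \<in> mandatory P. \<phi> ` e \<in> edges G) \<and>
        (\<forall>e \<in> forbidden P. \<phi> ` e \<notin> edges G))"

definition characterizes :: "pattern set \<Rightarrow> nat ugraph set \<Rightarrow> bool" where
  "characterizes F C \<longleftrightarrow>
     C = {G. simple_graph G \<and>
             (\<exists>\<tau>. ordered_graph G \<tau> \<and> (\<forall>P \<in> F. \<not> contains_pattern G \<tau> P))}"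


section \<open>A word RAM\<close>

text \<open>Programs are structured programs over finitely many scalar variables and finitely many
  one-dimensional arrays of natural numbers. Each constant, variable access, array access,
  arithmetic operation and assignment takes one unit of time. The parameter \<open>B\<close> of the semantics
  is the largest machine word: an execution in which some evaluated subexpression (in particular
  an array index) exceeds \<open>B\<close> is stuck.\<close>

record state =
  scalar :: "string \<Rightarrow> nat"
  array :: "string \<Rightarrow> nat \<Rightarrow> nat"

datatype binop = Add | Sub | Mul | Div | Lt | Eq

datatype expr =
    Const nat
  | Var string
  | Read string expr
  | Op binop expr expr

fun apply_op :: "binop \<Rightarrow> nat \<Rightarrow> nat \<Rightarrow> nat" where
  "apply_op Add a b = a + b"
| "apply_op Sub a b = a - b"
| "apply_op Mul a b = a * b"
| "apply_op Div a b = a div b"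
| "apply_op Lt a b = of_bool (a < b)"
| "apply_op Eq a b = of_bool (a = b)"

fun eval :: "expr \<Rightarrow> state \<Rightarrow> nat" where
  "eval (Const k) s = k"
| "eval (Var x) s = scalar s x"
| "eval (Read a e) s = array s a (eval e s)"
| "eval (Op f e1 e2) s = apply_op f (eval e1 s) (eval e2 s)"

fun fits :: "nat \<Rightarrow> expr \<Rightarrow> state \<Rightarrow> bool" where
  "fits B (Const k) s \<longleftrightarrow> k \<le> B"
| "fits B (Var x) s \<longleftrightarrow> scalar s x \<le> B"
| "fits B (Read a e) s \<longleftrightarrow> fits B e s \<and> eval (Read a e) s \<le> B"
| "fits B (Op f e1 e2) s \<longleftrightarrow> fits B e1 s \<and> fits B e2 s \<and> eval (Op f e1 e2) s \<le> B"

fun cost :: "expr \<Rightarrow> nat" where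
  "cost (Const k) = 1"
| "cost (Var x) = 1"
| "cost (Read a e) = cost e + 1"
| "cost (Op f e1 e2) = cost e1 + cost e2 + 1"

datatype com =
    Skip
  | Assign string expr
  | Store string expr expr  \<comment> \<open>array, index, value\<close>
  | Seq com com
  | Cond expr com com
  | While expr com

text \<open>\<open>exec B c s t s'\<close>: program \<open>c\<close> started in \<open>s\<close> halts in \<open>s'\<close> after \<open>t\<close> time units. A nonzero
  guard counts as true.\<close>

inductive exec :: "nat \<Rightarrow> com \<Rightarrow> state \<Rightarrow> nat \<Rightarrow> state \<Rightarrow> bool" for B :: nat where
  Skip: "exec B Skip s 1 s"
| Assign: "fits B e s \<Longrightarrow>
    exec B (Assign x e) s (cost e + 1) (s\<lparr>scalar := (scalar s)(x := eval e s)\<rparr>)"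
| Store: "fits B i s \<Longrightarrow> fits B e s \<Longrightarrow>
    exec B (Store a i e) s (cost i + cost e + 1)
      (s\<lparr>array := (array s)(a := (array s a)(eval i s := eval e s))\<rparr>)"
| Seq: "exec B c1 s t1 s1 \<Longrightarrow> exec B c2 s1 t2 s2 \<Longrightarrow>
    exec B (Seq c1 c2) s (t1 + t2) s2"
| CondTrue: "fits B e s \<Longrightarrow> eval e s \<noteq> 0 \<Longrightarrow> exec B c1 s t s' \<Longrightarrow>
    exec B (Cond e c1 c2) s (cost e + t) s'"
| CondFalse: "fits B e s \<Longrightarrow> eval e s = 0 \<Longrightarrow> exec B c2 s t s' \<Longrightarrow>
    exec B (Cond e c1 c2) s (cost e + t) s'"
| WhileFalse: "fits B e s \<Longrightarrow> eval e s = 0 \<Longrightarrow>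
    exec B (While e c) s (cost e) s"
| WhileTrue: "fits B e s \<Longrightarrow> eval e s \<noteq> 0 \<Longrightarrow>
    exec B c s t1 s1 \<Longrightarrow> exec B (While e c) s1 t2 s2 \<Longrightarrow>
    exec B (While e c) s (cost e + t1 + t2) s2"


section \<open>Detecting patterns in linear time\<close>

text \<open>The vertices of an input graph are \<open>0, \<dots>, n - 1\<close>. The list \<open>ord\<close> enumerates them according to
  \<open>\<tau>\<close>, and \<open>adj ! v\<close> lists the neighbours of \<open>v\<close>, each once, in any sequence whatsoever.\<close>

definition represents ::
    "nat list \<Rightarrow> nat list list \<Rightarrow> nat ugraph \<Rightarrow> nat rel \<Rightarrow> bool" where
  "represents ord adj G \<tau> \<longleftrightarrow>
     verts G = {..<length adj} \<and>
     (\<forall>v < length adj. distinct (adj ! v) \<and> set (adj ! v) = {u. {u, v} \<in> edges G}) \<and>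
     distinct ord \<and> set ord = verts G \<and>
     (\<forall>i j. i < j \<longrightarrow> j < length ord \<longrightarrow> (ord ! i, ord ! j) \<in> \<tau>)"

definition array_of :: "nat list \<Rightarrow> nat \<Rightarrow> nat" where
  "array_of xs i = (if i < length xs then xs ! i else 0)"

text \<open>The adjacency lists are stored one after the other in the array \<open>target\<close>; the list of \<open>v\<close>
  occupies the cells from \<open>offset[v]\<close> up to, but excluding, \<open>offset[v + 1]\<close>. All memory not
  mentioned is initially zero.\<close>

definition input_state :: "nat list \<Rightarrow> nat list list \<Rightarrow> state" where
  "input_state ord adj =
     \<lparr>scalar = (\<lambda>_. 0)(''n'' := length adj),
      array = (\<lambda>_ _. 0)
        (''order'' := array_of ord,
         ''offset'' := array_of (map (\<lambda>v. length (concat (take v adj))) [0..<length adj + 1]),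
         ''target'' := array_of (concat adj))\<rparr>"

text \<open>The bound \<open>(n + m + 2)\<^sup>w\<close> on machine words expresses a word length of \<open>O(log (n + m))\<close> bits.
  The summand 1 in the time bound only matters for the graph without vertices.\<close>

definition linear_time_detectable :: "pattern set \<Rightarrow> bool" where
  "linear_time_detectable F \<longleftrightarrow>
     (\<exists>(prog :: com) (w :: nat) (c :: nat). \<forall>G \<tau> ord adj.
        ordered_graph G \<tau> \<longrightarrow> represents ord adj G \<tau> \<longrightarrow>
        (let n = card (verts G); m = card (edges G) in
         \<exists>t s. exec ((n + m + 2) ^ w) prog (input_state ord adj) t s \<and>
               t \<le> c * (n + m + 1) \<and>
               (scalar s ''result'' \<noteq> 0 \<longleftrightarrow> (\<exists>P \<in> F. contains_pattern G \<tau> P))))"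

end

theory Submission
  imports Defs
begin

text \<open>A set of patterns on three vertices amounts to a set \<open>S\<close> of forbidden types of ordered
  triples \<open>a < b < c\<close>, where the type records which of \<open>ab\<close>, \<open>bc\<close>, \<open>ac\<close> are edges. Inclusion and
  exclusion expresses the number of triples of each of the eight types by the degrees to the left
  and to the right of every vertex and by the number of triangles, which enters with a sign given
  by the parity of the number of edges of the type. If \<open>S\<close> contains types of both parities, the
  triangles cancel in the sum of two such numbers, and linear time suffices. If all types in \<open>S\<close>
  have the same parity and one of them is the pattern of chordal graphs (edges \<open>ac\<close>, \<open>bc\<close> only) or
  that of co-chordal graphs (edge \<open>ab\<close> only), this one is tested in linear time as for perfect
  elimination orders; if it does not occur, the number of triangles is known, and with it all
  others. Up to reversal of the order, the four excluded classes and two further sets remain: those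
  of the bipartite permutation graphs and of their complements, and they are also characterized by
  sets with types of both parities.\<close>

section \<open>Types of ordered triples\<close>

text \<open>The obstacle is the number of triangles, for which no linear-time method is known; every
  other term of the expansion is a sum over vertices of a polynomial in the position and the two
  degrees. Cancelling it is enough because only emptiness is asked. Counts are nonnegative, so the
  sum of two of them vanishes exactly if both types are absent; and once a type \<open>u\<close> is
  known to be absent, its count 0 can be subtracted from that of a type of the same parity. A set of
  one parity thus needs one type whose absence is tested directly, which the elimination orders
  offer through counts of common neighbours. For the two bipartite sets a type of the other parity
  is added to \<open>S\<close> at the price of changing the order of the graph, which is harmless
  because only the class has to be preserved. Every test compares two sums over the positions, so
  one program scheme serves every \<open>S\<close>: a fixed preprocessing, followed by a list of
  comparisons that depends on \<open>S\<close> alone.\<close>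

definition triple_type :: "'a ugraph \<Rightarrow> 'a \<Rightarrow> 'a \<Rightarrow> 'a \<Rightarrow> bool \<times> bool \<times> bool" where
  "triple_type G a b c = ({a, b} \<in> edges G, {b, c} \<in> edges G, {a, c} \<in> edges G)"

definition occurs :: "'a ugraph \<Rightarrow> 'a rel \<Rightarrow> bool \<times> bool \<times> bool \<Rightarrow> bool" where
  "occurs G \<tau> t \<longleftrightarrow> (\<exists>a b c. {a, b, c} \<subseteq> verts G \<and> a \<noteq> b \<and> b \<noteq> c \<and>
     (a, b) \<in> \<tau> \<and> (b, c) \<in> \<tau> \<and> triple_type G a b c = t)"

definition avoiders :: "(bool \<times> bool \<times> bool) set \<Rightarrow> nat ugraph set" where
  "avoiders S = {G. simple_graph G \<and> (\<exists>\<tau>. ordered_graph G \<tau> \<and> (\<forall>t \<in> S. \<not> occurs G \<tau> t))}"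

text \<open>An undecided pair admits both values, so a pattern stands for the set of all types that
  complete it. This is how arbitrary pattern sets become sets of types.\<close>

definition matching_types :: "nat \<Rightarrow> nat \<Rightarrow> nat \<Rightarrow> pattern \<Rightarrow> (bool \<times> bool \<times> bool) set" where
  "matching_types x y z P = {(p, q, r).
     ({x, y} \<in> mandatory P \<longrightarrow> p) \<and> ({x, y} \<in> forbidden P \<longrightarrow> \<not> p) \<and>
     ({y, z} \<in> mandatory P \<longrightarrow> q) \<and> ({y, z} \<in> forbidden P \<longrightarrow> \<not> q) \<and>
     ({x, z} \<in> mandatory P \<longrightarrow> r) \<and> ({x, z} \<in> forbidden P \<longrightarrow> \<not> r)}"

text \<open>The way back uses fully decided patterns, one per type; the characterizing set found in
  the end consists of these.\<close>

definition type_pattern :: "bool \<times> bool \<times> bool \<Rightarrow> pattern" where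
  "type_pattern t = (case t of (p, q, r) \<Rightarrow>
     let M = (if p then {{0, 1}} else {}) \<union> (if q then {{1, 2}} else {}) \<union> (if r then {{0, 2}} else {})
     in \<lparr>pverts = {0, 1, 2}, porder = {(0, 0), (1, 1), (2, 2), (0, 1), (1, 2), (0, 2)},
         mandatory = M, forbidden = {{0, 1}, {1, 2}, {0, 2}} - M, undecided = {}\<rparr>)"

lemma pairs_three: "x \<noteq> y \<Longrightarrow> y \<noteq> z \<Longrightarrow> x \<noteq> z \<Longrightarrow> pairs {x, y, z} = {{x, y}, {y, z}, {x, z}}"
  unfolding pairs_def by (auto simp: insert_commute)

lemma linear_orderD:
  assumes "linear_order_on V \<tau>"
  shows "\<And>v. v \<in> V \<Longrightarrow> (v, v) \<in> \<tau>"
    "\<And>u v w. (u, v) \<in> \<tau> \<Longrightarrow> (v, w) \<in> \<tau> \<Longrightarrow> (u, w) \<in> \<tau>"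
    "\<And>u v. (u, v) \<in> \<tau> \<Longrightarrow> (v, u) \<in> \<tau> \<Longrightarrow> u = v"
    "\<And>u v. u \<in> V \<Longrightarrow> v \<in> V \<Longrightarrow> u \<noteq> v \<Longrightarrow> (u, v) \<in> \<tau> \<or> (v, u) \<in> \<tau>"
  using assms unfolding order_on_defs refl_on_def total_on_def
  by (auto elim: transD antisymD)

text \<open>The order-preserving bijection between two chains of three elements is forced, so
  containment only asks whether the type of the image triple completes the pattern.\<close>

lemma contains_pattern_iff_occurs:
  assumes P: "is_pattern P" and V: "pverts P = {x, y, z}" "x \<noteq> y" "y \<noteq> z"
    and xyz: "(x, y) \<in> porder P" "(y, z) \<in> porder P"
    and G: "ordered_graph G \<tau>"
  shows "contains_pattern G \<tau> P \<longleftrightarrow> (\<exists>t \<in> matching_types x y z P. occurs G \<tau> t)"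
proof -
  have lP: "linear_order_on {x, y, z} (porder P)"
    using P V unfolding is_pattern_def by auto
  note oP = linear_orderD[OF lP]
  have xz: "x \<noteq> z" using oP(3) xyz V by auto
  have xz': "(x, z) \<in> porder P" using oP(2) xyz by blast
  have nP: "(y, x) \<notin> porder P" "(z, y) \<notin> porder P" "(z, x) \<notin> porder P"
    using oP(3) xyz xz xz' V by blast+
  have mf: "mandatory P \<union> forbidden P \<subseteq> {{x, y}, {y, z}, {x, z}}"
    using P V xz unfolding is_pattern_def by (auto simp: pairs_three)
  have lG: "linear_order_on (verts G) \<tau>" using G unfolding ordered_graph_def by auto
  note oG = linear_orderD[OF lG]
  show ?thesis
  proof
    assume "contains_pattern G \<tau> P"
    then obtain X \<phi> where X: "X \<subseteq> verts G" and bij: "bij_betw \<phi> (pverts P) X"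
      and ord: "\<forall>a \<in> pverts P. \<forall>b \<in> pverts P. (a, b) \<in> porder P \<longleftrightarrow> (\<phi> a, \<phi> b) \<in> \<tau>"
      and m: "\<forall>e \<in> mandatory P. \<phi> ` e \<in> edges G" and f: "\<forall>e \<in> forbidden P. \<phi> ` e \<notin> edges G"
      unfolding contains_pattern_def by blast
    have "\<phi> x \<in> X" "\<phi> y \<in> X" "\<phi> z \<in> X" "\<phi> x \<noteq> \<phi> y" "\<phi> y \<noteq> \<phi> z"
      using bij V by (auto simp: bij_betw_def)
    moreover have "(\<phi> x, \<phi> y) \<in> \<tau>" "(\<phi> y, \<phi> z) \<in> \<tau>" using ord V xyz by auto
    moreover have "triple_type G (\<phi> x) (\<phi> y) (\<phi> z) \<in> matching_types x y z P"
      using bspec[OF m] bspec[OF f] unfolding matching_types_def triple_type_def by fastforce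
    ultimately show "\<exists>t \<in> matching_types x y z P. occurs G \<tau> t"
      using X unfolding occurs_def by blast
  next
    assume "\<exists>t \<in> matching_types x y z P. occurs G \<tau> t"
    then obtain a b c where abc: "{a, b, c} \<subseteq> verts G" "a \<noteq> b" "b \<noteq> c" "(a, b) \<in> \<tau>" "(b, c) \<in> \<tau>"
      and t: "triple_type G a b c \<in> matching_types x y z P"
      unfolding occurs_def by blast
    have ac: "a \<noteq> c" "(a, c) \<in> \<tau>" using oG(2,3) abc by blast+
    have nG: "(b, a) \<notin> \<tau>" "(c, b) \<notin> \<tau>" "(c, a) \<notin> \<tau>"
      using oG(3) abc ac by blast+
    define \<phi> where "\<phi> v = (if v = x then a else if v = y then b else c)" for v
    have [simp]: "\<phi> x = a" "\<phi> y = b" "\<phi> z = c" using V xz by (auto simp: \<phi>_def)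
    have bij: "bij_betw \<phi> {x, y, z} {a, b, c}" using V abc ac xz by (auto simp: bij_betw_def inj_on_def)
    have "\<forall>u \<in> {x, y, z}. \<forall>v \<in> {x, y, z}. (u, v) \<in> porder P \<longleftrightarrow> (\<phi> u, \<phi> v) \<in> \<tau>"
      using oP(1) oG(1) abc ac xyz xz' nP nG by simp
    moreover have "(e \<in> mandatory P \<longrightarrow> \<phi> ` e \<in> edges G) \<and> (e \<in> forbidden P \<longrightarrow> \<phi> ` e \<notin> edges G)" for e
    proof -
      consider "e = {x, y}" | "e = {y, z}" | "e = {x, z}" | "e \<notin> mandatory P \<union> forbidden P"
        using mf by blast
      then show ?thesis
        using t unfolding matching_types_def triple_type_def by cases simp_all
    qed
    moreover have "card {a, b, c} = card {x, y, z}" using V xz abc ac by simp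
    ultimately show "contains_pattern G \<tau> P"
      unfolding contains_pattern_def V using abc(1) bij by blast
  qed
qed

lemma linear_order_three:
  assumes "linear_order_on V r" "card V = 3"
  obtains x y z where "V = {x, y, z}" "x \<noteq> y" "y \<noteq> z" "(x, y) \<in> r" "(y, z) \<in> r"
proof -
  obtain a b c where abc: "V = {a, b, c}" "a \<noteq> b" "b \<noteq> c" "a \<noteq> c"
    using assms(2) by (auto simp: card_Suc_eq numeral_3_eq_3)
  have tot: "(a, b) \<in> r \<or> (b, a) \<in> r" "(b, c) \<in> r \<or> (c, b) \<in> r" "(a, c) \<in> r \<or> (c, a) \<in> r"
    using linear_orderD(4)[OF assms(1)] abc by auto
  have sets: "{a, b, c} = {a, c, b}" "{a, b, c} = {b, a, c}" "{a, b, c} = {b, c, a}"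
     "{a, b, c} = {c, a, b}" "{a, b, c} = {c, b, a}" by auto
  show ?thesis
    using that[of a b c] that[of a c b] that[of b a c] that[of b c a] that[of c a b] that[of c b a]
      tot abc linear_orderD(2)[OF assms(1)] sets by metis
qed

lemma three_vertex_pattern_types:
  assumes "is_pattern P" "card (pverts P) = 3"
  shows "\<exists>S. \<forall>G \<tau>. ordered_graph G \<tau> \<longrightarrow> (contains_pattern G \<tau> P \<longleftrightarrow> (\<exists>t \<in> S. occurs (G :: nat ugraph) \<tau> t))"
proof -
  have l: "linear_order_on (pverts P) (porder P)" using assms unfolding is_pattern_def by auto
  obtain x y z where V: "pverts P = {x, y, z}" "x \<noteq> y" "y \<noteq> z"
    and o: "(x, y) \<in> porder P" "(y, z) \<in> porder P"
    using linear_order_three[OF l assms(2)] .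
  show ?thesis using contains_pattern_iff_occurs[OF assms(1) V o] by blast
qed

text \<open>\<open>F\<close> may be infinite, but the union of the type sets of its patterns is a
  subset of the eight types and forbids the same ordered graphs.\<close>

lemma three_vertex_patterns_avoiders:
  assumes F: "\<forall>P \<in> F. is_pattern P \<and> card (pverts P) = 3" and C: "characterizes F C"
  obtains S where "C = avoiders S"
proof -
  obtain T where T: "\<And>P G \<tau>. P \<in> F \<Longrightarrow> ordered_graph G \<tau> \<Longrightarrow>
      contains_pattern (G :: nat ugraph) \<tau> P \<longleftrightarrow> (\<exists>t \<in> T P. occurs G \<tau> t)"
    using three_vertex_pattern_types F by metis
  have "C = avoiders (\<Union> (T ` F))"
    using C unfolding characterizes_def avoiders_def by (auto simp: T)
  then show ?thesis by (rule that)
qed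

lemma is_pattern_type_pattern: "is_pattern (type_pattern t)"
proof -
  have "linear_order_on {0, 1, 2} {(0, 0), (1, 1), (2, 2), (0, 1), (1, 2), (0, 2 :: nat)}"
    unfolding order_on_defs refl_on_def total_on_def trans_def antisym_def by auto
  moreover have "pairs {0, 1, 2 :: nat} = {{0, 1}, {1, 2}, {0, 2}}" by (rule pairs_three) auto
  ultimately show ?thesis
    unfolding is_pattern_def type_pattern_def by (auto simp: Let_def split: prod.split)
qed

lemma contains_type_pattern:
  assumes "ordered_graph G \<tau>"
  shows "contains_pattern G \<tau> (type_pattern t) \<longleftrightarrow> occurs G \<tau> t"
proof -
  have "matching_types 0 1 2 (type_pattern t) = {t}"
    unfolding matching_types_def type_pattern_def
    by (auto simp: Let_def doubleton_eq_iff split: prod.splits if_splits)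
  moreover have "pverts (type_pattern t) = {0, 1, 2}" "(0, 1) \<in> porder (type_pattern t)"
     "(1, 2) \<in> porder (type_pattern t)"
    unfolding type_pattern_def by (auto simp: Let_def split: prod.split)
  ultimately show ?thesis
    using contains_pattern_iff_occurs[OF is_pattern_type_pattern _ _ _ _ _ assms, of t 0 1 2] by simp
qed

lemma characterizes_type_patterns: "characterizes (type_pattern ` S) (avoiders S)"
  unfolding characterizes_def avoiders_def by (auto simp: contains_type_pattern)

section \<open>Orders as injective rankings\<close>

lemma simple_graphD:
  assumes "simple_graph G"
  shows "finite (verts G)" "\<And>u v. {u, v} \<in> edges G \<Longrightarrow> u \<in> verts G \<and> v \<in> verts G \<and> u \<noteq> v"
  using assms unfolding simple_graph_def pairs_def by (auto simp: doubleton_eq_iff dest!: subsetD)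

text \<open>The number of elements up to \<open>v\<close> increases strictly along the order. With
  such numbers, reasoning about orders becomes arithmetic.\<close>

lemma linear_order_ranking:
  assumes "linear_order_on V \<tau>" "finite V"
  obtains f :: "'a \<Rightarrow> nat" where "inj_on f V" "\<And>u v. u \<in> V \<Longrightarrow> v \<in> V \<Longrightarrow> (u, v) \<in> \<tau> \<longleftrightarrow> f u \<le> f v"
proof -
  note o = linear_orderD[OF assms(1)]
  define f where "f v = card {u \<in> V. (u, v) \<in> \<tau>}" for v
  have le: "f u \<le> f v" if "(u, v) \<in> \<tau>" for u v
    unfolding f_def by (intro card_mono) (use assms(2) that o(2) in auto)
  have less: "f u < f v" if "(u, v) \<in> \<tau>" "u \<noteq> v" "v \<in> V" for u v
  proof -
    have "v \<in> {u \<in> V. (u, v) \<in> \<tau>} - {w \<in> V. (w, u) \<in> \<tau>}" using that o(1,3) by blast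
    moreover have "{w \<in> V. (w, u) \<in> \<tau>} \<subseteq> {u \<in> V. (u, v) \<in> \<tau>}" using that o(2) by blast
    ultimately show ?thesis unfolding f_def using assms(2) by (intro psubset_card_mono) auto
  qed
  have "inj_on f V" by (intro inj_onI) (metis less o(4) less_irrefl)
  moreover have "(u, v) \<in> \<tau> \<longleftrightarrow> f u \<le> f v" if "u \<in> V" "v \<in> V" for u v
    using le less o(1,4) that by (metis not_less)
  ultimately show ?thesis using that by blast
qed

text \<open>Any injection into the naturals serves as an order, with gaps allowed; to show
  membership in a class it then suffices to name a function.\<close>

lemma avoiders_iff_ranking:
  "G \<in> avoiders S \<longleftrightarrow> simple_graph G \<and> (\<exists>f :: nat \<Rightarrow> nat. inj_on f (verts G) \<and>
     (\<forall>a \<in> verts G. \<forall>b \<in> verts G. \<forall>c \<in> verts G. f a < f b \<longrightarrow> f b < f c \<longrightarrow> triple_type G a b c \<notin> S))"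
  (is "_ \<longleftrightarrow> _ \<and> ?R")
proof (cases "simple_graph G")
  case True
  note fin = simple_graphD(1)[OF True]
  have "(\<exists>\<tau>. ordered_graph G \<tau> \<and> (\<forall>t \<in> S. \<not> occurs G \<tau> t)) \<longleftrightarrow> ?R"
  proof
    assume "\<exists>\<tau>. ordered_graph G \<tau> \<and> (\<forall>t \<in> S. \<not> occurs G \<tau> t)"
    then obtain \<tau> where \<tau>: "linear_order_on (verts G) \<tau>" "\<forall>t \<in> S. \<not> occurs G \<tau> t"
      unfolding ordered_graph_def by blast
    obtain f :: "nat \<Rightarrow> nat" where f: "inj_on f (verts G)"
      "\<And>u v. u \<in> verts G \<Longrightarrow> v \<in> verts G \<Longrightarrow> (u, v) \<in> \<tau> \<longleftrightarrow> f u \<le> f v"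
      using linear_order_ranking[OF \<tau>(1) fin] by blast
    have "triple_type G a b c \<notin> S"
      if "a \<in> verts G" "b \<in> verts G" "c \<in> verts G" "f a < f b" "f b < f c" for a b c
    proof -
      have "a \<noteq> b" "b \<noteq> c" "(a, b) \<in> \<tau>" "(b, c) \<in> \<tau>" using f(2) that by auto
      then show ?thesis using \<tau>(2) that(1-3) unfolding occurs_def by blast
    qed
    then show ?R using f(1) by blast
  next
    assume ?R
    then obtain f :: "nat \<Rightarrow> nat" where f: "inj_on f (verts G)"
      "\<forall>a \<in> verts G. \<forall>b \<in> verts G. \<forall>c \<in> verts G. f a < f b \<longrightarrow> f b < f c \<longrightarrow> triple_type G a b c \<notin> S"
      by blast
    define \<tau> where "\<tau> = {(u, v). u \<in> verts G \<and> v \<in> verts G \<and> f u \<le> f v}"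
    have "linear_order_on (verts G) \<tau>"
      using f(1) unfolding order_on_defs refl_on_def total_on_def trans_def antisym_def \<tau>_def
      by (auto dest: inj_onD)
    moreover have "\<not> occurs G \<tau> t" if "t \<in> S" for t
    proof
      assume "occurs G \<tau> t"
      then obtain a b c where abc: "a \<in> verts G" "b \<in> verts G" "c \<in> verts G" "a \<noteq> b" "b \<noteq> c"
        "f a \<le> f b" "f b \<le> f c" "triple_type G a b c = t"
        unfolding occurs_def \<tau>_def by auto
      then have "f a < f b" "f b < f c" using f(1) by (auto simp: le_less dest: inj_onD)
      then show False using f(2) abc that by blast
    qed
    ultimately show "\<exists>\<tau>. ordered_graph G \<tau> \<and> (\<forall>t \<in> S. \<not> occurs G \<tau> t)"
      using True unfolding ordered_graph_def by blast
  qed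
  then show ?thesis using True unfolding avoiders_def by simp
qed (simp add: avoiders_def)

text \<open>The counterpart for strict relations, which is the form in which new orders are
  constructed below.\<close>

lemma strict_order_ranking:
  fixes A :: "('a \<times> 'a) set" and V :: "'a set"
  assumes "finite V" and irr: "\<And>v. (v, v) \<notin> A" and "trans A"
    and tot: "\<And>u v. u \<in> V \<Longrightarrow> v \<in> V \<Longrightarrow> u \<noteq> v \<Longrightarrow> (u, v) \<in> A \<or> (v, u) \<in> A"
  obtains f :: "'a \<Rightarrow> nat" where "inj_on f V" "\<And>u v. u \<in> V \<Longrightarrow> v \<in> V \<Longrightarrow> f u < f v \<longleftrightarrow> (u, v) \<in> A"
proof -
  define f where "f v = card {u \<in> V. (u, v) \<in> A}" for v
  have less: "f u < f v" if "(u, v) \<in> A" "u \<in> V" for u v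
    unfolding f_def by (intro psubset_card_mono) (use assms that in \<open>auto dest: transD\<close>)
  then show ?thesis
    by (intro that[of f] inj_onI) (metis tot less_irrefl less_asym)+
qed

section \<open>Reversal of the order and complementation\<close>

definition mirror :: "bool \<times> bool \<times> bool \<Rightarrow> bool \<times> bool \<times> bool" where
  "mirror t = (case t of (p, q, r) \<Rightarrow> (q, p, r))"

lemma mirror_mirror [simp]: "mirror (mirror t) = t"
  by (simp add: mirror_def split: prod.split)

text \<open>Reading a triple backwards exchanges \<open>ab\<close> with \<open>bc\<close> and keeps
  \<open>ac\<close>. One inclusion suffices, since \<open>mirror\<close> is an involution.\<close>

lemma avoiders_mirror: "avoiders (mirror ` S) = avoiders S"
proof -
  have *: "avoiders S \<subseteq> avoiders (mirror ` S)" for S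
  proof
    fix G assume G: "G \<in> avoiders S"
    then obtain f :: "nat \<Rightarrow> nat" where s: "simple_graph G" and f: "inj_on f (verts G)"
      "\<forall>a \<in> verts G. \<forall>b \<in> verts G. \<forall>c \<in> verts G. f a < f b \<longrightarrow> f b < f c \<longrightarrow> triple_type G a b c \<notin> S"
      unfolding avoiders_iff_ranking by blast
    \<comment> \<open>An upper bound of all ranks keeps the truncated subtraction in
      \<open>g\<close> injective; the inserted 0 covers the graph without vertices.\<close>
    define N where "N = Max (insert 0 (f ` verts G))"
    have N: "f v \<le> N" if "v \<in> verts G" for v
      unfolding N_def using that simple_graphD(1)[OF s] by (intro Max_ge) auto
    define g where "g v = N - f v" for v
    have g: "g u < g v \<longleftrightarrow> f v < f u" if "u \<in> verts G" "v \<in> verts G" for u v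
      using N[OF that(1)] N[OF that(2)] unfolding g_def by auto
    have "inj_on g (verts G)"
      using f(1) N unfolding g_def inj_on_def by (metis diff_diff_cancel)
    moreover have "triple_type G c b a = mirror (triple_type G a b c)" for a b c
      by (simp add: mirror_def triple_type_def insert_commute)
    then have "triple_type G a b c \<in> mirror ` S \<Longrightarrow> triple_type G c b a \<in> S" for a b c
      by (metis imageE mirror_mirror)
    ultimately show "G \<in> avoiders (mirror ` S)"
      unfolding avoiders_iff_ranking using s f(2) g by (intro conjI exI[of _ g]) blast+
  qed
  have "mirror ` mirror ` S = S" by (simp add: image_image)
  then show ?thesis using *[of S] *[of "mirror ` S"] by auto
qed

definition flip :: "bool \<times> bool \<times> bool \<Rightarrow> bool \<times> bool \<times> bool" where
  "flip t = (case t of (p, q, r) \<Rightarrow> (\<not> p, \<not> q, \<not> r))"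

lemma complement_simps [simp]:
  "verts (complement G) = verts G"
  "u \<in> verts G \<Longrightarrow> v \<in> verts G \<Longrightarrow> {u, v} \<in> edges (complement G) \<longleftrightarrow> u \<noteq> v \<and> {u, v} \<notin> edges G"
  by (auto simp: complement_def pairs_def)

lemma simple_graph_complement: "simple_graph G \<Longrightarrow> simple_graph (complement G)"
  by (auto simp: simple_graph_def complement_def)

text \<open>The same ranking works for both graphs. The types are complementary only on triples of
  distinct vertices, which strictly increasing ranks guarantee.\<close>

lemma avoiders_flip:
  assumes "simple_graph G"
  shows "complement G \<in> avoiders S \<longleftrightarrow> G \<in> avoiders (flip ` S)"
proof -
  have "triple_type (complement G) a b c \<in> S \<longleftrightarrow> triple_type G a b c \<in> flip ` S"
    if "{a, b, c} \<subseteq> verts G" "a \<noteq> b" "b \<noteq> c" "a \<noteq> c" for a b c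
  proof -
    have "triple_type (complement G) a b c = flip (triple_type G a b c)"
      using that by (auto simp: triple_type_def flip_def)
    moreover have "flip (flip t) = t" for t by (simp add: flip_def split: prod.split)
    ultimately show ?thesis by (metis image_iff)
  qed
  note * = this
  have "triple_type (complement G) a b c \<in> S \<longleftrightarrow> triple_type G a b c \<in> flip ` S"
    if "a \<in> verts G" "b \<in> verts G" "c \<in> verts G" "f a < f b" "f b < f c" for a b c and f :: "nat \<Rightarrow> nat"
    using that by (intro *) auto
  then show ?thesis
    unfolding avoiders_iff_ranking
    using assms simple_graph_complement[OF assms] by (simp cong: conj_cong ball_cong)
qed

section \<open>The four excluded classes as single forbidden types\<close>

abbreviation (input) type_comp :: "bool \<times> bool \<times> bool" where
  "type_comp \<equiv> (True, True, False)"

text \<open>Without \<open>type_comp\<close>, orienting all edges upwards is transitive. Conversely,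
  sorting by in-degree makes every arc of a transitive orientation go up: the in-neighbours of the
  tail are in-neighbours of the head, and so is the tail itself.\<close>

lemma avoiders_comparability: "avoiders {type_comp} = comparability_graphs"
proof (intro set_eqI)
  fix G :: "nat ugraph"
  show "G \<in> avoiders {type_comp} \<longleftrightarrow> G \<in> comparability_graphs"
  proof
    assume "G \<in> avoiders {type_comp}"
    then obtain f :: "nat \<Rightarrow> nat" where s: "simple_graph G" and f: "inj_on f (verts G)"
      "\<forall>a \<in> verts G. \<forall>b \<in> verts G. \<forall>c \<in> verts G. f a < f b \<longrightarrow> f b < f c \<longrightarrow> triple_type G a b c \<noteq> type_comp"
      unfolding avoiders_iff_ranking by blast
    note sD = simple_graphD(2)[OF s]
    let ?A = "{(u, v). {u, v} \<in> edges G \<and> f u < f v}"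
    have "((u, v) \<in> ?A) \<noteq> ((v, u) \<in> ?A)" if "{u, v} \<in> edges G" for u v
      using sD[OF that] that f(1) by (auto simp: insert_commute inj_on_def) (metis linorder_cases)
    moreover have "trans ?A"
    proof (intro transI)
      fix u v w assume uv: "(u, v) \<in> ?A" "(v, w) \<in> ?A"
      then have "triple_type G u v w \<noteq> type_comp" using f(2) sD by blast
      then show "(u, w) \<in> ?A" using uv by (simp add: triple_type_def)
    qed
    ultimately have "transitive_orientation G ?A"
      unfolding transitive_orientation_def by blast
    then show "G \<in> comparability_graphs" using s unfolding comparability_graphs_def by blast
  next
    assume "G \<in> comparability_graphs"
    then obtain A where s: "simple_graph G" and ori: "transitive_orientation G A"
      unfolding comparability_graphs_def by blast
    have A: "\<And>u v. (u, v) \<in> A \<Longrightarrow> {u, v} \<in> edges G"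
      "\<And>u v. {u, v} \<in> edges G \<Longrightarrow> ((u, v) \<in> A) \<noteq> ((v, u) \<in> A)" "trans A"
      using ori by (auto simp: transitive_orientation_def)
    note sD = simple_graphD[OF s]
    define d where "d v = card {u \<in> verts G. (u, v) \<in> A}" for v
    have d: "d u < d v" if "(u, v) \<in> A" for u v
    proof -
      have "u \<in> {w \<in> verts G. (w, v) \<in> A} - {w \<in> verts G. (w, u) \<in> A}"
        using that A(1,2) sD(2) by blast
      moreover have "{w \<in> verts G. (w, u) \<in> A} \<subseteq> {w \<in> verts G. (w, v) \<in> A}"
        using that A(3) by (auto dest: transD)
      ultimately show ?thesis unfolding d_def using sD(1) by (intro psubset_card_mono) auto
    qed
    \<comment> \<open>In-degrees alone may tie, though never along an arc; the vertex numbers break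
      the ties.\<close>
    define L where "L = {(u, v). d u < d v \<or> d u = d v \<and> u < (v :: nat)}"
    obtain f :: "nat \<Rightarrow> nat" where f: "inj_on f (verts G)"
      "\<And>u v. u \<in> verts G \<Longrightarrow> v \<in> verts G \<Longrightarrow> f u < f v \<longleftrightarrow> (u, v) \<in> L"
      by (rule strict_order_ranking[OF sD(1), of L]) (auto simp: L_def intro!: transI)
    have e: "(u, v) \<in> A" if "u \<in> verts G" "v \<in> verts G" "f u < f v" "{u, v} \<in> edges G" for u v
      using f(2)[OF that(1,2)] A(2)[OF that(4)] d[of v u] that by (auto simp: L_def)
    have "triple_type G a b c \<noteq> type_comp"
      if "a \<in> verts G" "b \<in> verts G" "c \<in> verts G" "f a < f b" "f b < f c" for a b c
      using e[of a b] e[of b c] A(1)[of a c] transD[OF A(3), of a b c] that by (auto simp: triple_type_def)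
    then show "G \<in> avoiders {type_comp}"
      unfolding avoiders_iff_ranking using s f(1) by blast
  qed
qed

text \<open>A triangle has the same type in every order of its vertices: hence the six cases in one
  direction and the arbitrary ranking \<open>id\<close> in the other.\<close>

lemma avoiders_triangle_free: "avoiders {(True, True, True)} = triangle_free_graphs"
proof (intro set_eqI)
  fix G :: "nat ugraph"
  show "G \<in> avoiders {(True, True, True)} \<longleftrightarrow> G \<in> triangle_free_graphs"
  proof
    assume "G \<in> avoiders {(True, True, True)}"
    then obtain f :: "nat \<Rightarrow> nat" where s: "simple_graph G" and f: "inj_on f (verts G)"
      "\<And>a b c. a \<in> verts G \<Longrightarrow> b \<in> verts G \<Longrightarrow> c \<in> verts G \<Longrightarrow> f a < f b \<Longrightarrow> f b < f c \<Longrightarrow> triple_type G a b c \<noteq> (True, True, True)"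
      unfolding avoiders_iff_ranking by blast
    note sD = simple_graphD(2)[OF s]
    have False if "{u, v} \<in> edges G" "{v, w} \<in> edges G" "{u, w} \<in> edges G" for u v w
    proof -
      have "f u \<noteq> f v" "f v \<noteq> f w" "f u \<noteq> f w"
        using sD that f(1) by (metis inj_onD)+
      then consider "f u < f v \<and> f v < f w" | "f u < f w \<and> f w < f v" | "f v < f u \<and> f u < f w"
        | "f v < f w \<and> f w < f u" | "f w < f u \<and> f u < f v" | "f w < f v \<and> f v < f u" by linarith
      then show False
        using f(2)[of u v w] f(2)[of u w v] f(2)[of v u w] f(2)[of v w u] f(2)[of w u v] f(2)[of w v u]
          that sD[OF that(1)] sD[OF that(2)] by cases (simp_all add: triple_type_def insert_commute)
    qed
    then show "G \<in> triangle_free_graphs" using s unfolding triangle_free_graphs_def by auto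
  next
    assume "G \<in> triangle_free_graphs"
    then show "G \<in> avoiders {(True, True, True)}"
      unfolding avoiders_iff_ranking triangle_free_graphs_def triple_type_def
      by (auto intro!: exI[of _ id])
  qed
qed

lemma avoiders_co_comparability: "avoiders {(False, False, True)} = co_comparability_graphs"
proof -
  have "flip ` {type_comp} = {(False, False, True)}" by (simp add: flip_def)
  then show ?thesis
    using avoiders_flip[of _ "{type_comp}"] avoiders_comparability
    unfolding co_comparability_graphs_def by (auto simp: avoiders_iff_ranking)
qed

lemma avoiders_co_triangle_free: "avoiders {(False, False, False)} = co_triangle_free_graphs"
proof -
  have "flip ` {(True, True, True)} = {(False, False, False)}" by (simp add: flip_def)
  then show ?thesis
    using avoiders_flip[of _ "{(True, True, True)}"] avoiders_triangle_free
    unfolding co_triangle_free_graphs_def by (auto simp: avoiders_iff_ranking)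
qed

section \<open>Bipartite permutation graphs and their complements\<close>

text \<open>Dilworth's theorem for width two, with Galvin's induction: non-adjacency is a partial
  order whose antichains are the cliques of the graph.\<close>

lemma bipartite_if_triangle_free_co_comparability:
  fixes f :: "'a \<Rightarrow> nat" and E :: "'a \<Rightarrow> 'a \<Rightarrow> bool"
  assumes "finite V" "inj_on f V" and sym: "\<And>u v. E u v \<Longrightarrow> E v u"
    and tri: "\<And>u v w. E u v \<Longrightarrow> E v w \<Longrightarrow> \<not> E u w"
    and co: "\<And>a b c. {a, b, c} \<subseteq> V \<Longrightarrow> f a < f b \<Longrightarrow> f b < f c \<Longrightarrow> E a c \<Longrightarrow> E a b \<or> E b c"
  shows "\<exists>X \<subseteq> V. \<forall>u \<in> V. \<forall>v \<in> V. E u v \<longrightarrow> (u \<in> X) \<noteq> (v \<in> X)"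
  using assms(1,2) co
proof (induction V rule: finite_ranking_induct[where f = f])
  case empty
  then show ?case by simp
next
  case (insert z V)
  show ?case
  proof (cases "z \<in> V")
    case True
    then have "insert z V = V" by blast
    with insert show ?thesis by simp
  next
    case z: False
    have irr: "\<not> E u u" for u using tri[of u u u] by blast
    have zmax: "f u < f z" if "u \<in> V" for u
      using insert(2)[OF that] insert.prems(1) z that by (metis inj_on_insert insert_iff inj_onD le_less)
    have co: "E a b \<or> E b c" if "{a, b, c} \<subseteq> insert z V" "f a < f b" "f b < f c" "E a c" for a b c
      using insert.prems(2) that .
    have "inj_on f V" using insert.prems(1) by auto
    then have "\<exists>X \<subseteq> V. \<forall>u \<in> V. \<forall>v \<in> V. E u v \<longrightarrow> (u \<in> X) \<noteq> (v \<in> X)"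
    proof (rule insert.IH)
      show "E a b \<or> E b c" if "{a, b, c} \<subseteq> V" "f a < f b" "f b < f c" "E a c" for a b c
        using that by (intro co) auto
    qed
    then obtain X where X: "X \<subseteq> V" "\<And>u v. u \<in> V \<Longrightarrow> v \<in> V \<Longrightarrow> E u v \<Longrightarrow> (u \<in> X) \<noteq> (v \<in> X)"
      by auto
    show ?thesis
    proof (cases "\<exists>u \<in> V. \<exists>v \<in> V. E u v")
      \<comment> \<open>Without an edge in \<open>V\<close>, all edges contain \<open>z\<close>,
        which is a colour class by itself.\<close>
      case False
      then have "\<forall>u \<in> insert z V. \<forall>v \<in> insert z V. E u v \<longrightarrow> (u \<in> {z}) \<noteq> (v \<in> {z})"
        using irr z by auto
      then show ?thesis by (intro exI[of _ "{z}"]) simp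
    next
      case True
      \<comment> \<open>\<open>X\<close> and \<open>V - X\<close> are the two chains given by
        induction. A vertex lies in an antichain of size two exactly if it has a neighbour; as in
        Galvin's argument, the last such vertex of each chain is taken.\<close>
      define N1 where "N1 = {u \<in> X. \<exists>v \<in> V. E u v}"
      define N2 where "N2 = {u \<in> V - X. \<exists>v \<in> V. E u v}"
      obtain u v where "u \<in> V" "v \<in> V" "E u v" "u \<in> X" "v \<notin> X"
        using True X(2) sym by metis
      then have ne: "N1 \<noteq> {}" "N2 \<noteq> {}" using sym unfolding N1_def N2_def by blast+
      have fin: "finite N1" "finite N2"
        using insert.hyps(1) finite_subset[OF X(1)] unfolding N1_def N2_def by auto
      have max: "\<exists>x \<in> N. \<forall>u \<in> N. f u \<le> f x" if "finite N" "N \<noteq> {}" for N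
      proof -
        have "Max (f ` N) \<in> f ` N" using that by (intro Max_in) auto
        then obtain x where "x \<in> N" "f x = Max (f ` N)" by auto
        then show ?thesis using that(1) by (intro bexI[of _ x]) auto
      qed
      obtain x1 x2 where x1: "x1 \<in> N1" "\<And>u. u \<in> N1 \<Longrightarrow> f u \<le> f x1"
        and x2: "x2 \<in> N2" "\<And>u. u \<in> N2 \<Longrightarrow> f u \<le> f x2"
        using max[OF fin(1) ne(1)] max[OF fin(2) ne(2)] by blast
      have xV: "x1 \<in> V" "x2 \<in> V" "x1 \<in> X" "x2 \<notin> X" using x1(1) x2(1) X(1) unfolding N1_def N2_def by auto
      \<comment> \<open>Let \<open>y\<close> be a neighbour of \<open>b\<close>. It lies in the
        chain of \<open>a\<close>, hence not after \<open>a\<close>. If it is not \<open>a\<close>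
        itself, then \<open>y\<close>, \<open>a\<close>, \<open>b\<close> are increasing with
        \<open>y\<close> and \<open>b\<close> adjacent, and as \<open>y\<close> and \<open>a\<close>
        share a chain, the hypothesis \<open>co\<close> leaves only the edge from \<open>a\<close>
        to \<open>b\<close>.\<close>
      have aux: "E a b" if ab: "a \<in> V" "b \<in> V" "(a \<in> X) \<noteq> (b \<in> X)" "f a < f b" "\<exists>y \<in> V. E b y"
        and amax: "\<And>y. y \<in> V \<Longrightarrow> (y \<in> X) = (a \<in> X) \<Longrightarrow> \<exists>w \<in> V. E y w \<Longrightarrow> f y \<le> f a" for a b
      proof -
        obtain y where y: "y \<in> V" "E b y" using ab(5) by blast
        have "(y \<in> X) = (a \<in> X)" using X(2)[OF ab(2) y] ab(3) by blast
        then have le: "f y \<le> f a" and ny: "\<not> E y a"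
          using amax[OF y(1)] y ab(2) sym X(2)[of y a] ab(1) by blast+
        show ?thesis
        proof (cases "y = a")
          case False
          then have "f y < f a" using le \<open>inj_on f V\<close> y(1) ab(1) by (metis inj_onD le_less)
          then show ?thesis using co[of y a b] ab ny y sym by auto
        qed (use y sym in blast)
      qed
      have "E x1 x2"
      proof (cases "f x1 < f x2")
        case True
        then show ?thesis
          using aux[of x1 x2] xV x1(2) x2(1) unfolding N1_def N2_def by auto
      next
        case False
        then have "f x2 < f x1" using \<open>inj_on f V\<close> xV by (metis inj_onD linorder_neqE_nat)
        then show ?thesis
          using aux[of x2 x1] xV x2(2) x1(1) sym unfolding N1_def N2_def by auto
      qed
      then have "\<not> E x1 z \<or> \<not> E x2 z" using tri sym by blast
      then obtain x where x: "x \<in> V" "\<not> E x z" and xmax: "\<And>y. y \<in> V \<Longrightarrow> (y \<in> X) = (x \<in> X) \<Longrightarrow> \<exists>w \<in> V. E y w \<Longrightarrow> f y \<le> f x"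
        using xV x1(2) x2(2) unfolding N1_def N2_def by auto
      \<comment> \<open>As \<open>x1\<close> and \<open>x2\<close> are adjacent, \<open>z\<close>
        misses one of them, called \<open>x\<close>. By \<open>co\<close>, non-adjacency passes from
        \<open>x\<close> down its chain, so \<open>z\<close> can be put on top of the part of that
        chain up to \<open>x\<close>.\<close>
      define K where "K = insert z {u \<in> V. (u \<in> X) = (x \<in> X) \<and> f u \<le> f x}"
      have zK: "\<not> E u z" if "u \<in> K" for u
      proof (cases "u = z \<or> u = x")
        case False
        then have u: "u \<in> V" "(u \<in> X) = (x \<in> X)" "f u < f x"
          using that x(1) \<open>inj_on f V\<close> unfolding K_def by (auto dest: inj_onD simp: le_less)
        then have "\<not> E u x" using X(2) x(1) by blast
        then show ?thesis using co[of u x z] u x zmax by auto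
      qed (use irr x in auto)
      have "(u \<in> K) \<noteq> (v \<in> K)" if "u \<in> insert z V" "v \<in> insert z V" "E u v" for u v
      proof
        assume eq: "(u \<in> K) = (v \<in> K)"
        show False
        proof (cases "u \<in> K")
          case True
          then show ?thesis using eq zK that X(2) sym irr unfolding K_def by blast
        next
          \<comment> \<open>One end of an edge in \<open>V\<close> belongs to the chain of
            \<open>x\<close>; having a neighbour it comes no later than \<open>x\<close>, so it is
            in \<open>K\<close>.\<close>
          case False
          then have uv: "u \<in> V" "v \<in> V" "v \<notin> K" "u \<notin> K" using eq that unfolding K_def by auto
          then have "(u \<in> X) = (x \<in> X) \<or> (v \<in> X) = (x \<in> X)" using X(2) that(3) by blast
          then show ?thesis
            using xmax[of u] xmax[of v] uv that(3) sym unfolding K_def by blast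
        qed
      qed
      moreover have "K \<subseteq> insert z V" unfolding K_def by blast
      ultimately show ?thesis by blast
    qed
  qed
qed

text \<open>The graph is bipartite, and its order is changed so that the end in \<open>X\<close>
  comes first on every edge, while non-adjacent pairs stay as they are. Then no vertex is the upper
  end of one edge and the lower end of another, which excludes \<open>type_comp\<close> and
  triangles; the third type involves two non-adjacent pairs in their old order and remains
  excluded.\<close>

lemma avoiders_bipartite_permutation:
  "avoiders {(True, True, True), (False, False, True)} =
   avoiders {(True, True, True), (False, False, True), type_comp}"
proof (intro set_eqI iffI)
  fix G
  assume "G \<in> avoiders {(True, True, True), (False, False, True)}"
  then obtain f :: "nat \<Rightarrow> nat" where s: "simple_graph G" and f: "inj_on f (verts G)"
    "\<And>a b c. a \<in> verts G \<Longrightarrow> b \<in> verts G \<Longrightarrow> c \<in> verts G \<Longrightarrow> f a < f b \<Longrightarrow> f b < f c \<Longrightarrow>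
       triple_type G a b c \<notin> {(True, True, True), (False, False, True)}"
    unfolding avoiders_iff_ranking by blast
  note sD = simple_graphD[OF s]
  define E where "E u v \<longleftrightarrow> {u, v} \<in> edges G" for u v
  have EV: "u \<in> verts G" "v \<in> verts G" "u \<noteq> v" if "E u v" for u v using sD(2) that E_def by auto
  have sym: "E u v \<longleftrightarrow> E v u" for u v by (simp add: E_def insert_commute)
  have "G \<in> avoiders {(True, True, True)}"
    unfolding avoiders_iff_ranking using s f by (intro conjI exI[of _ f]) blast+
  then have tri: "E u v \<Longrightarrow> E v w \<Longrightarrow> \<not> E u w" for u v w
    unfolding avoiders_triangle_free triangle_free_graphs_def E_def by blast
  have co: "E a c \<Longrightarrow> E a b \<or> E b c" if "{a, b, c} \<subseteq> verts G" "f a < f b" "f b < f c" for a b c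
    using f(2)[of a b c] that unfolding triple_type_def E_def by auto
  have "\<exists>X \<subseteq> verts G. \<forall>u \<in> verts G. \<forall>v \<in> verts G. E u v \<longrightarrow> (u \<in> X) \<noteq> (v \<in> X)"
  proof (rule bipartite_if_triangle_free_co_comparability[OF sD(1) f(1)])
    show "E v u" if "E u v" for u v using that sym by blast
    show "\<not> E u w" if "E u v" "E v w" for u v w using that by (rule tri)
    show "E a b \<or> E b c" if "{a, b, c} \<subseteq> verts G" "f a < f b" "f b < f c" "E a c" for a b c
      using that by (rule co)
  qed
  then obtain X where "\<forall>u \<in> verts G. \<forall>v \<in> verts G. E u v \<longrightarrow> (u \<in> X) \<noteq> (v \<in> X)"
    by auto
  then have X: "(u \<in> X) \<noteq> (v \<in> X)" if "E u v" for u v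
    using EV(1,2)[OF that] that by simp
  define L where "L = {(u, v). u \<in> verts G \<and> v \<in> verts G \<and> (if E u v then u \<in> X else f u < f v)}"
  have trans: "trans L"
  proof (intro transI)
    fix u v w assume uv: "(u, v) \<in> L" "(v, w) \<in> L"
    have V: "u \<in> verts G" "v \<in> verts G" "w \<in> verts G" using uv by (auto simp: L_def)
    have ne: "f u \<noteq> f w" if "u \<noteq> w" using that V f(1) by (metis inj_onD)
    \<comment> \<open>Two consecutive edges would put \<open>v\<close> on both sides. With exactly
      one edge, either \<open>u\<close> and \<open>w\<close> are adjacent and \<open>u\<close> is in
      \<open>X\<close>, or they are not adjacent and \<open>co\<close> forbids that \<open>f\<close>
      reverses them. With no edge, \<open>co\<close> applies to \<open>u\<close>, \<open>v\<close>,
      \<open>w\<close> directly.\<close>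
    consider "E u v" "E v w" | "E u v" "\<not> E v w" | "\<not> E u v" "E v w" | "\<not> E u v" "\<not> E v w" by blast
    then show "(u, w) \<in> L"
    proof cases
      case 1
      then show ?thesis using uv X[of u v] by (auto simp: L_def)
    next
      case 2
      then have vw: "f v < f w" "u \<in> X" using uv by (auto simp: L_def)
      have "u \<noteq> w" using 2 sym by blast
      then have "f u < f w" if "\<not> E u w"
        using co[of v w u] V vw 2 that sym ne[OF \<open>u \<noteq> w\<close>] by (metis empty_subsetI insert_subset linorder_neqE_nat)
      then show ?thesis using V vw by (auto simp: L_def)
    next
      case 3
      then have vw: "f u < f v" "v \<in> X" using uv by (auto simp: L_def)
      have uw: "u \<noteq> w" using 3 sym by blast
      show ?thesis
      proof (cases "E u w")
        case True
        then have "u \<in> X" using X[of u w] X[of v w] 3 vw by blast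
        then show ?thesis using V True by (auto simp: L_def)
      next
        case False
        then have "f u < f w" using co[of w u v] V vw 3 sym ne[OF uw] by (metis empty_subsetI insert_subset linorder_neqE_nat)
        then show ?thesis using V False by (auto simp: L_def)
      qed
    next
      case 4
      then have "f u < f v" "f v < f w" using uv by (auto simp: L_def)
      moreover from this have "\<not> E u w" using co[of u v w] V 4 by auto
      ultimately show ?thesis using V by (auto simp: L_def)
    qed
  qed
  have "(u, v) \<in> L \<or> (v, u) \<in> L" if "u \<in> verts G" "v \<in> verts G" "u \<noteq> v" for u v
    using that X[of u v] sym f(1) unfolding L_def by (auto simp: inj_on_def) (metis linorder_cases)
  moreover have "(v, v) \<notin> L" for v using EV(3) by (auto simp: L_def)
  ultimately obtain g :: "nat \<Rightarrow> nat" where g: "inj_on g (verts G)"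
      "\<And>u v. u \<in> verts G \<Longrightarrow> v \<in> verts G \<Longrightarrow> g u < g v \<longleftrightarrow> (u, v) \<in> L"
    using strict_order_ranking[OF sD(1) _ trans] by metis
  have "triple_type G a b c \<notin> {(True, True, True), (False, False, True), type_comp}"
    if "a \<in> verts G" "b \<in> verts G" "c \<in> verts G" "g a < g b" "g b < g c" for a b c
  proof -
    have "(a, b) \<in> L" "(b, c) \<in> L" using that g(2) by auto
    then have "\<not> (E a b \<and> E b c)" "\<not> E a b \<Longrightarrow> \<not> E b c \<Longrightarrow> \<not> E a c"
      using X[of a b] co[of a b c] that by (auto simp: L_def)
    then show ?thesis by (auto simp: triple_type_def E_def)
  qed
  then show "G \<in> avoiders {(True, True, True), (False, False, True), type_comp}"
    unfolding avoiders_iff_ranking using s g(1) by blast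
qed (unfold avoiders_def, blast)

text \<open>Complementation exchanges \<open>type_comp\<close> with
  \<open>(False, False, True)\<close>, so the added type again has the other parity.\<close>

lemma avoiders_co_bipartite_permutation:
  "avoiders {(False, False, False), type_comp} =
   avoiders {(False, False, False), type_comp, (False, False, True)}"
proof -
  let ?S = "{(True, True, True), (False, False, True)}"
  let ?S' = "{(True, True, True), (False, False, True), type_comp}"
  have "flip ` ?S = {(False, False, False), type_comp}"
    "flip ` ?S' = {(False, False, False), type_comp, (False, False, True)}"
    by (auto simp: flip_def)
  then show ?thesis
    using avoiders_flip[of _ ?S] avoiders_flip[of _ ?S'] avoiders_bipartite_permutation
    by (metis (no_types, lifting) avoiders_iff_ranking set_eqI)
qed

section \<open>Counting triples\<close>

lemma subset_card_le_eq_iff: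
  "finite L \<Longrightarrow> K \<subseteq> L \<Longrightarrow> card K \<le> card L \<and> (card K = card L \<longleftrightarrow> K = L)"
  using card_mono card_subset_eq by blast

text \<open>Vertices are identified with their positions \<open>1..n\<close>. The order is then that
  of the numbers, and 0 is free to mean that a vertex with some property does not exist.\<close>

locale ranked_graph =
  fixes n :: nat and E :: "nat \<Rightarrow> nat \<Rightarrow> bool"
  assumes sym: "E i j \<Longrightarrow> E j i"
    and irrefl: "\<not> E i i"
    and range: "E i j \<Longrightarrow> i \<in> {1..n}"
begin

lemma range': "E i j \<Longrightarrow> j \<in> {1..n}"
  using sym range by blast

lemma finite_nbrs [simp]: "finite {j. E j i \<and> P j}"
  by (rule finite_subset[of _ "{1..n}"]) (use range in auto)

definition left_degree :: "nat \<Rightarrow> nat" where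
  "left_degree i = card {j. E j i \<and> j < i}"

definition right_degree :: "nat \<Rightarrow> nat" where
  "right_degree i = card {j. E j i \<and> i < j}"

definition last_nbr :: "nat \<Rightarrow> nat" where
  "last_nbr i = Max (insert 0 {j. E j i \<and> j < i})"

definition last_gap :: "nat \<Rightarrow> nat" where
  "last_gap i = Max (insert 0 {j. \<not> E j i \<and> j < i})"

text \<open>With \<open>p\<close> being \<open>last_nbr\<close> or \<open>last_gap\<close>, one
  notion serves the chordal and the co-chordal test. If \<open>p c\<close> is 0, the value is
  0.\<close>

definition common_left :: "(nat \<Rightarrow> nat) \<Rightarrow> nat \<Rightarrow> nat" where
  "common_left p c = card {a. E a c \<and> E a (p c) \<and> a < p c}"

definition has_type :: "bool \<times> bool \<times> bool \<Rightarrow> bool" where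
  "has_type t \<longleftrightarrow> (\<exists>a \<in> {1..n}. \<exists>b \<in> {1..n}. \<exists>c \<in> {1..n}. a < b \<and> b < c \<and> (E a b, E b c, E a c) = t)"

lemma left_degree_0 [simp]: "left_degree 0 = 0"
  by (simp add: left_degree_def)

lemma last_nbr_props:
  "last_nbr i = 0 \<or> E (last_nbr i) i \<and> last_nbr i < i"
  "E j i \<Longrightarrow> j < i \<Longrightarrow> j \<le> last_nbr i"
proof -
  have "last_nbr i \<in> insert 0 {j. E j i \<and> j < i}"
    unfolding last_nbr_def by (intro Max_in) auto
  then show "last_nbr i = 0 \<or> E (last_nbr i) i \<and> last_nbr i < i" by auto
  show "E j i \<Longrightarrow> j < i \<Longrightarrow> j \<le> last_nbr i"
    unfolding last_nbr_def by (intro Max_ge) auto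
qed

lemma last_gap_props:
  "last_gap i = 0 \<or> \<not> E (last_gap i) i \<and> last_gap i < i"
  "\<not> E j i \<Longrightarrow> j < i \<Longrightarrow> j \<le> last_gap i"
proof -
  have "last_gap i \<in> insert 0 {j. \<not> E j i \<and> j < i}"
    unfolding last_gap_def by (intro Max_in) auto
  then show "last_gap i = 0 \<or> \<not> E (last_gap i) i \<and> last_gap i < i" by auto
  show "\<not> E j i \<Longrightarrow> j < i \<Longrightarrow> j \<le> last_gap i"
    unfolding last_gap_def by (intro Max_ge) auto
qed

lemma no_edge_0 [simp]: "\<not> E 0 i" "\<not> E i 0"
  using range[of 0] range'[of _ 0] by auto

text \<open>The usual test of a perfect elimination order: it is enough to compare the earlier
  neighbours of each vertex with those of the last one among them.\<close>

lemma chordal_order_iff_last_nbr: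
  "\<not> has_type (False, True, True) \<longleftrightarrow>
   (\<forall>c \<in> {1..n}. \<forall>a. E a c \<longrightarrow> a < last_nbr c \<longrightarrow> E a (last_nbr c))"
proof
  assume no: "\<not> has_type (False, True, True)"
  show "\<forall>c \<in> {1..n}. \<forall>a. E a c \<longrightarrow> a < last_nbr c \<longrightarrow> E a (last_nbr c)"
  proof (intro ballI allI impI)
    fix c a assume c: "c \<in> {1..n}" and a: "E a c" "a < last_nbr c"
    then have "E (last_nbr c) c" "last_nbr c < c" using last_nbr_props(1)[of c] by auto
    then show "E a (last_nbr c)"
      using no a c range[of a c] range[of "last_nbr c" c] unfolding has_type_def by fastforce
  qed
next
  assume last: "\<forall>c \<in> {1..n}. \<forall>a. E a c \<longrightarrow> a < last_nbr c \<longrightarrow> E a (last_nbr c)"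
  have "E a b" if "a < b" "b < c" "E a c" "E b c" for a b c
    using that
  \<comment> \<open>Let \<open>p\<close> be the last earlier neighbour of \<open>c\<close>. Both
    \<open>a\<close> and \<open>b\<close> are handed down to \<open>p\<close>: either
    \<open>b\<close> is \<open>p\<close> and the edge is there, or both are earlier neighbours of
    \<open>p\<close>, which is smaller than \<open>c\<close>.\<close>
  proof (induction c arbitrary: a b rule: less_induct)
    case (less c)
    have b: "b \<le> last_nbr c" using last_nbr_props(2) less.prems by simp
    then have p: "last_nbr c < c" using last_nbr_props(1)[of c] less.prems by auto
    have c: "c \<in> {1..n}" using range' less.prems by blast
    have a: "E a (last_nbr c)" using last c less.prems b by auto
    show ?case
    proof (cases "b = last_nbr c")
      case False
      then have "b < last_nbr c" using b by simp
      moreover from this have "E b (last_nbr c)" using last c less.prems by auto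
      ultimately show ?thesis using less.IH[OF p] a less.prems by auto
    qed (use a in simp)
  qed
  then show "\<not> has_type (False, True, True)" unfolding has_type_def by auto
qed

text \<open>This is the test for the complement, where the last non-neighbour plays the part of the
  last neighbour. It is put in contrapositive form, as an inclusion between sets of neighbours: the
  number of non-edges is not linear in the size of the input.\<close>

lemma co_chordal_order_iff_last_gap:
  "\<not> has_type (True, False, False) \<longleftrightarrow>
   (\<forall>c \<in> {1..n}. \<forall>a. E a (last_gap c) \<longrightarrow> a < last_gap c \<longrightarrow> E a c)"
proof
  assume no: "\<not> has_type (True, False, False)"
  show "\<forall>c \<in> {1..n}. \<forall>a. E a (last_gap c) \<longrightarrow> a < last_gap c \<longrightarrow> E a c"
  proof (intro ballI allI impI)
    fix c a assume c: "c \<in> {1..n}" and a: "E a (last_gap c)" "a < last_gap c"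
    then have "\<not> E (last_gap c) c" "last_gap c < c" using last_gap_props(1)[of c] by auto
    then show "E a c"
      using no a c range[of a "last_gap c"] range'[of a "last_gap c"] unfolding has_type_def by fastforce
  qed
next
  assume last: "\<forall>c \<in> {1..n}. \<forall>a. E a (last_gap c) \<longrightarrow> a < last_gap c \<longrightarrow> E a c"
  have "\<not> E a b" if "a < b" "b < c" "c \<in> {1..n}" "\<not> E a c" "\<not> E b c" for a b c
    using that
  proof (induction c arbitrary: a b rule: less_induct)
    case (less c)
    have b: "b \<le> last_gap c" using last_gap_props(2) less.prems by simp
    then have p: "last_gap c < c" using last_gap_props(1)[of c] less.prems by auto
    have c: "last_gap c \<in> {1..n}" using p b less.prems by auto
    have a: "\<not> E a (last_gap c)" using last less.prems b by auto
    show ?case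
    proof (cases "b = last_gap c")
      case False
      then have "b < last_gap c" using b by simp
      moreover from this have "\<not> E b (last_gap c)" using last less.prems by auto
      ultimately show ?thesis using less.IH[OF p _ _ c] a less.prems by auto
    qed (use a in simp)
  qed
  then show "\<not> has_type (True, False, False)" unfolding has_type_def by auto blast
qed

text \<open>Termwise domination lets one comparison of sums decide the equality for all vertices at
  once.\<close>

lemma sum_nat_eq_iff:
  fixes f g :: "nat \<Rightarrow> nat"
  assumes "\<And>i. i \<in> {1..n} \<Longrightarrow> f i \<le> g i"
  shows "sum f {1..n} = sum g {1..n} \<longleftrightarrow> (\<forall>i \<in> {1..n}. f i = g i)"
  using sum_mono_inv[of f "{1..n}" g] assms by (auto intro: sum.cong)

text \<open>An inclusion of finite sets is an equality of cardinalities. The earlier neighbours of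
  \<open>c\<close> other than the last one number \<open>left_degree c - 1\<close>; truncation gives
  the correct 0 if there are none.\<close>

lemma chordal_order_iff_sums:
  "\<not> has_type (False, True, True) \<longleftrightarrow>
   sum (common_left last_nbr) {1..n} = (\<Sum>c = 1..n. left_degree c - 1)"
proof -
  have "common_left last_nbr c \<le> left_degree c - 1 \<and>
      (common_left last_nbr c = left_degree c - 1 \<longleftrightarrow> (\<forall>a. E a c \<longrightarrow> a < last_nbr c \<longrightarrow> E a (last_nbr c)))"
    for c
  proof -
    let ?K = "{a. E a c \<and> E a (last_nbr c) \<and> a < last_nbr c}"
    let ?L = "{a. E a c \<and> a < last_nbr c}"
    have "left_degree c - 1 = card ?L"
    proof (cases "last_nbr c = 0")
      case True
      then have "{j. E j c \<and> j < c} = {}" using last_nbr_props(2)[of _ c] by auto (metis no_edge_0(1))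
      then have "left_degree c = 0" unfolding left_degree_def by (metis card.empty)
      then show ?thesis using True by simp
    next
      case False
      then have "E (last_nbr c) c" "last_nbr c < c" using last_nbr_props(1)[of c] by auto
      then have "{j. E j c \<and> j < c} = insert (last_nbr c) ?L"
        using last_nbr_props(2)[of _ c] by (auto simp: le_less)
      then show ?thesis by (simp add: left_degree_def)
    qed
    moreover have "?K \<subseteq> ?L" by blast
    then have "card ?K \<le> card ?L" "card ?K = card ?L \<longleftrightarrow> ?K = ?L"
      using subset_card_le_eq_iff[OF finite_nbrs] by auto
    moreover have "?K = ?L \<longleftrightarrow> (\<forall>a. E a c \<longrightarrow> a < last_nbr c \<longrightarrow> E a (last_nbr c))" by blast
    ultimately show ?thesis unfolding common_left_def by simp
  qed
  then show ?thesis
    unfolding chordal_order_iff_last_nbr by (subst sum_nat_eq_iff) auto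
qed

text \<open>Again an inclusion is tested by cardinalities. A vertex without gap has
  \<open>last_gap c = 0\<close>, and \<open>left_degree 0 = 0\<close> matches the empty
  intersection.\<close>

lemma co_chordal_order_iff_sums:
  "\<not> has_type (True, False, False) \<longleftrightarrow>
   sum (common_left last_gap) {1..n} = (\<Sum>c = 1..n. left_degree (last_gap c))"
proof -
  have "common_left last_gap c \<le> left_degree (last_gap c) \<and>
      (common_left last_gap c = left_degree (last_gap c) \<longleftrightarrow> (\<forall>a. E a (last_gap c) \<longrightarrow> a < last_gap c \<longrightarrow> E a c))"
    for c
  proof -
    let ?K = "{a. E a c \<and> E a (last_gap c) \<and> a < last_gap c}"
    let ?L = "{a. E a (last_gap c) \<and> a < last_gap c}"
    have "?K \<subseteq> ?L" by blast
    then have "card ?K \<le> card ?L" "card ?K = card ?L \<longleftrightarrow> ?K = ?L"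
      using subset_card_le_eq_iff[OF finite_nbrs] by auto
    moreover have "?K = ?L \<longleftrightarrow> (\<forall>a. E a (last_gap c) \<longrightarrow> a < last_gap c \<longrightarrow> E a c)" by blast
    ultimately show ?thesis unfolding common_left_def left_degree_def by simp
  qed
  then show ?thesis
    unfolding co_chordal_order_iff_last_gap by (subst sum_nat_eq_iff) auto
qed

section \<open>Inclusion and exclusion over increasing triples\<close>

definition triple_sum :: "(nat \<Rightarrow> nat \<Rightarrow> nat \<Rightarrow> int) \<Rightarrow> int" where
  "triple_sum g = (\<Sum>a = 1..n. \<Sum>b = 1..n. \<Sum>c = 1..n. of_bool (a < b) * of_bool (b < c) * g a b c)"

definition triple_count :: "bool \<times> bool \<times> bool \<Rightarrow> int" where
  "triple_count t = triple_sum (\<lambda>a b c. of_bool ((E a b, E b c, E a c) = t))"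

lemma triple_count_nonneg: "0 \<le> triple_count t"
  unfolding triple_count_def triple_sum_def by (intro sum_nonneg) simp

lemma triple_count_eq_0_iff: "triple_count t = 0 \<longleftrightarrow> \<not> has_type t"
  unfolding triple_count_def triple_sum_def has_type_def
  by (simp add: sum_nonneg_eq_0_iff sum_nonneg) blast

abbreviation e :: "nat \<Rightarrow> nat \<Rightarrow> int" where
  "e i j \<equiv> of_bool (E i j)"

lemma left_degree_sum: "int (left_degree i) = (\<Sum>j = 1..n. of_bool (j < i) * e j i)"
proof -
  have "{j. E j i \<and> j < i} = {1..n} \<inter> {j. j < i \<and> E j i}" using range by auto
  then show ?thesis unfolding left_degree_def
    by (simp add: sum.If_cases flip: of_bool_conj)
qed

lemma right_degree_sum: "int (right_degree i) = (\<Sum>j = 1..n. of_bool (i < j) * e i j)"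
proof -
  have "{j. E j i \<and> i < j} = {1..n} \<inter> {j. i < j \<and> E i j}" using range sym by auto
  then show ?thesis unfolding right_degree_def
    by (simp add: sum.If_cases flip: of_bool_conj)
qed

lemma card_left: "i \<in> {1..n} \<Longrightarrow> (\<Sum>j = 1..n. of_bool (j < i) * 1) = int i - 1"
proof -
  assume "i \<in> {1..n}"
  moreover from this have "{j \<in> {1..n}. j < i} = {1..<i}" by auto
  ultimately show ?thesis by (simp add: Int_def of_nat_diff)
qed

lemma card_right: "i \<in> {1..n} \<Longrightarrow> (\<Sum>j = 1..n. of_bool (i < j) * 1) = int n - int i"
proof -
  assume "i \<in> {1..n}"
  moreover from this have "{j \<in> {1..n}. i < j} = {i<..n}" by auto
  ultimately show ?thesis by (simp add: Int_def of_nat_diff)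
qed

lemma card_between:
  assumes "i \<in> {1..n}" "k \<in> {1..n}"
  shows "(\<Sum>j = 1..n. of_bool (i < j) * of_bool (j < k)) = of_bool (i < k) * (int k - 1 - int i)"
proof -
  have "{j \<in> {1..n}. i < j \<and> j < k} = {i<..<k}" using assms by auto
  then have "(\<Sum>j = 1..n. of_bool (i < j \<and> j < k)) = int (card {i<..<k})" by (simp add: Int_def)
  then show ?thesis by (auto simp: of_bool_conj)
qed

text \<open>For a fixed middle vertex the choices of \<open>a\<close> and \<open>c\<close> are
  independent; this settles all weights that do not involve the pair \<open>ac\<close>.\<close>

lemma triple_sum_middle:
  assumes "\<And>b. b \<in> {1..n} \<Longrightarrow> (\<Sum>a = 1..n. of_bool (a < b) * f a b) = F b"
    and "\<And>b. b \<in> {1..n} \<Longrightarrow> (\<Sum>c = 1..n. of_bool (b < c) * g b c) = G b"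
  shows "triple_sum (\<lambda>a b c. f a b * g b c) = (\<Sum>b = 1..n. F b * G b)"
proof -
  have "triple_sum (\<lambda>a b c. f a b * g b c) =
     (\<Sum>b = 1..n. (\<Sum>a = 1..n. of_bool (a < b) * f a b) * (\<Sum>c = 1..n. of_bool (b < c) * g b c))"
    unfolding triple_sum_def sum_product
    by (subst sum.swap, intro sum.cong refl) (simp add: mult_ac)
  also have "\<dots> = (\<Sum>b = 1..n. F b * G b)"
    by (intro sum.cong refl) (simp only: assms)
  finally show ?thesis .
qed

text \<open>The square of the sum splits into the parts \<open>i < j\<close>, \<open>j < i\<close>
  and \<open>i = j\<close>; the first two agree by symmetry, and idempotence turns the last into the
  plain sum.\<close>

lemma double_pair_sum:
  fixes x :: "nat \<Rightarrow> int"
  assumes "\<And>i. x i * x i = x i"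
  shows "2 * (\<Sum>i = 1..n. \<Sum>j = 1..n. of_bool (i < j) * (x i * x j)) = (\<Sum>i = 1..n. x i) * ((\<Sum>i = 1..n. x i) - 1)"
proof -
  have "(\<Sum>i = 1..n. \<Sum>j = 1..n. of_bool (i < j) * (x i * x j)) = (\<Sum>i = 1..n. \<Sum>j = 1..n. of_bool (j < i) * (x i * x j))"
    by (subst sum.swap) (simp add: mult_ac)
  moreover have "(\<Sum>i = 1..n. x i) = (\<Sum>i = 1..n. \<Sum>j = 1..n. of_bool (i = j) * (x i * x j))"
    by (intro sum.cong refl) (simp add: assms of_bool_def if_distrib[of "\<lambda>y. y * _"] cong: if_cong)
  moreover have "(\<Sum>i = 1..n. x i) * (\<Sum>i = 1..n. x i) = (\<Sum>i = 1..n. \<Sum>j = 1..n. of_bool (i < j) * (x i * x j))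
     + (\<Sum>i = 1..n. \<Sum>j = 1..n. of_bool (j < i) * (x i * x j)) + (\<Sum>i = 1..n. \<Sum>j = 1..n. of_bool (i = j) * (x i * x j))"
    unfolding sum_product sum.distrib[symmetric]
    by (intro sum.cong refl) (auto simp: of_bool_def)
  ultimately show ?thesis by (simp add: algebra_simps)
qed

text \<open>Four sums factor at the middle vertex. For an edge \<open>ac\<close> the
  \<open>c - 1 - a\<close> vertices in between are counted, and the difference is split into a share
  of \<open>c\<close> and a share of \<open>a\<close>. The last two count pairs of later, or of
  earlier, neighbours of one vertex. Only the product of all three edges has no such
  formula.\<close>

lemma triple_sums:
  "triple_sum (\<lambda>a b c. 1) = (\<Sum>i = 1..n. (int i - 1) * (int n - int i))"
  "triple_sum (\<lambda>a b c. e a b) = (\<Sum>i = 1..n. int (left_degree i) * (int n - int i))"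
  "triple_sum (\<lambda>a b c. e b c) = (\<Sum>i = 1..n. (int i - 1) * int (right_degree i))"
  "triple_sum (\<lambda>a b c. e a b * e b c) = (\<Sum>i = 1..n. int (left_degree i) * int (right_degree i))"
  "triple_sum (\<lambda>a b c. e a c) = (\<Sum>i = 1..n. int (left_degree i) * (int i - 1)) - (\<Sum>i = 1..n. int (right_degree i) * int i)"
  "2 * triple_sum (\<lambda>a b c. e a b * e a c) = (\<Sum>i = 1..n. int (right_degree i) * (int (right_degree i) - 1))"
  "2 * triple_sum (\<lambda>a b c. e a c * e b c) = (\<Sum>i = 1..n. int (left_degree i) * (int (left_degree i) - 1))"
proof -
  show "triple_sum (\<lambda>a b c. 1) = (\<Sum>i = 1..n. (int i - 1) * (int n - int i))"
    using triple_sum_middle[of "\<lambda>_ _. 1", OF card_left card_right] by simp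
  show "triple_sum (\<lambda>a b c. e a b) = (\<Sum>i = 1..n. int (left_degree i) * (int n - int i))"
    using triple_sum_middle[OF left_degree_sum[symmetric] card_right] by simp
  show "triple_sum (\<lambda>a b c. e b c) = (\<Sum>i = 1..n. (int i - 1) * int (right_degree i))"
    using triple_sum_middle[of "\<lambda>_ _. 1", OF card_left right_degree_sum[symmetric]] by simp
  show "triple_sum (\<lambda>a b c. e a b * e b c) = (\<Sum>i = 1..n. int (left_degree i) * int (right_degree i))"
    by (rule triple_sum_middle[OF left_degree_sum[symmetric] right_degree_sum[symmetric]])
  have "triple_sum (\<lambda>a b c. e a c) = (\<Sum>a = 1..n. \<Sum>c = 1..n. e a c * (\<Sum>b = 1..n. of_bool (a < b) * of_bool (b < c)))"
    unfolding triple_sum_def sum_distrib_left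
    by (rule sum.cong[OF refl], subst sum.swap, intro sum.cong refl) (simp add: mult_ac)
  also have "\<dots> = (\<Sum>a = 1..n. \<Sum>c = 1..n. e a c * (of_bool (a < c) * (int c - 1 - int a)))"
    by (intro sum.cong refl) (simp only: card_between)
  also have "\<dots> = (\<Sum>a = 1..n. \<Sum>c = 1..n. (of_bool (a < c) * e a c) * (int c - 1)) - (\<Sum>a = 1..n. (\<Sum>c = 1..n. of_bool (a < c) * e a c) * int a)"
    unfolding sum_distrib_right sum_subtractf[symmetric]
    by (intro sum.cong refl) (auto simp: algebra_simps)
  also have "(\<Sum>a = 1..n. \<Sum>c = 1..n. (of_bool (a < c) * e a c) * (int c - 1)) = (\<Sum>i = 1..n. int (left_degree i) * (int i - 1))"
    by (subst sum.swap) (simp only: left_degree_sum sum_distrib_right)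
  finally show "triple_sum (\<lambda>a b c. e a c) = (\<Sum>i = 1..n. int (left_degree i) * (int i - 1)) - (\<Sum>i = 1..n. int (right_degree i) * int i)"
    by (simp only: right_degree_sum)
  have "triple_sum (\<lambda>a b c. e a b * e a c) = (\<Sum>a = 1..n. \<Sum>b = 1..n. \<Sum>c = 1..n. of_bool (b < c) * ((of_bool (a < b) * e a b) * (of_bool (a < c) * e a c)))"
    unfolding triple_sum_def by (intro sum.cong refl) auto
  then have "2 * triple_sum (\<lambda>a b c. e a b * e a c) = (\<Sum>a = 1..n. 2 * (\<Sum>b = 1..n. \<Sum>c = 1..n. of_bool (b < c) * ((of_bool (a < b) * e a b) * (of_bool (a < c) * e a c))))"
    by (simp only: sum_distrib_left)
  then show "2 * triple_sum (\<lambda>a b c. e a b * e a c) = (\<Sum>i = 1..n. int (right_degree i) * (int (right_degree i) - 1))"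
    unfolding right_degree_sum by (subst (asm) double_pair_sum) auto
  have "triple_sum (\<lambda>a b c. e a c * e b c) = (\<Sum>c = 1..n. \<Sum>a = 1..n. \<Sum>b = 1..n. of_bool (a < b) * ((of_bool (a < c) * e a c) * (of_bool (b < c) * e b c)))"
  proof -
    have "triple_sum (\<lambda>a b c. e a c * e b c) = (\<Sum>a = 1..n. \<Sum>c = 1..n. \<Sum>b = 1..n. of_bool (a < b) * of_bool (b < c) * (e a c * e b c))"
      unfolding triple_sum_def by (rule sum.cong[OF refl], rule sum.swap)
    also have "\<dots> = (\<Sum>c = 1..n. \<Sum>a = 1..n. \<Sum>b = 1..n. of_bool (a < b) * of_bool (b < c) * (e a c * e b c))"
      by (rule sum.swap)
    also have "\<dots> = (\<Sum>c = 1..n. \<Sum>a = 1..n. \<Sum>b = 1..n. of_bool (a < b) * ((of_bool (a < c) * e a c) * (of_bool (b < c) * e b c)))"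
      by (intro sum.cong refl) auto
    finally show ?thesis .
  qed
  then have "2 * triple_sum (\<lambda>a b c. e a c * e b c) = (\<Sum>c = 1..n. 2 * (\<Sum>a = 1..n. \<Sum>b = 1..n. of_bool (a < b) * ((of_bool (a < c) * e a c) * (of_bool (b < c) * e b c))))"
    by (simp only: sum_distrib_left)
  then show "2 * triple_sum (\<lambda>a b c. e a c * e b c) = (\<Sum>i = 1..n. int (left_degree i) * (int (left_degree i) - 1))"
    unfolding left_degree_sum by (subst (asm) double_pair_sum) auto
qed

end

section \<open>Tests that compare two sums of expressions\<close>

abbreviation (input) "rank_var \<equiv> Var ''i''"
abbreviation (input) "size_var \<equiv> Var ''n''"
abbreviation (input) "Ldeg \<equiv> Read ''left'' (Var ''i'')"
abbreviation (input) "Rdeg \<equiv> Read ''right'' (Var ''i'')"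

definition twice :: "expr \<Rightarrow> expr" where
  "twice x = Op Add x x"

text \<open>The summands at rank \<open>i\<close> of the doubled sums in \<open>triple_sums\<close>,
  named after the required edges. The last two are not wrapped in \<open>twice\<close>, because
  counting ordered pairs of neighbours doubles already.\<close>

definition "expr_1 = twice (Op Mul (Op Sub rank_var (Const 1)) (Op Sub size_var rank_var))"
definition "expr_ab = twice (Op Mul Ldeg (Op Sub size_var rank_var))"
definition "expr_bc = twice (Op Mul (Op Sub rank_var (Const 1)) Rdeg)"
definition "expr_ac_pos = twice (Op Mul Ldeg (Op Sub rank_var (Const 1)))"
definition "expr_ac_neg = twice (Op Mul Rdeg rank_var)"
definition "expr_ab_bc = twice (Op Mul Ldeg Rdeg)"
definition "expr_ab_ac = Op Mul Rdeg (Op Sub Rdeg (Const 1))"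
definition "expr_ac_bc = Op Mul Ldeg (Op Sub Ldeg (Const 1))"

lemmas expr_defs = expr_1_def expr_ab_def expr_bc_def expr_ac_pos_def expr_ac_neg_def
  expr_ab_bc_def expr_ab_ac_def expr_ac_bc_def twice_def

text \<open>Twice the number of triples of type \<open>t\<close> is the sum over all ranks \<open>i\<close> of \<open>pos_expr t\<close> minus
  \<open>neg_expr t\<close>, up to triangles. The factor 2 avoids a division in \<open>expr_ab_ac\<close>, and the two parts
  are kept apart because subtraction on words is truncated.\<close>

fun pos_expr :: "bool \<times> bool \<times> bool \<Rightarrow> expr" where
  "pos_expr (True, True, True) = Const 0"
| "pos_expr (True, True, False) = expr_ab_bc"
| "pos_expr (True, False, True) = expr_ab_ac"
| "pos_expr (False, True, True) = expr_ac_bc"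
| "pos_expr (True, False, False) = expr_ab"
| "pos_expr (False, True, False) = expr_bc"
| "pos_expr (False, False, True) = expr_ac_pos"
| "pos_expr (False, False, False) =
     Op Add (Op Add expr_1 expr_ac_neg) (Op Add expr_ab_bc (Op Add expr_ab_ac expr_ac_bc))"

fun neg_expr :: "bool \<times> bool \<times> bool \<Rightarrow> expr" where
  "neg_expr (True, False, False) = Op Add expr_ab_bc expr_ab_ac"
| "neg_expr (False, True, False) = Op Add expr_ab_bc expr_ac_bc"
| "neg_expr (False, False, True) = Op Add expr_ac_neg (Op Add expr_ab_ac expr_ac_bc)"
| "neg_expr (False, False, False) = Op Add expr_ab (Op Add expr_bc expr_ac_pos)"
| "neg_expr _ = Const 0"

definition odd_type :: "bool \<times> bool \<times> bool \<Rightarrow> bool" where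
  "odd_type t = (case t of (p, q, r) \<Rightarrow> (p \<noteq> q) \<noteq> r)"

text \<open>The coefficient of the triangle count: each missing edge contributes a factor -1 to the
  product of all three indicators, and the number of missing edges is even exactly if the number of
  edges is odd.\<close>

definition type_sign :: "bool \<times> bool \<times> bool \<Rightarrow> int" where
  "type_sign t = (if odd_type t then 1 else - 1)"

definition at_rank :: "state \<Rightarrow> nat \<Rightarrow> state" where
  "at_rank s i = s\<lparr>scalar := (scalar s)(''i'' := i)\<rparr>"

text \<open>The fragment in which the tests are written. Its values are determined by the rank
  \<open>i\<close> and the preprocessed data, hence unaffected by the accumulators of the program.
  The single indirect access, \<open>left\<close> at \<open>gap\<close>, is the one that the
  co-chordal test requires.\<close>

fun local_expr :: "expr \<Rightarrow> bool" where
  "local_expr (Const k) \<longleftrightarrow> True"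
| "local_expr (Var x) \<longleftrightarrow> x = ''i'' \<or> x = ''n''"
| "local_expr (Read a e) \<longleftrightarrow>
     a \<in> {''left'', ''right'', ''gap'', ''common_nbr'', ''common_gap''} \<and>
     (e = Var ''i'' \<or> a = ''left'' \<and> e = Read ''gap'' (Var ''i''))"
| "local_expr (Op f e1 e2) \<longleftrightarrow> local_expr e1 \<and> local_expr e2"

lemma local_expr_types: "local_expr (pos_expr t)" "local_expr (neg_expr t)"
  by (cases t rule: pos_expr.cases; simp add: expr_defs)+

abbreviation (input) "nbr_test \<equiv> (Read ''common_nbr'' rank_var, Op Sub Ldeg (Const 1))"
abbreviation (input) "gap_test \<equiv> (Read ''common_gap'' rank_var, Read ''left'' (Read ''gap'' rank_var))"

context ranked_graph
begin

text \<open>The interface between counting and programming: what preprocessing has to leave in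
  memory. Cell 0 of \<open>left\<close> is read when a vertex has no gap.\<close>

definition prepared :: "state \<Rightarrow> bool" where
  "prepared s \<longleftrightarrow> scalar s ''n'' = n \<and> array s ''left'' 0 = 0 \<and>
     (\<forall>i \<in> {1..n}. array s ''left'' i = left_degree i \<and> array s ''right'' i = right_degree i \<and>
        array s ''gap'' i = last_gap i \<and> array s ''common_nbr'' i = common_left last_nbr i \<and>
        array s ''common_gap'' i = common_left last_gap i)"

definition total :: "expr \<Rightarrow> state \<Rightarrow> nat" where
  "total g s = (\<Sum>i = 1..n. eval g (at_rank s i))"

lemma total_Add: "total (Op Add g h) s = total g s + total h s"
  by (simp add: total_def sum.distrib)

lemma total_twice: "total (twice g) s = 2 * total g s"
  by (simp add: twice_def total_Add)

lemma total_Const_0: "total (Const 0) s = 0"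
  by (simp add: total_def)

lemma nat_pred_mult: "int k * int (k - Suc 0) = int k * int k - int k"
  by (cases k) (auto simp: algebra_simps)

text \<open>For ranks between 1 and \<open>n\<close> the subtractions do not underflow, except for a
  degree 0 minus 1, where the other factor is 0.\<close>

lemma total_exprs:
  assumes "prepared s"
  shows "int (total expr_1 s) = 2 * triple_sum (\<lambda>a b c. 1)"
    "int (total expr_ab s) = 2 * triple_sum (\<lambda>a b c. e a b)"
    "int (total expr_bc s) = 2 * triple_sum (\<lambda>a b c. e b c)"
    "int (total expr_ac_pos s) = 2 * triple_sum (\<lambda>a b c. e a c) + int (total expr_ac_neg s)"
    "int (total expr_ab_bc s) = 2 * triple_sum (\<lambda>a b c. e a b * e b c)"
    "int (total expr_ab_ac s) = 2 * triple_sum (\<lambda>a b c. e a b * e a c)"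
    "int (total expr_ac_bc s) = 2 * triple_sum (\<lambda>a b c. e a c * e b c)"
  using assms unfolding triple_sums expr_1_def expr_ab_def expr_bc_def expr_ac_pos_def expr_ac_neg_def
      expr_ab_bc_def expr_ab_ac_def expr_ac_bc_def total_twice
  by (simp_all add: total_def prepared_def at_rank_def of_nat_diff nat_pred_mult sum_distrib_left right_diff_distrib
      cong: sum.cong_simp)

lemma triple_sum_add: "triple_sum (\<lambda>a b c. f a b c + g a b c) = triple_sum f + triple_sum g"
  unfolding triple_sum_def by (simp only: distrib_left sum.distrib)

lemma triple_sum_diff: "triple_sum (\<lambda>a b c. f a b c - g a b c) = triple_sum f - triple_sum g"
  unfolding triple_sum_def by (simp only: right_diff_distrib sum_subtractf)

text \<open>Every missing edge is a factor \<open>1 - e\<close>, and the expansion of the product is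
  pointwise. The sums are regrouped by sign, and \<open>?T\<close>, the product of all three edges,
  is left over as the triangle count.\<close>

lemma triple_count_total:
  assumes "prepared s"
  shows "2 * triple_count t = int (total (pos_expr t) s) - int (total (neg_expr t) s) +
    2 * type_sign t * triple_count (True, True, True)"
proof -
  let ?ab = "\<lambda>a b c. e a b" and ?bc = "\<lambda>a b c. e b c" and ?ac = "\<lambda>a b c. e a c"
  let ?T = "\<lambda>a b c. of_bool ((E a b, E b c, E a c) = (True, True, True))"
  let ?abbc = "\<lambda>a b c. e a b * e b c" and ?abac = "\<lambda>a b c. e a b * e a c" and ?acbc = "\<lambda>a b c. e a c * e b c"
  define T where "T = triple_sum ?T"
  have "triple_count (True, True, False) = triple_sum (\<lambda>a b c. ?abbc a b c - ?T a b c)"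
    unfolding triple_count_def by (rule arg_cong[of _ _ triple_sum]) (auto simp: fun_eq_iff)
  moreover have "triple_count (True, False, True) = triple_sum (\<lambda>a b c. ?abac a b c - ?T a b c)"
    unfolding triple_count_def by (rule arg_cong[of _ _ triple_sum]) (auto simp: fun_eq_iff)
  moreover have "triple_count (False, True, True) = triple_sum (\<lambda>a b c. ?acbc a b c - ?T a b c)"
    unfolding triple_count_def by (rule arg_cong[of _ _ triple_sum]) (auto simp: fun_eq_iff)
  moreover have "triple_count (True, False, False) = triple_sum (\<lambda>a b c. ?ab a b c - ?abbc a b c - ?abac a b c + ?T a b c)"
    unfolding triple_count_def by (rule arg_cong[of _ _ triple_sum]) (auto simp: fun_eq_iff)
  moreover have "triple_count (False, True, False) = triple_sum (\<lambda>a b c. ?bc a b c - ?abbc a b c - ?acbc a b c + ?T a b c)"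
    unfolding triple_count_def by (rule arg_cong[of _ _ triple_sum]) (auto simp: fun_eq_iff)
  moreover have "triple_count (False, False, True) = triple_sum (\<lambda>a b c. ?ac a b c - ?abac a b c - ?acbc a b c + ?T a b c)"
    unfolding triple_count_def by (rule arg_cong[of _ _ triple_sum]) (auto simp: fun_eq_iff)
  moreover have "triple_count (False, False, False) = triple_sum (\<lambda>a b c. 1 - ?ab a b c - ?bc a b c - ?ac a b c
      + ?abbc a b c + ?abac a b c + ?acbc a b c - ?T a b c)"
    unfolding triple_count_def by (rule arg_cong[of _ _ triple_sum]) (auto simp: fun_eq_iff)
  moreover have "triple_count (True, True, True) = triple_sum ?T"
    unfolding triple_count_def by simp
  ultimately show ?thesis
    by (cases t rule: pos_expr.cases)
      (simp_all only: triple_sum_add triple_sum_diff pos_expr.simps neg_expr.simps total_Add total_Const_0 of_nat_add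
        total_exprs[OF assms] type_sign_def odd_type_def, simp_all)
qed

text \<open>The sum of the two counts is free of triangles, and as both are nonnegative it is zero
  only if both types are absent.\<close>

lemma detect_opposite_parity:
  assumes "prepared s" "odd_type t \<noteq> odd_type u"
  shows "total (Op Add (pos_expr t) (pos_expr u)) s \<noteq> total (Op Add (neg_expr t) (neg_expr u)) s
    \<longleftrightarrow> has_type t \<or> has_type u"
  using triple_count_total[OF assms(1), of t] triple_count_total[OF assms(1), of u] assms(2)
    triple_count_nonneg[of t] triple_count_nonneg[of u] triple_count_eq_0_iff[of t] triple_count_eq_0_iff[of u]
  by (auto simp: total_Add type_sign_def split: if_splits)

text \<open>The count of \<open>u\<close> is 0, so the difference of the counts, in which the
  triangles cancel, is the count of \<open>t\<close> itself.\<close>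

lemma detect_same_parity:
  assumes "prepared s" "odd_type t = odd_type u" "\<not> has_type u"
  shows "total (Op Add (pos_expr t) (neg_expr u)) s \<noteq> total (Op Add (neg_expr t) (pos_expr u)) s
    \<longleftrightarrow> has_type t"
  using triple_count_total[OF assms(1), of t] triple_count_total[OF assms(1), of u] assms(2,3)
    triple_count_eq_0_iff[of t] triple_count_eq_0_iff[of u]
  by (auto simp: total_Add type_sign_def split: if_splits)

lemma detect_nbr_test:
  assumes "prepared s"
  shows "total (fst nbr_test) s \<noteq> total (snd nbr_test) s \<longleftrightarrow> has_type (False, True, True)"
proof -
  have "total (fst nbr_test) s = sum (common_left last_nbr) {1..n}"
    "total (snd nbr_test) s = (\<Sum>c = 1..n. left_degree c - 1)"
    using assms unfolding total_def prepared_def at_rank_def by (auto intro: sum.cong)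
  then show ?thesis using chordal_order_iff_sums by metis
qed

lemma detect_gap_test:
  assumes "prepared s"
  shows "total (fst gap_test) s \<noteq> total (snd gap_test) s \<longleftrightarrow> has_type (True, False, False)"
proof -
  have "array s ''left'' (last_gap i) = left_degree (last_gap i)" if "i \<in> {1..n}" for i
    using assms last_gap_props(1)[of i] that unfolding prepared_def
    by (cases "last_gap i = 0") auto
  then have "total (snd gap_test) s = (\<Sum>c = 1..n. left_degree (last_gap c))"
    using assms unfolding total_def prepared_def at_rank_def by (auto intro: sum.cong)
  moreover have "total (fst gap_test) s = sum (common_left last_gap) {1..n}"
    using assms unfolding total_def prepared_def at_rank_def by (auto intro: sum.cong)
  ultimately show ?thesis using co_chordal_order_iff_sums by metis
qed

definition detects :: "(expr \<times> expr) list \<Rightarrow> (bool \<times> bool \<times> bool) set \<Rightarrow> bool" where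
  "detects tests S \<longleftrightarrow> (\<forall>s. prepared s \<longrightarrow>
     ((\<exists>(g, h) \<in> set tests. total g s \<noteq> total h s) \<longleftrightarrow> (\<exists>t \<in> S. has_type t)))"

end

definition mixed_tests :: "(bool \<times> bool \<times> bool) list \<Rightarrow> (expr \<times> expr) list" where
  "mixed_tests ts = [(Op Add (pos_expr t) (pos_expr u), Op Add (neg_expr t) (neg_expr u)).
     t \<leftarrow> ts, u \<leftarrow> ts, odd_type t \<noteq> odd_type u]"

definition relative_tests :: "bool \<times> bool \<times> bool \<Rightarrow> (bool \<times> bool \<times> bool) list \<Rightarrow> (expr \<times> expr) list" where
  "relative_tests u ts = [(Op Add (pos_expr t) (neg_expr u), Op Add (neg_expr t) (pos_expr u)). t \<leftarrow> ts]"

text \<open>The first alternative amounts to \<open>S\<close> being empty or containing both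
  parities; the second is the case of one parity with a chordal or co-chordal type as
  reference.\<close>

definition detectable_types :: "(bool \<times> bool \<times> bool) set \<Rightarrow> bool" where
  "detectable_types S \<longleftrightarrow>
     (\<forall>t \<in> S. \<exists>u \<in> S. odd_type t \<noteq> odd_type u) \<or>
     (\<exists>u \<in> S. u \<in> {(False, True, True), (True, False, False)} \<and> (\<forall>t \<in> S. odd_type t = odd_type u))"

text \<open>The tests are fixed before \<open>n\<close> and \<open>E\<close>: this uniformity yields
  a single program for all graphs.\<close>

lemma detectable_types_tests:
  assumes "detectable_types S"
  obtains tests where "\<And>g h. (g, h) \<in> set tests \<Longrightarrow> local_expr g \<and> local_expr h"
    "\<And>n E. ranked_graph n E \<Longrightarrow> ranked_graph.detects n E tests S"
proof -
  have "finite S" by simp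
  then obtain ts where ts: "set ts = S" using finite_list by blast
  from assms show ?thesis
    unfolding detectable_types_def
  proof (elim disjE bexE conjE)
    assume mixed: "\<forall>t \<in> S. \<exists>u \<in> S. odd_type t \<noteq> odd_type u"
    show ?thesis
    proof (rule that[of "mixed_tests ts"])
      show "local_expr g \<and> local_expr h" if "(g, h) \<in> set (mixed_tests ts)" for g h
        using that by (auto simp: mixed_tests_def local_expr_types split: if_splits)
    next
      fix n E assume "ranked_graph n E"
      then interpret ranked_graph n E .
      have "(\<exists>(g, h) \<in> set (mixed_tests ts). total g s \<noteq> total h s) \<longleftrightarrow>
          (\<exists>t \<in> S. \<exists>u \<in> S. odd_type t \<noteq> odd_type u \<and> (has_type t \<or> has_type u))" if "prepared s" for s
      proof -
        have "(\<exists>(g, h) \<in> set (mixed_tests ts). total g s \<noteq> total h s) \<longleftrightarrow>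
          (\<exists>t \<in> S. \<exists>u \<in> S. odd_type t \<noteq> odd_type u \<and>
            total (Op Add (pos_expr t) (pos_expr u)) s \<noteq> total (Op Add (neg_expr t) (neg_expr u)) s)"
          unfolding mixed_tests_def using ts by (auto split: if_splits) 
        then show ?thesis using detect_opposite_parity[OF that] by blast
      qed
      then show "detects (mixed_tests ts) S" unfolding detects_def using mixed by blast
    qed
  next
    fix u assume u: "u \<in> S" "u \<in> {(False, True, True), (True, False, False)}"
      and same: "\<forall>t \<in> S. odd_type t = odd_type u"
    define test where "test = (if u = (False, True, True) then nbr_test else gap_test)"
    show ?thesis
    proof (rule that[of "test # relative_tests u ts"])
      show "local_expr g \<and> local_expr h" if "(g, h) \<in> set (test # relative_tests u ts)" for g h
        using that by (auto simp: relative_tests_def test_def local_expr_types simp del: pos_expr.simps neg_expr.simps split: if_splits)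
    next
      fix n E assume "ranked_graph n E"
      then interpret ranked_graph n E .
      have "(\<exists>(g, h) \<in> set (test # relative_tests u ts). total g s \<noteq> total h s) \<longleftrightarrow> (\<exists>t \<in> S. has_type t)"
        if s: "prepared s" for s
      proof -
        have test: "total (fst test) s \<noteq> total (snd test) s \<longleftrightarrow> has_type u"
          using u(2) detect_nbr_test[OF s] detect_gap_test[OF s] unfolding test_def by auto
        have rel: "(\<exists>(g, h) \<in> set (relative_tests u ts). total g s \<noteq> total h s) \<longleftrightarrow>
          (\<exists>t \<in> S. total (Op Add (pos_expr t) (neg_expr u)) s \<noteq> total (Op Add (neg_expr t) (pos_expr u)) s)"
          unfolding relative_tests_def using ts by auto
        show ?thesis
        proof (cases "has_type u")
          \<comment> \<open>The relative tests are meaningless if \<open>u\<close> occurs, but then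
            the answer is positive whatever they say.\<close>
          case True
          then show ?thesis using test u(1) by (auto simp: case_prod_unfold)
        next
          case False
          then show ?thesis using test rel detect_same_parity[OF s _ False] same
            by (simp add: case_prod_unfold)
        qed
      qed
      then show "detects (test # relative_tests u ts) S" unfolding detects_def by blast
    qed
  qed
qed

text \<open>If neither \<open>S\<close> nor its mirror image is detectable, then \<open>S\<close> is
  nonempty, of one parity, and contains none of the chordal and co-chordal types in either
  direction. Two types per parity survive; the singletons give the excluded classes, and the two
  pairs acquire a third type of the other parity.\<close>

lemma detectable_representative:
  assumes "avoiders S \<noteq> comparability_graphs" "avoiders S \<noteq> co_comparability_graphs"
    "avoiders S \<noteq> triangle_free_graphs" "avoiders S \<noteq> co_triangle_free_graphs"
  obtains S' where "detectable_types S'" "avoiders S' = avoiders S"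
proof (cases "detectable_types S")
  case True
  then show ?thesis using that by blast
next
  case nd: False
  have "detectable_types (mirror ` S) \<or>
     S = {(True, True, True), (False, False, True)} \<or> S = {(False, False, False), type_comp}"
  proof -
    obtain u where u: "u \<in> S" "\<And>t. t \<in> S \<Longrightarrow> odd_type t = odd_type u"
      using nd unfolding detectable_types_def by blast
    then have nS: "t \<notin> S" if "t \<in> {(False, True, True), (True, False, False)}" for t
      using nd that unfolding detectable_types_def by metis
    have odd_mirror: "odd_type (mirror t) = odd_type t" for t
      by (auto simp: odd_type_def mirror_def split: prod.split)
    have nM: "t \<notin> S" if "mirror t \<in> {(False, True, True), (True, False, False)}" "\<not> detectable_types (mirror ` S)" for t
    proof
      assume "t \<in> S"
      then have "mirror t \<in> mirror ` S" "\<forall>t' \<in> mirror ` S. odd_type t' = odd_type (mirror t)"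
        using u(2) by (auto simp: odd_mirror)
      then show False using that unfolding detectable_types_def by blast
    qed
    have "S = {(True, True, True), (False, False, True)} \<or> S = {(False, False, False), type_comp}"
      if M: "\<not> detectable_types (mirror ` S)"
    proof -
      have "(False, True, True) \<notin> S" "(True, False, False) \<notin> S" using nS by blast+
      moreover have "(True, False, True) \<notin> S" "(False, True, False) \<notin> S"
        using nM[OF _ M] by (simp_all add: mirror_def)
      ultimately have sub: "t \<in> S \<Longrightarrow>
          t \<in> (if odd_type u then {(True, True, True), (False, False, True)} else {(False, False, False), type_comp})" for t
        using u(2)[of t] by (cases t rule: pos_expr.cases) (auto simp: odd_type_def)
      \<comment> \<open>A singleton would make \<open>avoiders S\<close> one of the four excluded
        classes.\<close>
      have ne: "S \<noteq> {}" "S \<noteq> {(True, True, True)}" "S \<noteq> {(False, False, True)}" "S \<noteq> {(False, False, False)}" "S \<noteq> {type_comp}"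
        using u(1) assms avoiders_comparability avoiders_co_comparability avoiders_triangle_free
          avoiders_co_triangle_free by blast+
      have "S \<subseteq> (if odd_type u then {(True, True, True), (False, False, True)} else {(False, False, False), type_comp})"
        using sub by blast
      moreover have two: "S = {} \<or> S = {x} \<or> S = {y} \<or> S = {x, y}" if "S \<subseteq> {x, y}" for x y
        using that by blast
      ultimately consider "S \<subseteq> {(True, True, True), (False, False, True)}" | "S \<subseteq> {(False, False, False), type_comp}"
        by (cases "odd_type u") simp_all
      then show ?thesis
      proof cases
        case 1
        from two[OF this] ne show ?thesis by simp
      next
        case 2
        from two[OF this] ne show ?thesis by simp
      qed
    qed
    then show ?thesis by blast
  qed
  then show ?thesis
  proof (elim disjE)
    assume "detectable_types (mirror ` S)"
    then show ?thesis using that avoiders_mirror by blast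
  next
    assume S: "S = {(True, True, True), (False, False, True)}"
    have "detectable_types {(True, True, True), (False, False, True), type_comp}"
      unfolding detectable_types_def odd_type_def by simp
    then show ?thesis using that S avoiders_bipartite_permutation by simp
  next
    assume S: "S = {(False, False, False), type_comp}"
    have "detectable_types {(False, False, False), type_comp, (False, False, True)}"
      unfolding detectable_types_def odd_type_def by simp
    then show ?thesis using that S avoiders_co_bipartite_permutation by simp
  qed
qed

section \<open>Program verification\<close>

text \<open>Total correctness with a time bound. \<open>T\<close> does not depend on the state, but
  loop bodies receive a bound for each counter value, so that the degrees of the vertices can be
  summed up.\<close>

definition hoare :: "nat \<Rightarrow> (state \<Rightarrow> bool) \<Rightarrow> com \<Rightarrow> nat \<Rightarrow> (state \<Rightarrow> bool) \<Rightarrow> bool" where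
  "hoare B P c T Q \<longleftrightarrow> (\<forall>s. P s \<longrightarrow> (\<exists>t s'. exec B c s t s' \<and> t \<le> T \<and> Q s'))"

lemma hoare_conseq:
  assumes "hoare B P c T Q" "\<And>s. P' s \<Longrightarrow> P s" "T \<le> T'" "\<And>s. Q s \<Longrightarrow> Q' s"
  shows "hoare B P' c T' Q'"
  using assms unfolding hoare_def by (meson le_trans)

lemma hoare_Seq:
  assumes "hoare B P c1 T1 R" "hoare B R c2 T2 Q"
  shows "hoare B P (Seq c1 c2) (T1 + T2) Q"
  unfolding hoare_def
proof (intro allI impI)
  fix s assume "P s"
  then obtain t1 s1 where 1: "exec B c1 s t1 s1" "t1 \<le> T1" "R s1"
    using assms(1) unfolding hoare_def by blast
  then obtain t2 s2 where 2: "exec B c2 s1 t2 s2" "t2 \<le> T2" "Q s2"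
    using assms(2) unfolding hoare_def by blast
  show "\<exists>t s'. exec B (Seq c1 c2) s t s' \<and> t \<le> T1 + T2 \<and> Q s'"
    using exec.Seq[OF 1(1) 2(1)] 1 2 by (intro exI[of _ "t1 + t2"] exI[of _ s2]) auto
qed

definition set_var :: "string \<Rightarrow> nat \<Rightarrow> state \<Rightarrow> state" where
  "set_var x v s = s\<lparr>scalar := (scalar s)(x := v)\<rparr>"

definition set_cell :: "string \<Rightarrow> nat \<Rightarrow> nat \<Rightarrow> state \<Rightarrow> state" where
  "set_cell a i v s = s\<lparr>array := (array s)(a := (array s a)(i := v))\<rparr>"

lemma set_simps [simp]:
  "scalar (set_var x v s) = (scalar s)(x := v)"
  "array (set_var x v s) = array s"
  "scalar (set_cell a i v s) = scalar s"
  "array (set_cell a i v s) = (array s)(a := (array s a)(i := v))"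
  by (simp_all add: set_var_def set_cell_def)

text \<open>Symbolic execution of loop-free code, which reduces its verification to rewriting. The
  value on \<open>While\<close> is a dummy that \<open>runs\<close> rules out.\<close>

fun run :: "com \<Rightarrow> state \<Rightarrow> state" where
  "run Skip s = s"
| "run (Assign x e) s = set_var x (eval e s) s"
| "run (Store a i e) s = set_cell a (eval i s) (eval e s) s"
| "run (Seq c1 c2) s = run c2 (run c1 s)"
| "run (Cond e c1 c2) s = (if eval e s \<noteq> 0 then run c1 s else run c2 s)"
| "run (While e c) s = s"

fun runs :: "nat \<Rightarrow> com \<Rightarrow> state \<Rightarrow> bool" where
  "runs B Skip s \<longleftrightarrow> True"
| "runs B (Assign x e) s \<longleftrightarrow> fits B e s"
| "runs B (Store a i e) s \<longleftrightarrow> fits B i s \<and> fits B e s"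
| "runs B (Seq c1 c2) s \<longleftrightarrow> runs B c1 s \<and> runs B c2 (run c1 s)"
| "runs B (Cond e c1 c2) s \<longleftrightarrow> fits B e s \<and> (if eval e s \<noteq> 0 then runs B c1 s else runs B c2 s)"
| "runs B (While e c) s \<longleftrightarrow> False"

fun steps :: "com \<Rightarrow> nat" where
  "steps Skip = 1"
| "steps (Assign x e) = cost e + 1"
| "steps (Store a i e) = cost i + cost e + 1"
| "steps (Seq c1 c2) = steps c1 + steps c2"
| "steps (Cond e c1 c2) = cost e + max (steps c1) (steps c2)"
| "steps (While e c) = 0"

lemma runs_exec: "runs B c s \<Longrightarrow> \<exists>t \<le> steps c. exec B c s t (run c s)"
proof (induction c arbitrary: s)
  case Skip
  then show ?case using exec.Skip by fastforce
next
  case (Assign x e)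
  then show ?case using exec.Assign[of B e s x] by (auto simp: set_var_def)
next
  case (Store a i e)
  then show ?case using exec.Store[of B i s e a] by (auto simp: set_cell_def)
next
  case (Seq c1 c2)
  then show ?case by (auto intro!: exec.Seq) (meson add_mono exec.Seq)
next
  case (Cond e c1 c2)
  show ?case
  proof (cases "eval e s \<noteq> 0")
    case True
    then obtain t where "t \<le> steps c1" "exec B c1 s t (run c1 s)" using Cond by auto
    then show ?thesis using True Cond.prems exec.CondTrue[of B e s c1 t]
      by (intro exI[of _ "cost e + t"]) auto
  next
    case False
    then obtain t where "t \<le> steps c2" "exec B c2 s t (run c2 s)" using Cond by auto
    then show ?thesis using False Cond.prems exec.CondFalse[of B e s c2 t]
      by (intro exI[of _ "cost e + t"]) auto
  qed
qed simp

lemma hoare_straight: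
  assumes "\<And>s. P s \<Longrightarrow> runs B c s \<and> Q (run c s)"
  shows "hoare B P c (steps c) Q"
  using assms runs_exec unfolding hoare_def by meson

section \<open>Counting loops\<close>

definition For :: "string \<Rightarrow> expr \<Rightarrow> expr \<Rightarrow> com \<Rightarrow> com" where
  "For x lo hi c = Seq (Assign x lo)
     (While (Op Lt (Var x) hi) (Seq c (Assign x (Op Add (Var x) (Const 1)))))"

text \<open>Each round pays \<open>cost hi + 2\<close> for the guard and 4 for the increment; the
  remaining terms pay for the initial assignment and the last, failing guard. Since \<open>b\<close>
  is at most \<open>B\<close>, the counter fits even after its last increment.\<close>

lemma hoare_For:
  assumes ab: "a \<le> b" "b \<le> B" "1 \<le> B"
    and lo: "\<And>s. P s \<Longrightarrow> fits B lo s \<and> eval lo s = a \<and> Inv a (set_var x a s)"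
    and hi: "\<And>s k. Inv k s \<Longrightarrow> scalar s x = k \<Longrightarrow> a \<le> k \<Longrightarrow> k \<le> b \<Longrightarrow> fits B hi s \<and> eval hi s = b"
    and body: "\<And>k. a \<le> k \<Longrightarrow> k < b \<Longrightarrow> hoare B (\<lambda>s. Inv k s \<and> scalar s x = k) c (T k)
      (\<lambda>s. scalar s x = k \<and> Inv (Suc k) (set_var x (Suc k) s))"
  shows "hoare B P (For x lo hi c) ((\<Sum>k = a..<b. T k + cost hi + 6) + cost lo + cost hi + 3)
    (\<lambda>s. Inv b s \<and> scalar s x = b)"
proof -
  let ?w = "While (Op Lt (Var x) hi) (Seq c (Assign x (Op Add (Var x) (Const 1))))"
  have loop: "\<exists>t s'. exec B ?w s t s' \<and> t \<le> (\<Sum>k = k..<b. T k + cost hi + 6) + cost hi + 2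
      \<and> Inv b s' \<and> scalar s' x = b"
    if "Inv k s" "scalar s x = k" "a \<le> k" "k \<le> b" for k s
    using that
  proof (induction "b - k" arbitrary: k s)
    case 0
    then have "k = b" by simp
    moreover have "exec B ?w s (cost (Op Lt (Var x) hi)) s"
      using hi[OF 0(2-5)] 0 ab \<open>k = b\<close> by (intro exec.WhileFalse) auto
    ultimately show ?case using 0 by (intro exI[of _ "cost (Op Lt (Var x) hi)"] exI[of _ s]) auto
  next
    case (Suc d)
    then have k: "a \<le> k" "k < b" by auto
    obtain t1 s1 where 1: "exec B c s t1 s1" "t1 \<le> T k" "scalar s1 x = k" "Inv (Suc k) (set_var x (Suc k) s1)"
      using body[OF k] Suc.prems unfolding hoare_def by blast
    have "exec B (Assign x (Op Add (Var x) (Const 1))) s1 4 (set_var x (Suc k) s1)"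
      using exec.Assign[of B "Op Add (Var x) (Const 1)" s1 x] 1(3) k ab by (simp add: set_var_def numeral_eq_Suc)
    then have 2: "exec B (Seq c (Assign x (Op Add (Var x) (Const 1)))) s (t1 + 4) (set_var x (Suc k) s1)"
      using 1(1) exec.Seq by blast
    have d: "d = b - Suc k" using Suc.hyps(2) by simp
    obtain t2 s2 where 3: "exec B ?w (set_var x (Suc k) s1) t2 s2"
        "t2 \<le> (\<Sum>k = Suc k..<b. T k + cost hi + 6) + cost hi + 2" "Inv b s2" "scalar s2 x = b"
      using Suc.hyps(1)[OF d 1(4)] k by auto
    have "exec B ?w s (cost (Op Lt (Var x) hi) + (t1 + 4) + t2) s2"
      using hi[OF Suc.prems] Suc.prems k ab by (intro exec.WhileTrue[OF _ _ 2 3(1)]) auto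
    moreover have "(\<Sum>k = k..<b. T k + cost hi + 6) = T k + cost hi + 6 + (\<Sum>k = Suc k..<b. T k + cost hi + 6)"
      using k by (simp add: sum.atLeast_Suc_lessThan)
    ultimately show ?case
      using 1(2) 3 by (intro exI[of _ "cost (Op Lt (Var x) hi) + (t1 + 4) + t2"] exI[of _ s2]) auto
  qed
  show ?thesis
    unfolding hoare_def For_def
  proof (intro allI impI)
    fix s assume "P s"
    note lo = lo[OF this]
    have 1: "exec B (Assign x lo) s (cost lo + 1) (set_var x a s)"
      using exec.Assign[of B lo s x] lo by (simp add: set_var_def)
    obtain t s' where 2: "exec B ?w (set_var x a s) t s'"
      "t \<le> (\<Sum>k = a..<b. T k + cost hi + 6) + cost hi + 2" "Inv b s'" "scalar s' x = b"
      using loop[of a "set_var x a s"] lo ab by auto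
    show "\<exists>t s'. exec B (Seq (Assign x lo) ?w) s t s' \<and>
        t \<le> (\<Sum>k = a..<b. T k + cost hi + 6) + cost lo + cost hi + 3 \<and> Inv b s' \<and> scalar s' x = b"
      using exec.Seq[OF 1 2(1)] 2 by (intro exI[of _ "cost lo + 1 + t"] exI[of _ s']) auto
  qed
qed

section \<open>The input graph in memory\<close>

lemma nth_concat_offset:
  assumes "v < length xss" "k < length (xss ! v)"
  shows "concat xss ! (length (concat (take v xss)) + k) = xss ! v ! k"
    and "length (concat (take v xss)) + k < length (concat xss)"
proof -
  have "concat xss = concat (take v xss) @ xss ! v @ concat (drop (Suc v) xss)"
    using id_take_nth_drop[OF assms(1)] by (metis concat.simps(2) concat_append)
  then show "concat xss ! (length (concat (take v xss)) + k) = xss ! v ! k"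
    "length (concat (take v xss)) + k < length (concat xss)"
    using assms(2) by (auto simp: nth_append)
qed

definition nbr_loop :: "com \<Rightarrow> com" where
  "nbr_loop c = For ''j'' (Read ''offset'' (Var ''v'')) (Read ''offset'' (Op Add (Var ''v'') (Const 1)))
     (Seq (Assign ''u'' (Read ''rank'' (Read ''target'' (Var ''j'')))) c)"

text \<open>A linear word bound suffices for the preprocessing: offsets grow up to
  \<open>2 * m\<close>, and loop counters and counts up to \<open>n + 1\<close>.\<close>

locale graph_input =
  fixes ord :: "nat list" and adj :: "nat list list" and G :: "nat ugraph" and \<tau> :: "nat rel" and B :: nat
  assumes ordered: "ordered_graph G \<tau>" and represents: "represents ord adj G \<tau>"
    and word: "2 * (card (verts G) + card (edges G) + 2) \<le> B"
begin

definition n :: nat where "n = length adj"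
definition m :: nat where "m = card (edges G)"

lemma verts_G: "verts G = {..<n}" and card_verts: "card (verts G) = n"
  using represents by (auto simp: represents_def n_def)

lemma simple: "simple_graph G"
  using ordered by (simp add: ordered_graph_def)

lemma B_bounds: "2 * (n + m + 2) \<le> B"
  using word by (simp add: card_verts m_def)

lemma ord_props: "distinct ord" "set ord = {..<n}" "length ord = n"
  using represents distinct_card[of ord] verts_G by (auto simp: represents_def)

lemma ord_less: "i < n \<Longrightarrow> ord ! i < n"
  using ord_props nth_mem by fastforce

lemma ord_bij: "bij_betw (\<lambda>r. ord ! (r - 1)) {1..n} {..<n}"
proof -
  have "bij_betw ((!) ord) {..<n} {..<n}" 
    by (rule bij_betw_nth) (simp_all add: ord_props)
  moreover have "bij_betw (\<lambda>r. r - 1) {1..n} {..<n}"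
    by (rule bij_betw_byWitness[where f' = Suc]) auto
  ultimately show ?thesis using bij_betw_trans by (fastforce simp: o_def)
qed

definition rank :: "nat \<Rightarrow> nat" where
  "rank = the_inv_into {1..n} (\<lambda>r. ord ! (r - 1))"

lemma rank_ord: "r \<in> {1..n} \<Longrightarrow> rank (ord ! (r - 1)) = r"
  unfolding rank_def using ord_bij by (intro the_inv_into_f_f) (auto simp: bij_betw_def)

lemma ord_rank: "u < n \<Longrightarrow> ord ! (rank u - 1) = u"
  unfolding rank_def using ord_bij f_the_inv_into_f_bij_betw[OF ord_bij] by auto

lemma rank_range: "u < n \<Longrightarrow> rank u \<in> {1..n}"
  unfolding rank_def using bij_betw_the_inv_into[OF ord_bij] by (auto dest: bij_betwE)

definition E :: "nat \<Rightarrow> nat \<Rightarrow> bool" where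
  "E r s \<longleftrightarrow> r \<in> {1..n} \<and> s \<in> {1..n} \<and> {ord ! (r - 1), ord ! (s - 1)} \<in> edges G"

sublocale ranked_graph n E
proof
  show "E j i" if "E i j" for i j using that by (auto simp: E_def insert_commute)
  show "\<not> E i i" for i using simple_graphD(2)[OF simple, of "ord ! (i - 1)" "ord ! (i - 1)"] by (auto simp: E_def)
  show "E i j \<Longrightarrow> i \<in> {1..n}" for i j by (simp add: E_def)
qed

text \<open>\<open>ord\<close> lists the vertices increasingly for \<tau>, and by antisymmetry the
  positions determine \<tau> on distinct vertices.\<close>

lemma has_type_iff_occurs: "has_type t \<longleftrightarrow> occurs G \<tau> t"
proof
  have mono: "(ord ! (a - 1), ord ! (b - 1)) \<in> \<tau>" if "a \<in> {1..n}" "b \<in> {1..n}" "a < b" for a b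
    using represents that ord_props(3) by (auto simp: represents_def)
  have lin: "linear_order_on (verts G) \<tau>" using ordered by (simp add: ordered_graph_def)
  {
    assume "has_type t"
    then obtain a b c where abc: "a \<in> {1..n}" "b \<in> {1..n}" "c \<in> {1..n}" "a < b" "b < c"
      and t: "(E a b, E b c, E a c) = t"
      unfolding has_type_def by auto
    let ?o = "\<lambda>r. ord ! (r - 1)"
    have "?o a \<noteq> ?o b" "?o b \<noteq> ?o c"
      using rank_ord abc by (metis less_irrefl)+
    moreover have "{?o a, ?o b, ?o c} \<subseteq> verts G"
      using abc ord_less verts_G by auto
    moreover have "triple_type G (?o a) (?o b) (?o c) = t"
      using t abc by (auto simp: triple_type_def E_def)
    ultimately show "occurs G \<tau> t"
      unfolding occurs_def using mono[of a b] mono[of b c] abc by blast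
  next
    assume "occurs G \<tau> t"
    then obtain u v w where uvw: "{u, v, w} \<subseteq> verts G" "u \<noteq> v" "v \<noteq> w" "(u, v) \<in> \<tau>" "(v, w) \<in> \<tau>"
      and t: "triple_type G u v w = t" unfolding occurs_def by blast
    have V: "u < n" "v < n" "w < n" using uvw(1) verts_G by auto
    have less: "rank x < rank y" if "x < n" "y < n" "x \<noteq> y" "(x, y) \<in> \<tau>" for x y
    proof (rule ccontr)
      assume "\<not> rank x < rank y"
      then have "rank y < rank x" using that ord_rank by (metis linorder_neqE_nat)
      then have "(y, x) \<in> \<tau>" using mono[OF rank_range rank_range] that ord_rank by metis
      then show False using linear_orderD(3)[OF lin] that by blast
    qed
    have "(E (rank u) (rank v), E (rank v) (rank w), E (rank u) (rank w)) = t"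
      using t V rank_range ord_rank by (auto simp: triple_type_def E_def)
    then show "has_type t"
      unfolding has_type_def using rank_range V less uvw by blast
  }
qed

definition nbrs :: "nat \<Rightarrow> nat list" where
  "nbrs r = map rank (adj ! (ord ! (r - 1)))"

lemma adj_props:
  assumes "v < n"
  shows "distinct (adj ! v)" "set (adj ! v) = {u. {u, v} \<in> edges G}" "set (adj ! v) \<subseteq> {..<n}"
  using represents assms simple_graphD(2)[OF simple] unfolding represents_def n_def[symmetric] verts_G
  by auto

lemma nbrs_props:
  assumes "r \<in> {1..n}"
  shows "distinct (nbrs r)" "set (nbrs r) = {j. E j r}"
proof -
  have v: "ord ! (r - 1) < n" using assms ord_less by auto
  note adj = adj_props[OF v]
  have "inj_on rank {..<n}" by (rule inj_on_inverseI[of _ "\<lambda>r. ord ! (r - 1)"]) (use ord_rank in auto)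
  then show "distinct (nbrs r)"
    unfolding nbrs_def using adj inj_on_subset by (simp add: distinct_map) blast
  show "set (nbrs r) = {j. E j r}"
  proof (intro set_eqI iffI)
    fix j assume "j \<in> set (nbrs r)"
    then obtain u where "j = rank u" "u < n" "{u, ord ! (r - 1)} \<in> edges G"
      using adj unfolding nbrs_def by auto
    then show "j \<in> {j. E j r}" using assms rank_range[of u] ord_rank[of u] by (auto simp: E_def)
  next
    fix j assume "j \<in> {j. E j r}"
    then have "ord ! (j - 1) \<in> set (adj ! (ord ! (r - 1)))" "j = rank (ord ! (j - 1))"
      using adj(2) rank_ord by (auto simp: E_def)
    then show "j \<in> set (nbrs r)" unfolding nbrs_def by (metis image_eqI set_map)
  qed
qed

text \<open>The handshake bound: an entry \<open>u\<close> in the list of \<open>v\<close> is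
  recovered from the edge and one bit telling which of its ends is \<open>v\<close>.\<close>

lemma sum_lengths: "(\<Sum>v<n. length (adj ! v)) \<le> 2 * m"
proof -
  have fin: "finite (edges G)"
    using simple finite_subset[of "edges G" "Pow (verts G)"] unfolding simple_graph_def pairs_def by auto
  have "(\<Sum>v<n. length (adj ! v)) = (\<Sum>v<n. card {u. {u, v} \<in> edges G})"
    by (intro sum.cong refl) (simp add: adj_props(1) adj_props(2)[symmetric] distinct_card)
  also have "\<dots> = card (SIGMA v:{..<n}. {u. {u, v} \<in> edges G})"
    using adj_props(2,3) by (intro card_SigmaI[symmetric]) (auto intro: finite_subset)
  also have "\<dots> \<le> card (edges G \<times> (UNIV :: bool set))"
  proof (rule card_inj_on_le)
    show "inj_on (\<lambda>(v, u). ({u, v}, v < u)) (SIGMA v:{..<n}. {u. {u, v} \<in> edges G})"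
      by (auto simp: inj_on_def doubleton_eq_iff)
    show "(\<lambda>(v, u). ({u, v}, v < u)) ` (SIGMA v:{..<n}. {u. {u, v} \<in> edges G}) \<subseteq> edges G \<times> UNIV" by auto
  qed (use fin in simp)
  finally show ?thesis by (simp add: m_def card_cartesian_product)
qed

lemma sum_nbrs: "(\<Sum>r = 1..n. length (nbrs r)) \<le> 2 * m"
proof -
  have "(\<Sum>r = 1..n. length (nbrs r)) = (\<Sum>v<n. length (adj ! v))"
    using sum.reindex_bij_betw[OF ord_bij, of "\<lambda>v. length (adj ! v)"] by (simp add: nbrs_def)
  then show ?thesis using sum_lengths by simp
qed

definition offset :: "nat \<Rightarrow> nat" where
  "offset v = length (concat (take v adj))"

lemma offset_Suc: "v < n \<Longrightarrow> offset (Suc v) = offset v + length (adj ! v)"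
  by (simp add: offset_def n_def take_Suc_conv_app_nth)

lemma offset_le: "v \<le> n \<Longrightarrow> offset v \<le> 2 * m"
proof -
  have "v \<le> n \<Longrightarrow> offset v = (\<Sum>w<v. length (adj ! w))" for v
    by (induction v) (auto simp: offset_Suc offset_def[of 0])
  moreover have "v \<le> n \<Longrightarrow> (\<Sum>w<v. length (adj ! w)) \<le> (\<Sum>w<n. length (adj ! w))"
    by (intro sum_mono2) auto
  ultimately show "v \<le> n \<Longrightarrow> offset v \<le> 2 * m" using sum_lengths by force
qed

definition loaded :: "state \<Rightarrow> bool" where
  "loaded s \<longleftrightarrow> scalar s ''n'' = n \<and> scalar s ''result'' = 0 \<and> (\<forall>i<n. array s ''order'' i = ord ! i) \<and>
     (\<forall>v\<le>n. array s ''offset'' v = offset v) \<and>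
     (\<forall>v<n. \<forall>k<length (adj ! v). array s ''target'' (offset v + k) = adj ! v ! k)"

definition ranked :: "state \<Rightarrow> bool" where
  "ranked s \<longleftrightarrow> loaded s \<and> (\<forall>v<n. array s ''rank'' v = rank v)"

definition at_vertex :: "nat \<Rightarrow> state \<Rightarrow> bool" where
  "at_vertex r s \<longleftrightarrow> ranked s \<and> scalar s ''i'' = r \<and> scalar s ''v'' = ord ! (r - 1)"

lemma loaded_input_state: "loaded (input_state ord adj)"
proof -
  have "array (input_state ord adj) ''target'' (offset v + k) = adj ! v ! k" if "v < n" "k < length (adj ! v)" for v k
    using nth_concat_offset[of v adj k] that by (simp add: input_state_def array_of_def offset_def n_def)
  moreover have "array (input_state ord adj) ''offset'' v = offset v" if "v \<le> n" for v
    using that nth_map[of v "[0..<length adj + 1]" "\<lambda>v. length (concat (take v adj))"]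
    by (simp add: input_state_def array_of_def offset_def n_def del: upt_Suc)
  moreover have "array (input_state ord adj) ''order'' i = ord ! i" if "i < n" for i
    using that ord_props by (simp add: input_state_def array_of_def)
  ultimately show ?thesis by (simp add: loaded_def input_state_def n_def)
qed

lemma loaded_set_var [simp]: "x \<noteq> ''n'' \<Longrightarrow> x \<noteq> ''result'' \<Longrightarrow> loaded (set_var x v s) = loaded s"
  by (simp add: loaded_def eq_commute[of _ x])

lemma loaded_set_cell [simp]:
  "a \<notin> {''order'', ''offset'', ''target''} \<Longrightarrow> loaded (set_cell a i v s) = loaded s"
  by (simp add: loaded_def eq_commute[of _ a])

lemma ranked_set_var [simp]: "x \<noteq> ''n'' \<Longrightarrow> x \<noteq> ''result'' \<Longrightarrow> ranked (set_var x v s) = ranked s"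
  by (simp add: ranked_def)

lemma ranked_set_cell [simp]:
  "a \<notin> {''order'', ''offset'', ''target'', ''rank''} \<Longrightarrow> ranked (set_cell a i v s) = ranked s"
  by (simp add: ranked_def eq_commute[of _ a])

lemma at_vertex_set_var [simp]:
  "x \<notin> {''n'', ''result'', ''i'', ''v''} \<Longrightarrow> at_vertex r (set_var x v s) = at_vertex r s"
  by (simp add: at_vertex_def eq_commute[of _ x])

lemma at_vertex_set_cell [simp]:
  "a \<notin> {''order'', ''offset'', ''target'', ''rank''} \<Longrightarrow> at_vertex r (set_cell a i v s) = at_vertex r s"
  by (simp add: at_vertex_def)

text \<open>\<open>Inv k\<close> speaks of the first \<open>k\<close> neighbours. Per neighbour, 4
  units translate it into its rank and 10 run the loop; the 9 pay for entry and exit.\<close>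

lemma hoare_nbr_loop:
  assumes r: "r \<in> {1..n}"
    and pre: "\<And>s. P s \<Longrightarrow> at_vertex r s \<and> Inv 0 s"
    and stable: "\<And>k s y. Inv k (set_var ''j'' y s) = Inv k s" "\<And>k s y. Inv k (set_var ''u'' y s) = Inv k s"
    and body: "\<And>k s. k < length (nbrs r) \<Longrightarrow> at_vertex r s \<Longrightarrow> Inv k s \<Longrightarrow> scalar s ''u'' = nbrs r ! k \<Longrightarrow>
      runs B c s \<and> at_vertex r (run c s) \<and> Inv (Suc k) (run c s) \<and> scalar (run c s) ''j'' = scalar s ''j''"
  shows "hoare B P (nbr_loop c) ((steps c + 14) * length (nbrs r) + 9)
    (\<lambda>s. at_vertex r s \<and> Inv (length (nbrs r)) s)"
proof -
  define v where "v = ord ! (r - 1)"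
  have v: "v < n" using r ord_less unfolding v_def by auto
  have len: "length (nbrs r) = length (adj ! v)" by (simp add: nbrs_def v_def)
  have off: "offset (Suc v) = offset v + length (nbrs r)" using offset_Suc[OF v] len by simp
  have "offset (Suc v) \<le> 2 * m" "offset v \<le> 2 * m" using offset_le v by auto
  then have le: "offset v + length (nbrs r) \<le> B" "offset v \<le> B" "n + 1 \<le> B" using B_bounds off by auto
  \<comment> \<open>The counter ranges over cells of \<open>target\<close>, so the number of
    neighbours treated is its distance from the offset.\<close>
  define J where "J k s \<longleftrightarrow> at_vertex r s \<and> Inv (k - offset v) s" for k s
  have nbr: "nbrs r ! k = rank (adj ! v ! k) \<and> adj ! v ! k < n" if "k < length (nbrs r)" for k
  proof -
    have k: "k < length (adj ! v)" using that len by simp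
    then have "adj ! v ! k < n" using adj_props(3)[OF v] nth_mem by blast
    moreover have "nbrs r = map rank (adj ! v)" by (simp add: nbrs_def v_def)
    ultimately show ?thesis using k by simp
  qed
  have at: "scalar s ''v'' = v" "array s ''offset'' v = offset v" "array s ''offset'' (Suc v) = offset (Suc v)"
    if "at_vertex r s" for s
    using that v unfolding at_vertex_def ranked_def loaded_def v_def[symmetric] by auto
  have cell: "array s ''target'' (offset v + k) = adj ! v ! k \<and> array s ''rank'' (adj ! v ! k) = nbrs r ! k"
    if "at_vertex r s" "k < length (nbrs r)" for s k
    using that v nbr[OF that(2)] unfolding at_vertex_def ranked_def loaded_def len by simp
  have "hoare B P (nbr_loop c)
     ((\<Sum>k = offset v..<offset v + length (nbrs r). (steps c + 4) + cost (Read ''offset'' (Op Add (Var ''v'') (Const 1))) + 6)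
       + cost (Read ''offset'' (Var ''v'')) + cost (Read ''offset'' (Op Add (Var ''v'') (Const 1))) + 3)
     (\<lambda>s. J (offset v + length (nbrs r)) s \<and> scalar s ''j'' = offset v + length (nbrs r))"
    unfolding nbr_loop_def
  proof (rule hoare_For)
    show "fits B (Read ''offset'' (Var ''v'')) s \<and> eval (Read ''offset'' (Var ''v'')) s = offset v \<and>
      J (offset v) (set_var ''j'' (offset v) s)" if "P s" for s
      using pre[OF that] at[of s] le v by (simp add: J_def stable)
    show "fits B (Read ''offset'' (Op Add (Var ''v'') (Const 1))) s \<and>
        eval (Read ''offset'' (Op Add (Var ''v'') (Const 1))) s = offset v + length (nbrs r)"
      if "J k s" for s k
      using that at[of s] le v off by (simp add: J_def)
    show "hoare B (\<lambda>s. J k s \<and> scalar s ''j'' = k) (Seq (Assign ''u'' (Read ''rank'' (Read ''target'' (Var ''j'')))) c)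
          (steps c + 4) (\<lambda>s. scalar s ''j'' = k \<and> J (Suc k) (set_var ''j'' (Suc k) s))"
      if k: "offset v \<le> k" "k < offset v + length (nbrs r)" for k
    proof (rule hoare_conseq[OF hoare_straight])
      fix s assume s: "J k s \<and> scalar s ''j'' = k"
      define d where "d = k - offset v"
      have d: "k = offset v + d" "d < length (nbrs r)" using k by (auto simp: d_def)
      have av: "at_vertex r s" using s by (simp add: J_def)
      note at' = at[OF av] cell[OF av d(2)]
      have "nbrs r ! d \<in> {1..n}" "adj ! v ! d < n"
        using nbr[OF d(2)] rank_range by auto
      then have fit: "nbrs r ! d \<le> B" "adj ! v ! d \<le> B" using le by auto
      define s' where "s' = set_var ''u'' (nbrs r ! d) s"
      have run1: "run (Assign ''u'' (Read ''rank'' (Read ''target'' (Var ''j'')))) s = s'"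
        using s at' by (simp add: s'_def d(1))
      have "runs B c s' \<and> at_vertex r (run c s') \<and> Inv (Suc d) (run c s') \<and> scalar (run c s') ''j'' = scalar s' ''j''"
        by (rule body[OF d(2)]) (use s in \<open>auto simp: s'_def J_def stable d(1)\<close>)
      then show "runs B (Seq (Assign ''u'' (Read ''rank'' (Read ''target'' (Var ''j'')))) c) s \<and>
         (scalar (run (Seq (Assign ''u'' (Read ''rank'' (Read ''target'' (Var ''j'')))) c) s) ''j'' = k \<and>
          J (Suc k) (set_var ''j'' (Suc k) (run (Seq (Assign ''u'' (Read ''rank'' (Read ''target'' (Var ''j'')))) c) s)))"
        using s at' fit run1 le d by (simp add: s'_def J_def stable Suc_diff_le)
    qed auto
  qed (use le in auto)
  then show ?thesis
    by (rule hoare_conseq) (auto simp: J_def algebra_simps)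
qed

end

section \<open>The preprocessing programs and their correctness\<close>

definition vertex_loop :: "com \<Rightarrow> com" where
  "vertex_loop c = For ''i'' (Const 1) (Op Add (Var ''n'') (Const 1)) c"

definition load_vertex :: com where
  "load_vertex = Assign ''v'' (Read ''order'' (Op Sub (Var ''i'') (Const 1)))"

text \<open>Vertices are replaced by their ranks \<open>1, \<dots>, n\<close>, so that 0 can stand for a missing vertex.\<close>

definition rank_prog :: com where
  "rank_prog = vertex_loop (Store ''rank'' (Read ''order'' (Op Sub (Var ''i'') (Const 1))) (Var ''i''))"

text \<open>Marks carry the rank \<open>i\<close> instead of a flag, so they expire by themselves
  when the next vertex is reached and need no clearing. A product serves as conjunction.\<close>

definition scan_nbrs :: com where
  "scan_nbrs = Seq (Store ''mark'' (Var ''u'') (Var ''i''))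
     (Seq (Store ''left'' (Var ''i'') (Op Add (Read ''left'' (Var ''i'')) (Op Lt (Var ''u'') (Var ''i''))))
     (Seq (Store ''right'' (Var ''i'') (Op Add (Read ''right'' (Var ''i'')) (Op Lt (Var ''i'') (Var ''u''))))
     (Cond (Op Mul (Op Lt (Read ''nbr'' (Var ''i'')) (Var ''u'')) (Op Lt (Var ''u'') (Var ''i'')))
        (Store ''nbr'' (Var ''i'') (Var ''u'')) Skip)))"

text \<open>Repeating this once per neighbour moves \<open>q\<close> from the predecessor of \<open>i\<close> down to the last
  non-neighbour before \<open>i\<close>, within the time that the degree of \<open>i\<close> allows.\<close>

definition descend :: com where
  "descend = Cond (Op Eq (Read ''mark'' (Var ''q'')) (Var ''i'')) (Assign ''q'' (Op Sub (Var ''q'') (Const 1))) Skip"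

definition profile_prog :: com where
  "profile_prog = vertex_loop (Seq load_vertex (Seq (nbr_loop scan_nbrs)
     (Seq (Assign ''q'' (Op Sub (Var ''i'') (Const 1))) (Seq (nbr_loop descend)
       (Store ''gap'' (Var ''i'') (Var ''q''))))))"

text \<open>The common neighbours are counted from the side of the common neighbour
  \<open>i\<close>: for each neighbour \<open>u\<close> of \<open>i\<close>, the stamp of its
  partner in \<open>p\<close> tells whether \<open>i\<close> is adjacent to that partner too.
  Intersecting the lists of \<open>u\<close> and its partner for each \<open>u\<close> would not
  stay within the sum of the degrees.\<close>

definition count_common :: "string \<Rightarrow> string \<Rightarrow> com" where
  "count_common c p = Store c (Var ''u'') (Op Add (Read c (Var ''u''))
     (Op Mul (Op Eq (Read ''stamp'' (Read p (Var ''u''))) (Var ''i'')) (Op Lt (Var ''i'') (Read p (Var ''u'')))))"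

definition common_prog :: com where
  "common_prog = vertex_loop (Seq load_vertex (Seq (nbr_loop (Store ''stamp'' (Var ''u'') (Var ''i'')))
     (nbr_loop (Seq (count_common ''common_nbr'' ''nbr'') (count_common ''common_gap'' ''gap'')))))"

definition blank :: "string set \<Rightarrow> state \<Rightarrow> bool" where
  "blank A s \<longleftrightarrow> (\<forall>a \<in> A. \<forall>i. array s a i = 0)"

lemma blank_simps [simp]:
  "blank A (set_var x v s) = blank A s"
  "a \<notin> A \<Longrightarrow> blank A (set_cell a i v s) = blank A s"
  by (auto simp: blank_def)

context graph_input
begin

lemma vertex_bounds:
  assumes "r \<in> {1..n}"
  shows "r \<le> B" "ord ! (r - 1) \<le> B" "1 \<le> B"
proof -
  have "r - 1 < n" using assms by auto
  from ord_less[OF this] show "ord ! (r - 1) \<le> B" using B_bounds by simp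
  show "r \<le> B" "1 \<le> B" using assms B_bounds by auto
qed

text \<open>The constants are those of \<open>hoare_For\<close> for the bounds \<open>1\<close> and
  \<open>n + 1\<close>.\<close>

lemma hoare_vertex_loop:
  assumes pre: "\<And>s. P s \<Longrightarrow> Inv 1 s" and n: "\<And>k s. Inv k s \<Longrightarrow> scalar s ''n'' = n"
    and stable: "\<And>k s y. Inv k (set_var ''i'' y s) = Inv k s"
    and body: "\<And>r. r \<in> {1..n} \<Longrightarrow> hoare B (\<lambda>s. Inv r s \<and> scalar s ''i'' = r) c (T r)
      (\<lambda>s. scalar s ''i'' = r \<and> Inv (Suc r) s)"
  shows "hoare B P (vertex_loop c) ((\<Sum>r = 1..n. T r) + 9 * n + 7) (Inv (Suc n))"
proof -
  have "hoare B P (vertex_loop c)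
    ((\<Sum>k = 1..<Suc n. T k + cost (Op Add (Var ''n'') (Const 1)) + 6) + cost (Const 1) + cost (Op Add (Var ''n'') (Const 1)) + 3)
    (\<lambda>s. Inv (Suc n) s \<and> scalar s ''i'' = Suc n)"
    unfolding vertex_loop_def
  proof (rule hoare_For)
    show "fits B (Op Add (Var ''n'') (Const 1)) s \<and> eval (Op Add (Var ''n'') (Const 1)) s = Suc n" if "Inv k s" for s k
      using n[OF that] B_bounds by simp
    show "hoare B (\<lambda>s. Inv k s \<and> scalar s ''i'' = k) c (T k)
        (\<lambda>s. scalar s ''i'' = k \<and> Inv (Suc k) (set_var ''i'' (Suc k) s))" if "1 \<le> k" "k < Suc n" for k
      using body[of k] that by (simp add: stable)
  qed (use B_bounds pre in \<open>auto simp: stable\<close>)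
  then show ?thesis
    by (rule hoare_conseq) (auto simp: sum.distrib atLeastLessThanSuc_atLeastAtMost)
qed

abbreviation (input) "work_arrays \<equiv> {''left'', ''right'', ''nbr'', ''mark'', ''stamp'', ''common_nbr'', ''common_gap''}"

lemma hoare_rank_prog:
  "hoare B (\<lambda>s. loaded s \<and> blank work_arrays s) rank_prog (20 * (n + m + 1))
    (\<lambda>s. ranked s \<and> blank work_arrays s)"
proof -
  let ?Inv = "\<lambda>k s. loaded s \<and> blank work_arrays s \<and> (\<forall>r \<in> {1..<k}. array s ''rank'' (ord ! (r - 1)) = r)"
  have "hoare B (\<lambda>s. loaded s \<and> blank work_arrays s) rank_prog ((\<Sum>r = 1..n. 6) + 9 * n + 7) (?Inv (Suc n))"
    unfolding rank_prog_def
  proof (rule hoare_vertex_loop)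
    fix r assume r: "r \<in> {1..n}"
    have eq: "ord ! (r' - 1) = ord ! (r - 1) \<longleftrightarrow> r' = r" if "r' \<in> {1..n}" for r'
      using rank_ord[OF r] rank_ord[OF that] by metis
    note le = vertex_bounds[OF r]
    show "hoare B (\<lambda>s. ?Inv r s \<and> scalar s ''i'' = r) (Store ''rank'' (Read ''order'' (Op Sub (Var ''i'') (Const 1))) (Var ''i'')) 6
       (\<lambda>s. scalar s ''i'' = r \<and> ?Inv (Suc r) s)"
    proof (rule hoare_conseq[OF hoare_straight])
      fix s assume s: "?Inv r s \<and> scalar s ''i'' = r"
      then have "array s ''order'' (r - Suc 0) = ord ! (r - 1)" using r by (auto simp: loaded_def)
      then show "runs B (Store ''rank'' (Read ''order'' (Op Sub (Var ''i'') (Const 1))) (Var ''i'')) s \<and>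
          scalar (run (Store ''rank'' (Read ''order'' (Op Sub (Var ''i'') (Const 1))) (Var ''i'')) s) ''i'' = r \<and>
          ?Inv (Suc r) (run (Store ''rank'' (Read ''order'' (Op Sub (Var ''i'') (Const 1))) (Var ''i'')) s)"
        using s le r eq by (auto simp: less_Suc_eq)
    qed auto
  qed (auto simp: loaded_def)
  then show ?thesis
  proof (rule hoare_conseq)
    fix s assume s: "?Inv (Suc n) s"
    have "array s ''rank'' v = rank v" if "v < n" for v
      using s rank_range[OF that] ord_rank[OF that] by (metis atLeastAtMost_iff atLeastLessThan_iff le_imp_less_Suc)
    then show "ranked s \<and> blank work_arrays s" using s by (simp add: ranked_def)
  qed (auto simp: algebra_simps)
qed

lemma nbrs_step:
  assumes "r \<in> {1..n}" "k < length (nbrs r)"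
  shows "set (take (Suc k) (nbrs r)) = insert (nbrs r ! k) (set (take k (nbrs r)))"
    "nbrs r ! k \<notin> set (take k (nbrs r))" "nbrs r ! k \<in> {1..n}" "nbrs r ! k \<noteq> r" "E (nbrs r ! k) r"
    "set (take k (nbrs r)) \<subseteq> {1..n}"
proof -
  show "set (take (Suc k) (nbrs r)) = insert (nbrs r ! k) (set (take k (nbrs r)))"
    using assms(2) by (simp add: take_Suc_conv_app_nth)
  show "nbrs r ! k \<notin> set (take k (nbrs r))"
    using assms nbrs_props(1) by (auto simp: in_set_conv_nth nth_eq_iff_index_eq)
  show E: "E (nbrs r ! k) r" using nbrs_props(2)[OF assms(1)] nth_mem[OF assms(2)] by auto
  show "nbrs r ! k \<in> {1..n}" using range[OF E] .
  show "nbrs r ! k \<noteq> r" using E irrefl by metis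
  show "set (take k (nbrs r)) \<subseteq> {1..n}" using nbrs_props(2)[OF assms(1)] set_take_subset range by fastforce
qed

lemma nbrs_length: "r \<in> {1..n} \<Longrightarrow> card {j. E j r} = length (nbrs r)"
  using nbrs_props distinct_card by metis

definition profiled :: "nat \<Rightarrow> state \<Rightarrow> bool" where
  "profiled k s \<longleftrightarrow> ranked s \<and> array s ''left'' 0 = 0 \<and> (\<forall>r \<in> {1..<k}.
     array s ''left'' r = left_degree r \<and> array s ''right'' r = right_degree r \<and>
     array s ''nbr'' r = last_nbr r \<and> array s ''gap'' r = last_gap r)"

text \<open>The counters of a vertex are accumulated from zero, so its cells must be blank when the
  outer loop arrives there.\<close>

definition untouched :: "nat \<Rightarrow> state \<Rightarrow> bool" where
  "untouched k s \<longleftrightarrow> blank {''stamp'', ''common_nbr'', ''common_gap''} s \<and>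
     (\<forall>r \<ge> k. array s ''left'' r = 0 \<and> array s ''right'' r = 0 \<and> array s ''nbr'' r = 0)"

lemma profiled_simps [simp]:
  "x \<noteq> ''n'' \<Longrightarrow> x \<noteq> ''result'' \<Longrightarrow> profiled k (set_var x v s) = profiled k s"
  "a \<notin> {''order'', ''offset'', ''target'', ''rank'', ''left'', ''right'', ''nbr'', ''gap''} \<Longrightarrow>
    profiled k (set_cell a i v s) = profiled k s"
  "a \<in> {''left'', ''right'', ''nbr'', ''gap''} \<Longrightarrow> 1 \<le> r \<Longrightarrow> profiled r (set_cell a r v s) = profiled r s"
  by (auto simp: profiled_def eq_commute[of _ a])

lemma untouched_simps [simp]:
  "untouched k (set_var x v s) = untouched k s"
  "a \<notin> {''stamp'', ''common_nbr'', ''common_gap'', ''left'', ''right'', ''nbr''} \<Longrightarrow> untouched k (set_cell a i v s) = untouched k s"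
  "a \<in> {''left'', ''right'', ''nbr''} \<Longrightarrow> untouched (Suc r) (set_cell a r v s) = untouched (Suc r) s"
  by (auto simp: untouched_def eq_commute[of _ a])

lemma hoare_load_vertex:
  assumes "r \<in> {1..n}" "\<And>s v. Inv (set_var ''v'' v s) = Inv s" "\<And>s. Inv s \<Longrightarrow> ranked s"
  shows "hoare B (\<lambda>s. Inv s \<and> scalar s ''i'' = r) load_vertex 5 (\<lambda>s. at_vertex r s \<and> Inv s)"
proof (rule hoare_conseq[OF hoare_straight])
  fix s assume s: "Inv s \<and> scalar s ''i'' = r"
  have "array s ''order'' (r - Suc 0) = ord ! (r - 1)"
    using s assms(1) assms(3)[of s] by (auto simp: ranked_def loaded_def)
  then show "runs B load_vertex s \<and> (at_vertex r (run load_vertex s) \<and> Inv (run load_vertex s))"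
    using s assms(2,3) vertex_bounds[OF assms(1)] by (simp add: load_vertex_def at_vertex_def)
qed (auto simp: load_vertex_def)

text \<open>The adjacency lists are unsorted, so degrees and last neighbour are maintained over the
  prefix seen so far. All old marks are below \<open>r\<close>; afterwards a mark equal to
  \<open>r\<close> decides adjacency to \<open>r\<close> in constant time.\<close>

lemma hoare_scan_nbrs:
  assumes r: "r \<in> {1..n}"
  shows "hoare B (\<lambda>s. at_vertex r s \<and> profiled r s \<and> untouched r s \<and> (\<forall>x. array s ''mark'' x < r))
    (nbr_loop scan_nbrs) (50 * length (nbrs r) + 9)
    (\<lambda>s. at_vertex r s \<and> profiled r s \<and> untouched (Suc r) s \<and> array s ''left'' r = left_degree r \<and>
      array s ''right'' r = right_degree r \<and> array s ''nbr'' r = last_nbr r \<and>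
      (\<forall>x. array s ''mark'' x \<le> r) \<and> (\<forall>x. array s ''mark'' x = r \<longleftrightarrow> E x r))"
proof -
  let ?A = "\<lambda>k. set (take k (nbrs r))"
  let ?Inv = "\<lambda>k s. profiled r s \<and> untouched (Suc r) s \<and> array s ''left'' r = card {x \<in> ?A k. x < r} \<and>
      array s ''right'' r = card {x \<in> ?A k. r < x} \<and> array s ''nbr'' r = Max (insert 0 {x \<in> ?A k. x < r}) \<and>
      (\<forall>x. array s ''mark'' x \<le> r) \<and> (\<forall>x. array s ''mark'' x = r \<longleftrightarrow> x \<in> ?A k)"
  have "hoare B (\<lambda>s. at_vertex r s \<and> profiled r s \<and> untouched r s \<and> (\<forall>x. array s ''mark'' x < r))
    (nbr_loop scan_nbrs) ((steps scan_nbrs + 14) * length (nbrs r) + 9) (\<lambda>s. at_vertex r s \<and> ?Inv (length (nbrs r)) s)"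
  proof (rule hoare_nbr_loop[OF r])
    show "at_vertex r s \<and> ?Inv 0 s"
      if "at_vertex r s \<and> profiled r s \<and> untouched r s \<and> (\<forall>x. array s ''mark'' x < r)" for s
      using that by (auto simp: untouched_def less_imp_le dest: less_imp_neq)
  next
    fix k s assume k: "k < length (nbrs r)" and at: "at_vertex r s" and inv: "?Inv k s" and su: "scalar s ''u'' = nbrs r ! k"
    define u where "u = nbrs r ! k"
    note step = nbrs_step[OF r k, folded u_def]
    have i: "scalar s ''i'' = r" using at by (simp add: at_vertex_def)
    have left: "card {x \<in> ?A (Suc k). x < r} = card {x \<in> ?A k. x < r} + of_bool (u < r)"
    proof (cases "u < r")
      case True
      then have "{x \<in> ?A (Suc k). x < r} = insert u {x \<in> ?A k. x < r}" using step(1) by auto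
      then show ?thesis using step(2) True by simp
    next
      case False
      then have "{x \<in> ?A (Suc k). x < r} = {x \<in> ?A k. x < r}" using step(1) by auto
      then show ?thesis using False by simp
    qed
    have right: "card {x \<in> ?A (Suc k). r < x} = card {x \<in> ?A k. r < x} + of_bool (r < u)"
    proof (cases "r < u")
      case True
      then have "{x \<in> ?A (Suc k). r < x} = insert u {x \<in> ?A k. r < x}" using step(1) by auto
      then show ?thesis using step(2) True by simp
    next
      case False
      then have "{x \<in> ?A (Suc k). r < x} = {x \<in> ?A k. r < x}" using step(1) by auto
      then show ?thesis using False by simp
    qed
    have last: "Max (insert 0 {x \<in> ?A (Suc k). x < r}) =
        (if Max (insert 0 {x \<in> ?A k. x < r}) < u \<and> u < r then u else Max (insert 0 {x \<in> ?A k. x < r}))"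
    proof (cases "u < r")
      case True
      then have "insert 0 {x \<in> ?A (Suc k). x < r} = insert u (insert 0 {x \<in> ?A k. x < r})" using step(1) by auto
      moreover have "Max (insert u (insert 0 {x \<in> ?A k. x < r})) = max u (Max (insert 0 {x \<in> ?A k. x < r}))"
        by (rule Max_insert) simp_all
      moreover have "max u p = (if p < u \<and> u < r then u else p)" for p using True by auto
      ultimately show ?thesis by simp
    next
      case False
      then have "{x \<in> ?A (Suc k). x < r} = {x \<in> ?A k. x < r}" using step(1) by auto
      then show ?thesis using False by simp
    qed
    have sub: "?A (Suc k) \<subseteq> {1..n}" unfolding step(1) using step(3,6) by simp
    have "card {x \<in> ?A (Suc k). x < r} \<le> card {1..n}" "card {x \<in> ?A (Suc k). r < x} \<le> card {1..n}"
      by (rule card_mono, simp, use sub in blast)+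
    moreover have "Max (insert 0 {x \<in> ?A k. x < r}) \<le> r" by simp
    ultimately have le: "card {x \<in> ?A k. x < r} + of_bool (u < r) \<le> B" "card {x \<in> ?A k. r < x} + of_bool (r < u) \<le> B"
      "Max (insert 0 {x \<in> ?A k. x < r}) \<le> B" "u \<le> B" "r \<le> B" "1 \<le> B"
      using left right B_bounds r step(3) by auto
    define l d p where "l = card {x \<in> ?A k. x < r}" and "d = card {x \<in> ?A k. r < x}"
      and "p = Max (insert 0 {x \<in> ?A k. x < r})"
    have arr: "profiled r s" "untouched (Suc r) s" "array s ''left'' r = l" "array s ''right'' r = d" "array s ''nbr'' r = p"
      "\<And>x. array s ''mark'' x \<le> r" "\<And>x. array s ''mark'' x = r \<longleftrightarrow> x \<in> ?A k"
      using inv unfolding l_def d_def p_def by blast+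
    have goal: "?Inv (Suc k) s' \<longleftrightarrow> profiled r s' \<and> untouched (Suc r) s' \<and> array s' ''left'' r = l + of_bool (u < r) \<and>
      array s' ''right'' r = d + of_bool (r < u) \<and> array s' ''nbr'' r = (if p < u \<and> u < r then u else p) \<and>
      (\<forall>x. array s' ''mark'' x \<le> r) \<and> (\<forall>x. array s' ''mark'' x = r \<longleftrightarrow> x = u \<or> x \<in> ?A k)" for s'
      unfolding left right last l_def d_def p_def unfolding step(1) by simp
    have u': "scalar s ''u'' = u" using su by (simp add: u_def)
    have r1: "1 \<le> r" using r by simp
    show "runs B scan_nbrs s \<and> at_vertex r (run scan_nbrs s) \<and> ?Inv (Suc k) (run scan_nbrs s) \<and>
        scalar (run scan_nbrs s) ''j'' = scalar s ''j''"
      unfolding goal scan_nbrs_def using i u' at arr le[folded l_def d_def p_def] r1 by simp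
  qed auto
  then show ?thesis
  proof (rule hoare_conseq)
    show "(steps scan_nbrs + 14) * length (nbrs r) + 9 \<le> 50 * length (nbrs r) + 9" 
      by (simp add: scan_nbrs_def)
    fix s assume s: "at_vertex r s \<and> ?Inv (length (nbrs r)) s"
    have "{x \<in> ?A (length (nbrs r)). x < r} = {x. E x r \<and> x < r}" "{x \<in> ?A (length (nbrs r)). r < x} = {x. E x r \<and> r < x}"
      "x \<in> ?A (length (nbrs r)) \<longleftrightarrow> E x r" for x
      using nbrs_props(2)[OF r] by auto
    with s show "at_vertex r s \<and> profiled r s \<and> untouched (Suc r) s \<and> array s ''left'' r = left_degree r \<and>
      array s ''right'' r = right_degree r \<and> array s ''nbr'' r = last_nbr r \<and>
      (\<forall>x. array s ''mark'' x \<le> r) \<and> (\<forall>x. array s ''mark'' x = r \<longleftrightarrow> E x r)"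
      unfolding left_degree_def right_degree_def last_nbr_def by simp
  qed auto
qed

text \<open>All vertices strictly between \<open>q\<close> and \<open>r\<close> are neighbours of
  \<open>r\<close>, and \<open>q\<close> has moved in every round as long as it is a neighbour
  itself. If it still were one after as many rounds as \<open>r\<close> has neighbours, then
  \<open>q\<close> up to \<open>r - 1\<close> would be one neighbour too many. As 0 is never a
  neighbour, the descent stops there at the latest.\<close>

lemma hoare_descend:
  assumes r: "r \<in> {1..n}"
  shows "hoare B (\<lambda>s. at_vertex r s \<and> profiled r s \<and> untouched (Suc r) s \<and> array s ''left'' r = left_degree r \<and>
      array s ''right'' r = right_degree r \<and> array s ''nbr'' r = last_nbr r \<and>
      (\<forall>x. array s ''mark'' x \<le> r) \<and> (\<forall>x. array s ''mark'' x = r \<longleftrightarrow> E x r) \<and> scalar s ''q'' = r - 1)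
    (nbr_loop descend) (30 * length (nbrs r) + 9)
    (\<lambda>s. at_vertex r s \<and> profiled r s \<and> untouched (Suc r) s \<and> array s ''left'' r = left_degree r \<and>
      array s ''right'' r = right_degree r \<and> array s ''nbr'' r = last_nbr r \<and>
      (\<forall>x. array s ''mark'' x \<le> r) \<and> scalar s ''q'' = last_gap r)"
proof -
  let ?Inv = "\<lambda>k s. profiled r s \<and> untouched (Suc r) s \<and> array s ''left'' r = left_degree r \<and>
      array s ''right'' r = right_degree r \<and> array s ''nbr'' r = last_nbr r \<and>
      (\<forall>x. array s ''mark'' x \<le> r) \<and> (\<forall>x. array s ''mark'' x = r \<longleftrightarrow> E x r) \<and>
      scalar s ''q'' < r \<and> (\<forall>x. scalar s ''q'' < x \<longrightarrow> x < r \<longrightarrow> E x r) \<and>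
      (E (scalar s ''q'') r \<longrightarrow> scalar s ''q'' + k + 1 = r)"
  have "hoare B (\<lambda>s. at_vertex r s \<and> profiled r s \<and> untouched (Suc r) s \<and> array s ''left'' r = left_degree r \<and>
      array s ''right'' r = right_degree r \<and> array s ''nbr'' r = last_nbr r \<and>
      (\<forall>x. array s ''mark'' x \<le> r) \<and> (\<forall>x. array s ''mark'' x = r \<longleftrightarrow> E x r) \<and> scalar s ''q'' = r - 1)
    (nbr_loop descend) ((steps descend + 14) * length (nbrs r) + 9) (\<lambda>s. at_vertex r s \<and> ?Inv (length (nbrs r)) s)"
  proof (rule hoare_nbr_loop[OF r])
    fix k s assume at: "at_vertex r s" and inv: "?Inv k s"
    define q where "q = scalar s ''q''"
    have i: "scalar s ''i'' = r" using at by (simp add: at_vertex_def)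
    have "array s ''mark'' q \<le> r" and mark_r: "array s ''mark'' q = r \<longleftrightarrow> E q r" using inv by simp_all
    then have mark: "array s ''mark'' q \<le> B" "array s ''mark'' q = r \<longleftrightarrow> E q r"
      using vertex_bounds(1)[OF r] by simp_all
    have q: "q < r" "\<And>x. q < x \<Longrightarrow> x < r \<Longrightarrow> E x r" "E q r \<Longrightarrow> q + k + 1 = r"
      using inv by (auto simp: q_def)
    have q0: "q \<noteq> 0" if "E q r" using that no_edge_0 by (cases "q = 0") auto
    have up: "E x r" if "q - 1 < x" "x < r" "E q r" for x
      using that q(2)[of x] q(1) by (cases "x = q") auto
    have run: "run descend s = (if E q r then set_var ''q'' (q - 1) s else s)"
      using mark i by (simp add: descend_def q_def[symmetric])
    have "q - Suc 0 \<le> B" using q(1) vertex_bounds(1)[OF r] by simp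
    then have ok: "runs B descend s"
      using mark i q(1) vertex_bounds[OF r] by (simp add: descend_def q_def[symmetric])
    have inv': "?Inv (Suc k) (run descend s)"
    proof (cases "E q r")
      case True
      then show ?thesis using inv q(1) q(3)[OF True] q0[OF True] up[OF _ _ True] unfolding run by simp
    next
      case False
      then show ?thesis using inv unfolding run by (simp add: q_def)
    qed
    have at': "at_vertex r (run descend s)" "scalar (run descend s) ''j'' = scalar s ''j''"
      using at by (simp_all add: run)
    show "runs B descend s \<and> at_vertex r (run descend s) \<and> ?Inv (Suc k) (run descend s) \<and>
        scalar (run descend s) ''j'' = scalar s ''j''"
      by (rule conjI[OF ok conjI[OF at'(1) conjI[OF inv' at'(2)]]])
  qed (use r in auto)
  then show ?thesis
  proof (rule hoare_conseq)
    show "(steps descend + 14) * length (nbrs r) + 9 \<le> 30 * length (nbrs r) + 9"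
      by (simp add: descend_def)
    fix s assume s: "at_vertex r s \<and> ?Inv (length (nbrs r)) s"
    define q where "q = scalar s ''q''"
    have q: "q < r" "\<And>x. q < x \<Longrightarrow> x < r \<Longrightarrow> E x r" "E q r \<Longrightarrow> q + length (nbrs r) + 1 = r"
      using s by (auto simp: q_def)
    have nq: "\<not> E q r"
    proof
      assume Eq: "E q r"
      have "card {q..<r} \<le> card {j. E j r}"
      proof (rule card_mono)
        show "finite {j. E j r}" using finite_nbrs[of r "\<lambda>_. True"] by simp
        show "{q..<r} \<subseteq> {j. E j r}" using Eq q(2) by (auto simp: le_less)
      qed
      then show False using q(3)[OF Eq] nbrs_length[OF r] by simp
    qed
    have "q = last_gap r"
      using last_gap_props(2)[OF nq q(1)] last_gap_props(1)[of r] q(2)[of "last_gap r"] by fastforce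
    then show "at_vertex r s \<and> profiled r s \<and> untouched (Suc r) s \<and> array s ''left'' r = left_degree r \<and>
      array s ''right'' r = right_degree r \<and> array s ''nbr'' r = last_nbr r \<and>
      (\<forall>x. array s ''mark'' x \<le> r) \<and> scalar s ''q'' = last_gap r"
      using s unfolding q_def by simp
  qed auto
qed

lemma profiled_Suc:
  "r \<in> {1..n} \<Longrightarrow> profiled (Suc r) s \<longleftrightarrow> profiled r s \<and> array s ''left'' r = left_degree r \<and>
    array s ''right'' r = right_degree r \<and> array s ''nbr'' r = last_nbr r \<and> array s ''gap'' r = last_gap r"
  by (auto simp: profiled_def less_Suc_eq)

text \<open>This is where costs proportional to the degrees become linear in
  \<open>m\<close>.\<close>

lemma linear_sum_bound:
  "(\<Sum>r = 1..n. a * length (nbrs r) + b) \<le> 2 * a * m + b * n"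
proof -
  have "(\<Sum>r = 1..n. a * length (nbrs r) + b) = a * (\<Sum>r = 1..n. length (nbrs r)) + b * n"
    by (simp add: sum.distrib sum_distrib_left)
  also have "\<dots> \<le> a * (2 * m) + b * n" using sum_nbrs by simp
  finally show ?thesis by simp
qed

lemma hoare_profile_prog:
  "hoare B (\<lambda>s. ranked s \<and> blank work_arrays s) profile_prog (200 * (n + m + 1))
    (\<lambda>s. profiled (Suc n) s \<and> blank {''stamp'', ''common_nbr'', ''common_gap''} s)"
proof -
  let ?Inv = "\<lambda>k s. profiled k s \<and> untouched k s \<and> (\<forall>x. array s ''mark'' x < k)"
  have "hoare B (\<lambda>s. ranked s \<and> blank work_arrays s) profile_prog
      ((\<Sum>r = 1..n. 80 * length (nbrs r) + 30) + 9 * n + 7) (?Inv (Suc n))"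
    unfolding profile_prog_def
  proof (rule hoare_vertex_loop)
    fix r assume r: "r \<in> {1..n}"
    have load: "hoare B (\<lambda>s. ?Inv r s \<and> scalar s ''i'' = r) load_vertex 5
        (\<lambda>s. at_vertex r s \<and> profiled r s \<and> untouched r s \<and> (\<forall>x. array s ''mark'' x < r))"
      by (rule hoare_load_vertex[OF r]) (auto simp: profiled_def)
    have init: "hoare B (\<lambda>s. at_vertex r s \<and> profiled r s \<and> untouched (Suc r) s \<and> array s ''left'' r = left_degree r \<and>
        array s ''right'' r = right_degree r \<and> array s ''nbr'' r = last_nbr r \<and>
        (\<forall>x. array s ''mark'' x \<le> r) \<and> (\<forall>x. array s ''mark'' x = r \<longleftrightarrow> E x r))
      (Assign ''q'' (Op Sub (Var ''i'') (Const 1))) (steps (Assign ''q'' (Op Sub (Var ''i'') (Const 1))))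
      (\<lambda>s. at_vertex r s \<and> profiled r s \<and> untouched (Suc r) s \<and> array s ''left'' r = left_degree r \<and>
        array s ''right'' r = right_degree r \<and> array s ''nbr'' r = last_nbr r \<and>
        (\<forall>x. array s ''mark'' x \<le> r) \<and> (\<forall>x. array s ''mark'' x = r \<longleftrightarrow> E x r) \<and> scalar s ''q'' = r - 1)"
      by (rule hoare_straight) (use vertex_bounds[OF r] in \<open>auto simp: at_vertex_def\<close>)
    have last: "last_gap r \<le> B" using last_gap_props(1)[of r] vertex_bounds[OF r] by auto
    have store: "hoare B (\<lambda>s. at_vertex r s \<and> profiled r s \<and> untouched (Suc r) s \<and> array s ''left'' r = left_degree r \<and>
        array s ''right'' r = right_degree r \<and> array s ''nbr'' r = last_nbr r \<and>
        (\<forall>x. array s ''mark'' x \<le> r) \<and> scalar s ''q'' = last_gap r)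
      (Store ''gap'' (Var ''i'') (Var ''q'')) (steps (Store ''gap'' (Var ''i'') (Var ''q'')))
      (\<lambda>s. scalar s ''i'' = r \<and> ?Inv (Suc r) s)"
      by (rule hoare_straight)
        (use vertex_bounds[OF r] last r in \<open>auto simp: profiled_Suc at_vertex_def less_Suc_eq_le\<close>)
    show "hoare B (\<lambda>s. ?Inv r s \<and> scalar s ''i'' = r) (Seq load_vertex (Seq (nbr_loop scan_nbrs)
        (Seq (Assign ''q'' (Op Sub (Var ''i'') (Const 1))) (Seq (nbr_loop descend)
          (Store ''gap'' (Var ''i'') (Var ''q'')))))) (80 * length (nbrs r) + 30)
        (\<lambda>s. scalar s ''i'' = r \<and> ?Inv (Suc r) s)"
      \<comment> \<open>The five parts cost 5, \<open>50 d + 9\<close>, 4, \<open>30 d + 9\<close>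
        and 3 for a vertex of degree \<open>d\<close>, in total \<open>80 d + 30\<close>.\<close>
      by (rule hoare_conseq[OF hoare_Seq[OF load hoare_Seq[OF hoare_scan_nbrs[OF r]
          hoare_Seq[OF init hoare_Seq[OF hoare_descend[OF r] store]]]]]) auto
  qed (auto simp: profiled_def untouched_def ranked_def loaded_def blank_def)
  then show ?thesis
    by (rule hoare_conseq) (use linear_sum_bound[of 80 30] in \<open>auto simp: untouched_def\<close>)
qed

text \<open>The outer loop runs over the common neighbour \<open>a\<close>, so the invariant
  restricts the count to those \<open>a\<close> already visited.\<close>

definition partial_common :: "(nat \<Rightarrow> nat) \<Rightarrow> nat \<Rightarrow> nat \<Rightarrow> nat" where
  "partial_common p k c = card {a. a < k \<and> E a c \<and> E a (p c) \<and> a < p c}"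

lemma partial_common_Suc:
  "partial_common p (Suc k) c = partial_common p k c + of_bool (E k c \<and> E k (p c) \<and> k < p c)"
proof (cases "E k c \<and> E k (p c) \<and> k < p c")
  case True
  then have "{a. a < Suc k \<and> E a c \<and> E a (p c) \<and> a < p c} = insert k {a. a < k \<and> E a c \<and> E a (p c) \<and> a < p c}"
    by (auto simp: less_Suc_eq)
  then show ?thesis using True by (simp add: partial_common_def)
next
  case False
  then have "{a. a < Suc k \<and> E a c \<and> E a (p c) \<and> a < p c} = {a. a < k \<and> E a c \<and> E a (p c) \<and> a < p c}"
    by (auto simp: less_Suc_eq)
  then show ?thesis using False by (simp add: partial_common_def)
qed

lemma partial_common_le: "partial_common p k c \<le> k"
  using card_mono[of "{..<k}" "{a. a < k \<and> E a c \<and> E a (p c) \<and> a < p c}"]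
  by (auto simp: partial_common_def)

lemma partial_common_1: "partial_common p (Suc 0) c = 0"
  by (auto simp: partial_common_def)

lemma partial_common_full: "partial_common p (Suc n) c = common_left p c"
proof -
  have "{a. a < Suc n \<and> E a c \<and> E a (p c) \<and> a < p c} = {a. E a c \<and> E a (p c) \<and> a < p c}"
    using range by (auto simp: less_Suc_eq_le)
  then show ?thesis by (simp add: partial_common_def common_left_def)
qed

text \<open>Stamps work as marks do. \<open>R\<close> stands for whatever the outer loop has to
  carry along.\<close>

lemma hoare_stamp_nbrs:
  assumes r: "r \<in> {1..n}" and R: "\<And>s x v. x \<noteq> ''n'' \<Longrightarrow> x \<noteq> ''result'' \<Longrightarrow> R (set_var x v s) = R s" "\<And>s i v. R (set_cell ''stamp'' i v s) = R s"
  shows "hoare B (\<lambda>s. at_vertex r s \<and> R s \<and> (\<forall>x. array s ''stamp'' x < r))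
    (nbr_loop (Store ''stamp'' (Var ''u'') (Var ''i''))) (17 * length (nbrs r) + 9)
    (\<lambda>s. at_vertex r s \<and> R s \<and> (\<forall>x. array s ''stamp'' x \<le> r) \<and> (\<forall>x. array s ''stamp'' x = r \<longleftrightarrow> E x r))"
proof -
  let ?c = "Store ''stamp'' (Var ''u'') (Var ''i'')"
  let ?Inv = "\<lambda>k s. R s \<and> (\<forall>x. array s ''stamp'' x \<le> r) \<and>
     (\<forall>x. array s ''stamp'' x = r \<longleftrightarrow> x \<in> set (take k (nbrs r)))"
  have "hoare B (\<lambda>s. at_vertex r s \<and> R s \<and> (\<forall>x. array s ''stamp'' x < r))
    (nbr_loop ?c) ((steps ?c + 14) * length (nbrs r) + 9) (\<lambda>s. at_vertex r s \<and> ?Inv (length (nbrs r)) s)"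
  proof (rule hoare_nbr_loop[OF r])
    show "at_vertex r s \<and> ?Inv 0 s" if "at_vertex r s \<and> R s \<and> (\<forall>x. array s ''stamp'' x < r)" for s
      using that by (auto simp: less_imp_le dest: less_imp_neq)
  next
    fix k s assume k: "k < length (nbrs r)" and at: "at_vertex r s" and inv: "?Inv k s" and u: "scalar s ''u'' = nbrs r ! k"
    have "scalar s ''i'' = r" using at by (simp add: at_vertex_def)
    then show "runs B ?c s \<and> at_vertex r (run ?c s) \<and> ?Inv (Suc k) (run ?c s) \<and> scalar (run ?c s) ''j'' = scalar s ''j''"
      using inv u at vertex_bounds[OF r] vertex_bounds(1)[OF nbrs_step(3)[OF r k]]
      unfolding nbrs_step(1)[OF r k] by (simp add: R)
  qed (simp_all add: R)
  then show ?thesis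
    by (rule hoare_conseq) (use nbrs_props(2)[OF r] in auto)
qed

text \<open>Here \<open>r\<close> plays the common neighbour \<open>a\<close>, and the neighbour in
  \<open>u\<close> plays \<open>c\<close>. Each \<open>c\<close> is met once, so its count grows by
  at most one and reaches the next stage of \<open>partial_common\<close>.\<close>

lemma hoare_count_common:
  assumes r: "r \<in> {1..n}"
  defines "C \<equiv> Seq (count_common ''common_nbr'' ''nbr'') (count_common ''common_gap'' ''gap'')"
  shows "hoare B (\<lambda>s. at_vertex r s \<and> (profiled (Suc n) s \<and> (\<forall>x \<in> {1..n}. array s ''common_nbr'' x = partial_common last_nbr r x \<and>
        array s ''common_gap'' x = partial_common last_gap r x)) \<and>
      (\<forall>x. array s ''stamp'' x \<le> r) \<and> (\<forall>x. array s ''stamp'' x = r \<longleftrightarrow> E x r))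
    (nbr_loop C) (60 * length (nbrs r) + 9)
    (\<lambda>s. at_vertex r s \<and> profiled (Suc n) s \<and> (\<forall>x \<in> {1..n}. array s ''common_nbr'' x = partial_common last_nbr (Suc r) x \<and>
        array s ''common_gap'' x = partial_common last_gap (Suc r) x) \<and> (\<forall>x. array s ''stamp'' x \<le> r))"
proof -
  \<comment> \<open>In the midst of the loop only the neighbours in the processed prefix have
    received the contribution of \<open>r\<close>.\<close>
  let ?f = "\<lambda>p k x. partial_common p r x + of_bool (x \<in> set (take k (nbrs r)) \<and> E r (p x) \<and> r < p x)"
  let ?Inv = "\<lambda>k s. profiled (Suc n) s \<and> (\<forall>x \<in> {1..n}. array s ''common_nbr'' x = ?f last_nbr k x \<and>
        array s ''common_gap'' x = ?f last_gap k x) \<and>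
      (\<forall>x. array s ''stamp'' x \<le> r) \<and> (\<forall>x. array s ''stamp'' x = r \<longleftrightarrow> E x r)"
  have "hoare B (\<lambda>s. at_vertex r s \<and> (profiled (Suc n) s \<and> (\<forall>x \<in> {1..n}. array s ''common_nbr'' x = partial_common last_nbr r x \<and>
        array s ''common_gap'' x = partial_common last_gap r x)) \<and>
      (\<forall>x. array s ''stamp'' x \<le> r) \<and> (\<forall>x. array s ''stamp'' x = r \<longleftrightarrow> E x r))
    (nbr_loop C) ((steps C + 14) * length (nbrs r) + 9) (\<lambda>s. at_vertex r s \<and> ?Inv (length (nbrs r)) s)"
  proof (rule hoare_nbr_loop[OF r])
    fix k s assume k: "k < length (nbrs r)" and at: "at_vertex r s" and inv: "?Inv k s" and su: "scalar s ''u'' = nbrs r ! k"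
    define u where "u = nbrs r ! k"
    note step = nbrs_step[OF r k, folded u_def]
    have i: "scalar s ''i'' = r" and u: "scalar s ''u'' = u" using at su by (auto simp: at_vertex_def u_def)
    have arr: "array s ''nbr'' u = last_nbr u" "array s ''gap'' u = last_gap u"
      "array s ''common_nbr'' u = partial_common last_nbr r u" "array s ''common_gap'' u = partial_common last_gap r u"
      using inv step(2,3) by (auto simp: profiled_def)
    have stamp: "array s ''stamp'' x \<le> B" "array s ''stamp'' x = r \<longleftrightarrow> E r x" for x
    proof -
      have "array s ''stamp'' x \<le> r" using inv by simp
      then show "array s ''stamp'' x \<le> B" using vertex_bounds(1)[OF r] by simp
      have "array s ''stamp'' x = r \<longleftrightarrow> E x r" using inv by simp
      then show "array s ''stamp'' x = r \<longleftrightarrow> E r x" using sym by blast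
    qed
    have p: "last_nbr u \<le> B" "last_gap u \<le> B"
      using last_nbr_props(1)[of u] last_gap_props(1)[of u] vertex_bounds(1)[OF step(3)] by auto
    have c: "partial_common q r u + of_bool b \<le> B" "partial_common q r u \<le> B" for q b
      using partial_common_le[of q r u] r B_bounds by (cases b; simp)+
    have f: "?f q (Suc k) x = (if x = u then partial_common q r u + of_bool (E r (q u) \<and> r < q u) else ?f q k x)" for q x
      unfolding step(1) using step(2) by auto
    define s' where "s' = set_cell ''common_nbr'' u (partial_common last_nbr r u + of_bool (E r (last_nbr u) \<and> r < last_nbr u)) s"
    have run1: "run (count_common ''common_nbr'' ''nbr'') s = s'"
      using i u arr stamp by (auto simp: count_common_def s'_def)
    have run: "run C s = set_cell ''common_gap'' u (partial_common last_gap r u + of_bool (E r (last_gap u) \<and> r < last_gap u)) s'"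
      unfolding C_def run.simps run1 using i u arr stamp by (auto simp: count_common_def s'_def)
    have ok1: "runs B (count_common ''common_nbr'' ''nbr'') s"
      using i u arr stamp p c vertex_bounds[OF r] vertex_bounds[OF step(3)]
      by (simp add: count_common_def of_bool_conj[symmetric] del: of_bool_conj)
    have ok2: "runs B (count_common ''common_gap'' ''gap'') s'"
      using i u arr stamp p c vertex_bounds[OF r] vertex_bounds[OF step(3)]
      by (simp add: count_common_def s'_def of_bool_conj[symmetric] del: of_bool_conj)
    have ok: "runs B C s" unfolding C_def using ok1 ok2 run1 by simp
    have inv': "?Inv (Suc k) (run C s)"
      unfolding run s'_def f using inv by simp
    have at': "at_vertex r (run C s)" "scalar (run C s) ''j'' = scalar s ''j''"
      using at by (simp_all add: run s'_def)
    show "runs B C s \<and> at_vertex r (run C s) \<and> ?Inv (Suc k) (run C s) \<and>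
        scalar (run C s) ''j'' = scalar s ''j''"
      by (rule conjI[OF ok conjI[OF at'(1) conjI[OF inv' at'(2)]]])
  qed auto
  then show ?thesis
  proof (rule hoare_conseq)
    show "(steps C + 14) * length (nbrs r) + 9 \<le> 60 * length (nbrs r) + 9"
      by (simp add: C_def count_common_def)
    fix s assume s: "at_vertex r s \<and> ?Inv (length (nbrs r)) s"
    have "?f p (length (nbrs r)) x = partial_common p (Suc r) x" for p x
      using nbrs_props(2)[OF r] sym[of x r] sym[of r x] by (auto simp: partial_common_Suc)
    then show "at_vertex r s \<and> profiled (Suc n) s \<and> (\<forall>x \<in> {1..n}. array s ''common_nbr'' x = partial_common last_nbr (Suc r) x \<and>
        array s ''common_gap'' x = partial_common last_gap (Suc r) x) \<and> (\<forall>x. array s ''stamp'' x \<le> r)"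
      using s by simp
  qed auto
qed

end

text \<open>Bounds the value of an expression, as an exponent of \<open>n + m + 2\<close>.\<close>

fun expr_size :: "expr \<Rightarrow> nat" where
  "expr_size (Const k) = Suc k"
| "expr_size (Var x) = 1"
| "expr_size (Read a e) = 1"
| "expr_size (Op f e1 e2) = expr_size e1 + expr_size e2 + 1"

section \<open>Running the tests\<close>

definition test_prog :: "expr \<Rightarrow> expr \<Rightarrow> com" where
  "test_prog g h = Seq (Seq (Assign ''p'' (Const 0)) (Assign ''q'' (Const 0)))
     (Seq (vertex_loop (Seq (Assign ''p'' (Op Add (Var ''p'') g)) (Assign ''q'' (Op Add (Var ''q'') h))))
       (Cond (Op Eq (Var ''p'') (Var ''q'')) Skip (Assign ''result'' (Const 1))))"

fun tests_prog :: "(expr \<times> expr) list \<Rightarrow> com" where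
  "tests_prog [] = Skip"
| "tests_prog ((g, h) # tests) = Seq (test_prog g h) (tests_prog tests)"

definition tests_width :: "(expr \<times> expr) list \<Rightarrow> nat" where
  "tests_width tests = (\<Sum>(g, h) \<leftarrow> tests. expr_size g + expr_size h + 1)"

definition tests_cost :: "(expr \<times> expr) list \<Rightarrow> nat" where
  "tests_cost tests = (\<Sum>(g, h) \<leftarrow> tests. cost g + cost h + 50) + 1"

definition full_prog :: "(expr \<times> expr) list \<Rightarrow> com" where
  "full_prog tests = Seq rank_prog (Seq profile_prog (Seq common_prog (tests_prog tests)))"

text \<open>The additional 1 in the exponent pays for the factor 2 of an addition, as
  \<open>M\<close> is at least 2; products need only the sum of the exponents.\<close>

lemma power_op_le:
  fixes x y M :: nat
  assumes "2 \<le> M" "x \<le> M ^ a" "y \<le> M ^ b"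
  shows "apply_op f x y \<le> M ^ (a + b + 1)"
proof -
  have 1: "1 \<le> M ^ a" "1 \<le> M ^ b" using assms(1) by auto
  have "x + y \<le> 2 * (M ^ a * M ^ b)"
  proof -
    have "M ^ a \<le> M ^ a * M ^ b" "M ^ b \<le> M ^ a * M ^ b" using 1 by auto
    then show ?thesis using assms(2,3) by linarith
  qed
  also have "\<dots> \<le> M ^ (a + b + 1)" using assms(1) by (simp add: power_add)
  finally have add: "x + y \<le> M ^ (a + b + 1)" .
  have "x * y \<le> M ^ (a + b)" using assms(2,3) by (simp add: power_add mult_le_mono)
  also have "\<dots> \<le> M ^ (a + b + 1)" using assms(1) by (intro power_increasing) auto
  finally have mul: "x * y \<le> M ^ (a + b + 1)" .
  have "1 \<le> M ^ (a + b + 1)" using assms(1) by auto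
  moreover have "x div y \<le> x + y" "x - y \<le> x + y"
    using div_le_dividend[of x y] by linarith+
  moreover define X where "X = M ^ (a + b + 1)"
  ultimately have "apply_op f x y \<le> X" using add mul unfolding X_def[symmetric]
    by (cases f) auto
  then show ?thesis unfolding X_def .
qed

context graph_input
begin

lemma hoare_common_prog:
  "hoare B (\<lambda>s. profiled (Suc n) s \<and> blank {''stamp'', ''common_nbr'', ''common_gap''} s) common_prog (200 * (n + m + 1))
    (\<lambda>s. prepared s \<and> scalar s ''result'' = 0)"
proof -
  let ?R = "\<lambda>k s. profiled (Suc n) s \<and> (\<forall>x \<in> {1..n}. array s ''common_nbr'' x = partial_common last_nbr k x \<and>
        array s ''common_gap'' x = partial_common last_gap k x)"
  let ?Inv = "\<lambda>k s. ?R k s \<and> (\<forall>x. array s ''stamp'' x < k)"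
  have "hoare B (\<lambda>s. profiled (Suc n) s \<and> blank {''stamp'', ''common_nbr'', ''common_gap''} s) common_prog
      ((\<Sum>r = 1..n. 80 * length (nbrs r) + 30) + 9 * n + 7) (?Inv (Suc n))"
    unfolding common_prog_def
  proof (rule hoare_vertex_loop[where Inv = ?Inv])
    fix r assume r: "r \<in> {1..n}"
    have load: "hoare B (\<lambda>s. ?Inv r s \<and> scalar s ''i'' = r) load_vertex 5 (\<lambda>s. at_vertex r s \<and> ?Inv r s)"
      by (rule hoare_load_vertex[OF r]) (auto simp: profiled_def)
    have load': "hoare B (\<lambda>s. ?Inv r s \<and> scalar s ''i'' = r) load_vertex 5
        (\<lambda>s. at_vertex r s \<and> ?R r s \<and> (\<forall>x. array s ''stamp'' x < r))"
      by (rule hoare_conseq[OF load]) auto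
    have stamp: "hoare B (\<lambda>s. at_vertex r s \<and> ?R r s \<and> (\<forall>x. array s ''stamp'' x < r))
        (nbr_loop (Store ''stamp'' (Var ''u'') (Var ''i''))) (17 * length (nbrs r) + 9)
        (\<lambda>s. at_vertex r s \<and> ?R r s \<and> (\<forall>x. array s ''stamp'' x \<le> r) \<and> (\<forall>x. array s ''stamp'' x = r \<longleftrightarrow> E x r))"
    proof (rule hoare_stamp_nbrs[where R = "?R r", OF r])
      fix s x v
      show "x \<noteq> ''n'' \<Longrightarrow> x \<noteq> ''result'' \<Longrightarrow> ?R r (set_var x v s) = ?R r s" by simp
      show "?R r (set_cell ''stamp'' i v s) = ?R r s" for i v s by simp
    qed
    show "hoare B (\<lambda>s. ?Inv r s \<and> scalar s ''i'' = r) (Seq load_vertex (Seq (nbr_loop (Store ''stamp'' (Var ''u'') (Var ''i'')))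
        (nbr_loop (Seq (count_common ''common_nbr'' ''nbr'') (count_common ''common_gap'' ''gap''))))) (80 * length (nbrs r) + 30)
        (\<lambda>s. scalar s ''i'' = r \<and> ?Inv (Suc r) s)"
      by (rule hoare_conseq[OF hoare_Seq[OF load' hoare_Seq[OF stamp hoare_count_common[OF r]]]])
        (auto simp: at_vertex_def less_Suc_eq_le)
  qed (auto simp: profiled_def ranked_def loaded_def blank_def partial_common_1)
  then show ?thesis
    by (rule hoare_conseq)
      (use linear_sum_bound[of 80 30] in \<open>auto simp: prepared_def profiled_def ranked_def loaded_def partial_common_full\<close>)
qed

lemma degree_bounds:
  "left_degree i \<le> n" "right_degree i \<le> n" "common_left p i \<le> n + 1" "i \<in> {1..n} \<Longrightarrow> last_gap i \<le> n"
proof -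
  have "card {j. E j i \<and> j < i} \<le> card {1..n}" "card {j. E j i \<and> i < j} \<le> card {1..n}"
    by (rule card_mono, simp, use range in blast)+
  then show "left_degree i \<le> n" "right_degree i \<le> n" by (auto simp: left_degree_def right_degree_def)
  show "common_left p i \<le> n + 1" using partial_common_le[of p "Suc n" i] by (simp add: partial_common_full)
  show "i \<in> {1..n} \<Longrightarrow> last_gap i \<le> n" using last_gap_props(1)[of i] by auto
qed

lemma prepared_left_gap:
  assumes "prepared s" "i \<in> {1..n}"
  shows "array s ''left'' (last_gap i) = left_degree (last_gap i)"
  using assms last_gap_props(1)[of i] unfolding prepared_def by (cases "last_gap i = 0") auto

text \<open>Values of local expressions agree in all prepared states at the same rank, so the totals
  may be stated for one fixed state although the program keeps changing its own.\<close>

lemma eval_local: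
  assumes "local_expr g" "prepared s" "prepared s'" "scalar s ''i'' = r" "scalar s' ''i'' = r" "r \<in> {1..n}"
  shows "eval g s = eval g s'"
  using assms(1)
proof (induction g)
  case (Var x)
  then show ?case using assms by (auto simp: prepared_def)
next
  case (Read a e)
  show ?case
  proof (cases "e = Var ''i''")
    case True
    then show ?thesis using Read.prems assms by (auto simp: prepared_def)
  next
    case False
    then have "a = ''left''" "e = Read ''gap'' (Var ''i'')" using Read.prems by auto
    moreover have "array s ''gap'' r = last_gap r" "array s' ''gap'' r = last_gap r"
      using assms by (auto simp: prepared_def)
    ultimately show ?thesis
      using prepared_left_gap assms by simp
  qed
qed auto

text \<open>The exponent of an expression dominates those of its parts, so if the bound for the
  whole is a machine word, all intermediate results are.\<close>

lemma local_expr_bound: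
  assumes "prepared s" "scalar s ''i'' = r" "r \<in> {1..n}" and "local_expr g"
  shows "eval g s \<le> (n + m + 2) ^ expr_size g \<and> ((n + m + 2) ^ expr_size g \<le> B \<longrightarrow> fits B g s)"
  using assms(4)
proof (induction g)
  case (Const k)
  have "k \<le> (2 :: nat) ^ Suc k" using less_exp[of "Suc k"] by linarith
  also have "\<dots> \<le> (n + m + 2) ^ Suc k" by (rule power_mono) auto
  finally show ?case by auto
next
  case (Var x)
  then show ?case using assms by (auto simp: prepared_def)
next
  case (Read a e)
  note P = assms(1-3)
  have r: "array s ''left'' r = left_degree r" "array s ''right'' r = right_degree r" "array s ''gap'' r = last_gap r"
    "array s ''common_nbr'' r = common_left last_nbr r" "array s ''common_gap'' r = common_left last_gap r"
    using P by (auto simp: prepared_def)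
  note bounds = degree_bounds(1,2)[of r] degree_bounds(3)[of _ r] degree_bounds(4)[OF P(3)]
  show ?case
  proof (cases "e = Var ''i''")
    case True
    then have "a \<in> {''left'', ''right'', ''gap'', ''common_nbr'', ''common_gap''}" using Read.prems by simp
    then have "array s a r \<le> n + 1" using r bounds by (auto intro: le_SucI)
    then show ?thesis using True P by auto
  next
    case False
    then have "a = ''left''" "e = Read ''gap'' (Var ''i'')" using Read.prems by auto
    moreover have "left_degree (last_gap r) \<le> n" by (rule degree_bounds)
    ultimately show ?thesis using r bounds(4) P prepared_left_gap[OF P(1,3)] by auto
  qed
next
  case (Op f e1 e2)
  let ?M = "n + m + 2"
  have IH: "eval e1 s \<le> ?M ^ expr_size e1" "eval e2 s \<le> ?M ^ expr_size e2"
    "?M ^ expr_size e1 \<le> B \<Longrightarrow> fits B e1 s" "?M ^ expr_size e2 \<le> B \<Longrightarrow> fits B e2 s"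
    using Op by auto
  have "apply_op f (eval e1 s) (eval e2 s) \<le> ?M ^ (expr_size e1 + expr_size e2 + 1)"
    using IH by (intro power_op_le) auto
  moreover have "?M ^ expr_size e1 \<le> ?M ^ (expr_size e1 + expr_size e2 + 1)"
    "?M ^ expr_size e2 \<le> ?M ^ (expr_size e1 + expr_size e2 + 1)"
    by (intro power_increasing; simp)+
  ultimately show ?case using IH(3,4) by auto
qed

text \<open>A fixed prepared state, to which the postconditions refer in place of the running
  state.\<close>

definition canonical :: state where
  "canonical = \<lparr>scalar = (\<lambda>_. n), array = (\<lambda>_ _. 0)(''left'' := left_degree, ''right'' := right_degree,
     ''gap'' := last_gap, ''common_nbr'' := common_left last_nbr, ''common_gap'' := common_left last_gap)\<rparr>"

lemma prepared_canonical: "prepared canonical"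
  by (simp add: prepared_def canonical_def)

lemma prepared_set_var [simp]: "x \<noteq> ''n'' \<Longrightarrow> prepared (set_var x v s) = prepared s"
  by (simp add: prepared_def)

text \<open>\<open>b\<close> records whether an earlier test has found a difference. Since
  \<open>result\<close> is set but never cleared, a sequence of tests computes a
  disjunction.\<close>

lemma hoare_test_prog:
  assumes local: "local_expr g" "local_expr h" and size: "(n + m + 2) ^ (expr_size g + expr_size h + 1) \<le> B"
  shows "hoare B (\<lambda>s. prepared s \<and> (scalar s ''result'' \<noteq> 0 \<longleftrightarrow> b)) (test_prog g h) ((cost g + cost h + 50) * (n + m + 1))
    (\<lambda>s. prepared s \<and> (scalar s ''result'' \<noteq> 0 \<longleftrightarrow> b \<or> total g canonical \<noteq> total h canonical))"
proof -
  let ?M = "n + m + 2"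
  let ?body = "Seq (Assign ''p'' (Op Add (Var ''p'') g)) (Assign ''q'' (Op Add (Var ''q'') h))"
  let ?sum = "\<lambda>g k. \<Sum>i = 1..<k. eval g (at_rank canonical i)"
  let ?Inv = "\<lambda>k s. prepared s \<and> (scalar s ''result'' \<noteq> 0 \<longleftrightarrow> b) \<and> scalar s ''p'' = ?sum g k \<and> scalar s ''q'' = ?sum h k"
  have B1: "1 \<le> B" using B_bounds by simp
  have size': "?M ^ Suc (expr_size g) \<le> B" "?M ^ Suc (expr_size h) \<le> B"
    by (rule le_trans[OF power_increasing size]; simp)+
  have init: "hoare B (\<lambda>s. prepared s \<and> (scalar s ''result'' \<noteq> 0 \<longleftrightarrow> b))
      (Seq (Assign ''p'' (Const 0)) (Assign ''q'' (Const 0))) (steps (Seq (Assign ''p'' (Const 0)) (Assign ''q'' (Const 0)))) (?Inv 1)"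
    by (rule hoare_straight) simp
  have val: "eval f s = eval f (at_rank canonical r)" if "local_expr f" "prepared s" "scalar s ''i'' = r" "r \<in> {1..n}" for f s r
    using prepared_canonical that by (intro eval_local[where r = r]) (auto simp: at_rank_def prepared_def)
  \<comment> \<open>At most \<open>n\<close> summands cost one further factor
    \<open>n + m + 2\<close>, for which the exponent in \<open>size\<close> has room.\<close>
  have bound: "?sum f (Suc r) \<le> ?M ^ Suc (expr_size f)" if "local_expr f" "r \<in> {1..n}" for f r
  proof -
    have "eval f (at_rank canonical i) \<le> ?M ^ expr_size f" if "i \<in> {1..<Suc r}" for i
    proof -
      have "i \<in> {1..n}" using that \<open>r \<in> {1..n}\<close> by auto
      then show ?thesis
        using local_expr_bound[of "at_rank canonical i" i f] prepared_canonical \<open>local_expr f\<close>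
        by (auto simp: at_rank_def prepared_def)
    qed
    then have "?sum f (Suc r) \<le> (\<Sum>i = 1..<Suc r. ?M ^ expr_size f)" by (rule sum_mono)
    also have "\<dots> = r * ?M ^ expr_size f" by simp
    also have "\<dots> \<le> ?M ^ Suc (expr_size f)"
      unfolding power_Suc by (rule mult_le_mono1) (use that(2) in auto)
    finally show ?thesis .
  qed
  have loop: "hoare B (?Inv 1) (vertex_loop ?body) ((\<Sum>r = 1..n. steps ?body) + 9 * n + 7) (?Inv (Suc n))"
  proof (rule hoare_vertex_loop[where Inv = ?Inv])
    fix r assume r: "r \<in> {1..n}"
    show "hoare B (\<lambda>s. ?Inv r s \<and> scalar s ''i'' = r) ?body (steps ?body) (\<lambda>s. scalar s ''i'' = r \<and> ?Inv (Suc r) s)"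
    proof (rule hoare_straight)
      fix s assume s: "?Inv r s \<and> scalar s ''i'' = r"
      define s' where "s' = set_var ''p'' (?sum g (Suc r)) s"
      have P: "prepared s" "prepared s'" "scalar s ''i'' = r" "scalar s' ''i'' = r" using s by (auto simp: s'_def)
      note g = val[OF local(1) P(1,3) r] and h = val[OF local(2) P(2,4) r]
      have step: "?sum f r + eval f (at_rank canonical r) = ?sum f (Suc r)" for f using r by simp
      have fits: "fits B g s" "fits B h s'"
        using local_expr_bound[OF P(1,3) r local(1)] local_expr_bound[OF P(2,4) r local(2)] size'
        by (auto elim!: order_trans[rotated])
      have le: "?sum g (Suc r) \<le> B" "?sum h (Suc r) \<le> B"
        using bound[OF local(1) r] bound[OF local(2) r] size' by linarith+
      have "?sum g r \<le> B" "?sum h r \<le> B"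
        using le step[of g] step[of h] by linarith+
      moreover have eg: "eval (Op Add (Var ''p'') g) s = ?sum g (Suc r)"
        using s g step[of g] by simp
      have run1: "run (Assign ''p'' (Op Add (Var ''p'') g)) s = s'" by (simp only: run.simps eg s'_def)
      have eh: "eval (Op Add (Var ''q'') h) s' = ?sum h (Suc r)"
        using s h step[of h] by (simp add: s'_def)
      have "scalar s ''p'' = ?sum g r" "scalar s' ''q'' = ?sum h r" using s by (simp_all add: s'_def)
      ultimately have "fits B (Op Add (Var ''p'') g) s" "fits B (Op Add (Var ''q'') h) s'"
        unfolding fits.simps eg eh using fits le by simp_all
      then have "runs B ?body s" by (simp only: runs.simps run1)
      moreover have "run ?body s = set_var ''q'' (?sum h (Suc r)) s'"
        by (simp only: run.simps(4) run1) (simp only: run.simps eh)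
      ultimately show "runs B ?body s \<and> scalar (run ?body s) ''i'' = r \<and> ?Inv (Suc r) (run ?body s)"
        using s by (simp add: s'_def)
    qed
  qed (auto simp: prepared_def)
  have sums: "?sum f (Suc n) = total f canonical" for f
    by (simp add: total_def atLeastLessThanSuc_atLeastAtMost)
  have "?sum f (Suc n) \<le> B" if "f = g \<or> f = h" for f
    using bound[of f n] local size' that by (cases "n = 0") (auto elim!: order_trans)
  then have le: "total g canonical \<le> B" "total h canonical \<le> B" unfolding sums by auto
  have final: "hoare B (?Inv (Suc n)) (Cond (Op Eq (Var ''p'') (Var ''q'')) Skip (Assign ''result'' (Const 1)))
     (steps (Cond (Op Eq (Var ''p'') (Var ''q'')) Skip (Assign ''result'' (Const 1))))
     (\<lambda>s. prepared s \<and> (scalar s ''result'' \<noteq> 0 \<longleftrightarrow> b \<or> total g canonical \<noteq> total h canonical))"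
    unfolding sums by (rule hoare_straight) (use le B1 in auto)
  show ?thesis
    unfolding test_prog_def
    by (rule hoare_conseq[OF hoare_Seq[OF init hoare_Seq[OF loop final]]]) (auto simp: algebra_simps)
qed

lemma hoare_tests_prog:
  assumes "\<And>g h. (g, h) \<in> set tests \<Longrightarrow> local_expr g \<and> local_expr h" "(n + m + 2) ^ tests_width tests \<le> B"
  shows "hoare B (\<lambda>s. prepared s \<and> (scalar s ''result'' \<noteq> 0 \<longleftrightarrow> b)) (tests_prog tests) (tests_cost tests * (n + m + 1))
    (\<lambda>s. scalar s ''result'' \<noteq> 0 \<longleftrightarrow> b \<or> (\<exists>(g, h) \<in> set tests. total g canonical \<noteq> total h canonical))"
  using assms
proof (induction tests arbitrary: b)
  case Nil
  have "hoare B (\<lambda>s. prepared s \<and> (scalar s ''result'' \<noteq> 0 \<longleftrightarrow> b)) Skip (steps Skip) (\<lambda>s. scalar s ''result'' \<noteq> 0 \<longleftrightarrow> b)"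
    by (rule hoare_straight) simp
  then show ?case by (auto simp: tests_cost_def elim: hoare_conseq)
next
  case (Cons gh tests)
  obtain g h where gh: "gh = (g, h)" by fastforce
  have size: "(n + m + 2) ^ (expr_size g + expr_size h + 1) \<le> B" "(n + m + 2) ^ tests_width tests \<le> B"
    by (rule le_trans[OF power_increasing Cons.prems(2)]; simp add: tests_width_def gh)+
  have local: "local_expr g" "local_expr h" using Cons.prems(1)[of g h] gh by auto
  have test: "hoare B (\<lambda>s. prepared s \<and> (scalar s ''result'' \<noteq> 0 \<longleftrightarrow> b)) (test_prog g h) ((cost g + cost h + 50) * (n + m + 1))
     (\<lambda>s. prepared s \<and> (scalar s ''result'' \<noteq> 0 \<longleftrightarrow> b \<or> total g canonical \<noteq> total h canonical))"
    by (rule hoare_test_prog[OF local size(1)])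
  have rest: "hoare B (\<lambda>s. prepared s \<and> (scalar s ''result'' \<noteq> 0 \<longleftrightarrow> b \<or> total g canonical \<noteq> total h canonical))
     (tests_prog tests) (tests_cost tests * (n + m + 1))
     (\<lambda>s. scalar s ''result'' \<noteq> 0 \<longleftrightarrow> (b \<or> total g canonical \<noteq> total h canonical) \<or>
        (\<exists>(g, h) \<in> set tests. total g canonical \<noteq> total h canonical))"
    by (rule Cons.IH[OF _ size(2)]) (use Cons.prems(1) in auto)
  show ?case
    unfolding gh tests_prog.simps
    by (rule hoare_conseq[OF hoare_Seq[OF test rest]]) (auto simp: tests_cost_def algebra_simps)
qed

text \<open>The 420 is made up of 20 for the ranks and 200 for each of the two other stages of
  preprocessing.\<close>

lemma full_prog_correct:
  assumes "\<And>g h. (g, h) \<in> set tests \<Longrightarrow> local_expr g \<and> local_expr h" "(n + m + 2) ^ tests_width tests \<le> B"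
    and "detects tests S"
  shows "\<exists>t s. exec B (full_prog tests) (input_state ord adj) t s \<and> t \<le> (420 + tests_cost tests) * (n + m + 1) \<and>
    (scalar s ''result'' \<noteq> 0 \<longleftrightarrow> (\<exists>t \<in> S. occurs G \<tau> t))"
proof -
  have common: "hoare B (\<lambda>s. profiled (Suc n) s \<and> blank {''stamp'', ''common_nbr'', ''common_gap''} s) common_prog
      (200 * (n + m + 1)) (\<lambda>s. prepared s \<and> (scalar s ''result'' \<noteq> 0 \<longleftrightarrow> False))"
    by (rule hoare_conseq[OF hoare_common_prog]) auto
  have "blank work_arrays (input_state ord adj)" by (auto simp: blank_def input_state_def)
  then obtain t s where "exec B (full_prog tests) (input_state ord adj) t s"
    "t \<le> 20 * (n + m + 1) + (200 * (n + m + 1) + (200 * (n + m + 1) + tests_cost tests * (n + m + 1)))"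
    "scalar s ''result'' \<noteq> 0 \<longleftrightarrow> False \<or> (\<exists>(g, h) \<in> set tests. total g canonical \<noteq> total h canonical)"
    using hoare_Seq[OF hoare_rank_prog hoare_Seq[OF hoare_profile_prog hoare_Seq[OF common
        hoare_tests_prog[OF assms(1,2)]]]] loaded_input_state
    unfolding hoare_def full_prog_def by blast
  moreover have "(\<exists>(g, h) \<in> set tests. total g canonical \<noteq> total h canonical) \<longleftrightarrow> (\<exists>t \<in> S. occurs G \<tau> t)"
    using assms(3) prepared_canonical unfolding detects_def has_type_iff_occurs by blast
  ultimately show ?thesis
    by (intro exI[of _ t] exI[of _ s]) (simp add: algebra_simps)
qed

end

lemma linear_time_detectable_types:
  assumes "detectable_types S"
  shows "linear_time_detectable (type_pattern ` S)"
proof -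
  obtain tests where tests: "\<And>g h. (g, h) \<in> set tests \<Longrightarrow> local_expr g \<and> local_expr h"
    and detects: "\<And>n E. ranked_graph n E \<Longrightarrow> ranked_graph.detects n E tests S"
    using detectable_types_tests[OF assms] by blast
  \<comment> \<open>The summand 2 yields the linear word bound of \<open>graph_input\<close>, as
    \<open>2 * M\<close> is at most the square of \<open>M\<close> for \<open>M\<close> at least 2;
    the width covers the values in the tests.\<close>
  define w where "w = tests_width tests + 2"
  have "\<exists>t s. exec ((card (verts G) + card (edges G) + 2) ^ w) (full_prog tests) (input_state ord adj) t s \<and>
        t \<le> (420 + tests_cost tests) * (card (verts G) + card (edges G) + 1) \<and>
        (scalar s ''result'' \<noteq> 0 \<longleftrightarrow> (\<exists>P \<in> type_pattern ` S. contains_pattern G \<tau> P))"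
    if G: "ordered_graph G \<tau>" "represents ord adj G \<tau>" for G \<tau> ord adj
  proof -
    let ?M = "card (verts G) + card (edges G) + 2"
    have "2 * ?M \<le> ?M ^ 2" by (simp add: power2_eq_square)
    also have "\<dots> \<le> ?M ^ w" by (rule power_increasing) (auto simp: w_def)
    finally interpret graph_input ord adj G \<tau> "?M ^ w"
      using G by unfold_locales
    have eq: "n = card (verts G)" "m = card (edges G)" by (simp_all add: card_verts m_def)
    have "(n + m + 2) ^ tests_width tests \<le> ?M ^ w"
      unfolding eq by (rule power_increasing) (auto simp: w_def)
    from full_prog_correct[OF tests this detects[OF ranked_graph_axioms]]
    show ?thesis using G by (simp add: eq contains_type_pattern)
  qed
  then show ?thesis
    unfolding linear_time_detectable_def Let_def by blast
qed

theorem theorem2: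
  fixes C :: "nat ugraph set" and F :: "pattern set"
  assumes "\<forall>P \<in> F. is_pattern P \<and> card (pverts P) = 3"
    and "characterizes F C"
    and "C \<noteq> comparability_graphs"
    and "C \<noteq> co_comparability_graphs"
    and "C \<noteq> triangle_free_graphs"
    and "C \<noteq> co_triangle_free_graphs"
  shows "\<exists>F'. (\<forall>P \<in> F'. is_pattern P) \<and> characterizes F' C \<and> linear_time_detectable F'"
proof -
  obtain S where S: "C = avoiders S"
    using three_vertex_patterns_avoiders[OF assms(1,2)] .
  obtain S' where S': "detectable_types S'" "avoiders S' = avoiders S"
    using detectable_representative[of S] assms(3-6) unfolding S by blast
  have "\<forall>P \<in> type_pattern ` S'. is_pattern P" by (auto simp: is_pattern_type_pattern)
  moreover have "characterizes (type_pattern ` S') C"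
    using characterizes_type_patterns[of S'] S S'(2) by simp
  ultimately show ?thesis using linear_time_detectable_types[OF S'(1)] by blast
qed

end
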